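(* Let $r\ge2$ and let $\mathfrak p\in A$ be a non-constant monic irreducible polynomial. The function $\mathcal G_r(\cdot,t)\in\mathbb M_{\frac{q^{r-1}-1}{q-1}}(\rho)$ is a Hecke eigenform. Moreover, for any $\mathbf z\in\Omega^r$, we have $$\mathrm T_{\mathfrak p,r}(\mathcal G_r)(\mathbf z,t)=\mathfrak p^{1+q+\dots+q^{r-2}}\,\mathcal G_r(\mathbf z,t).$$
   Context: Basic notation. $A=\mathbb F_q[\theta]$, $K=\mathbb F_q(\theta)$, $|\cdot|$ is the norm at infinity with $|\theta|=q$, $K_\infty=\mathbb F_q((1/\theta))$, $\mathbb C_\infty$ is the completion of an algebraic closure of $K_\infty$. $\mathbb T=\{\sum_{n\ge0}a_nt^n\in\mathbb C_\infty[[t]] : |a_n|\to0\}$ with the Gauss norm; for $g=\sum a_nt^n\in\mathbb T$ and $\ell\in\mathbb Z$, $g^{(\ell)}=\sum a_n^{q^\ell}t^n$. For $a\in A$, $a(t):=a|_{\theta=t}$; for a matrix $\gamma=(a_{ij})$ over $A$, $\overline\gamma=(a_{ij}(t))$. $\tilde\pi=\theta(-\theta)^{1/(q-1)}\prod_{i\ge1}(1-\theta^{1-q^i})^{-1}$ and $\omega(t)=(-\theta)^{1/(q-1)}\prod_{i\ge0}(1-t/\theta^{q^i})^{-1}\in\mathbb T^\times$, for a fixed $(q-1)$-st root $(-\theta)^{1/(q-1)}$. $\Omega^r$ is the set of $\mathbf z=(z_1,\dots,z_r)^{\mathrm{tr}}\in\mathbb C_\infty^r$ with $K_\infty$-linearly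 independent entries and $z_r=1$ ($\Omega^1=\{1\}$). Write $\mathbf z=(z_1,\tilde{\mathbf z})$ with $\tilde{\mathbf z}=(z_2,\dots,z_r)^{\mathrm{tr}}\in\Omega^{r-1}$, $|\mathbf z|_\infty=\max_i|z_i|$, $|\mathbf z|_{\mathrm{im}}=\inf\{|z_1-\mathfrak a|:\mathfrak a\in K_\infty z_2+\dots+K_\infty z_r\}$, and $\mathfrak I_{\tilde{\mathbf z}}=\{\mathbf z=(z_1,\tilde{\mathbf z})\in\Omega^r:|z_1|=|\mathbf z|_{\mathrm{im}}\}$. For $n\ge1$, $\Omega^r_n$ is the set of $\mathbf z\in\Omega^r$ with $|b_1z_1+\dots+b_rz_r|\ge q^{-n}|\mathbf z|_\infty$ for all $(b_i)\in K_\infty^r$ with $\max|b_i|=1$. $\mathrm{Hol}(\Omega^r,\mathbb T^r)$ is the set of functions $\Omega^r\to\mathbb T^r$ each of whose entries is, on each $\Omega^r_n$, a uniform limit of rational functions in $\mathbb T(z_1,\dots,z_{r-1})$ without poles in $\Omega^r_n$. For $\gamma=(a_{ij})\in\mathrm{GL}_r(K_\infty)$, $j(\gamma;\mathbf z)=a_{r1}z_1+\dots+a_{rr}z_r$ and $\gamma\cdot\mathbf z=j(\gamma;\mathbf z)^{-1}\gamma\mathbf z$. The exponential of an $A$-lattice $\Lambda$ is $\exp_\Lambda(X)=X\prod_{0\ne\lambda\in\Lambda}(1-X/\lambda)$, and $u(\mathbf z)=\tilde\pi^{-1}\exp_{\Lambda_{\tilde{\mathbf z}}}(z_1)^{-1}$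 with $\Lambda_{\tilde{\mathbf z}}=Az_2+\dots+Az_r$. Vectorial forms. $\rho(\gamma)=\det(\overline\gamma)^{-1}\overline\gamma$ for $\gamma\in\mathrm{GL}_r(A)$. $\mathbb M_k(\rho)$ is the $\mathbb T$-module of $\mathcal P=(\mathcal P_1,\dots,\mathcal P_r)^{\mathrm{tr}}\in\mathrm{Hol}(\Omega^r,\mathbb T^r)$ such that $\mathcal P(\gamma\cdot\mathbf z)=j(\gamma;\mathbf z)^k\rho(\gamma)\mathcal P(\mathbf z)$ for all $\gamma\in\mathrm{GL}_r(A)$ and, for every $\tilde{\mathbf z}\in\Omega^{r-1}$, $(u\mathcal P_1,\mathcal P_2,\dots,\mathcal P_r)^{\mathrm{tr}}(\mathbf z)\to0$ as $|\mathbf z|_\infty\to\infty$ with $\mathbf z=(z_1,\tilde{\mathbf z})\in\mathfrak I_{\tilde{\mathbf z}}$ (these are the vectorial Drinfeld modular forms of weight $k$ with respect to $\rho$). Hecke operator. For $1\le\ell\le r$ let $B_{\ell,r}$ be the set of $r\times r$ matrices whose $i$-th column is the $i$-th unit vector for $i\ne\ell$ and whose $\ell$-th column is $(b_1,\dots,b_{\ell-1},\mathfrak p,0,\dots,0)^{\mathrm{tr}}$ with $b_i\in A$, $\deg b_i<\deg\mathfrak p$. For $\mathcal P\in\mathbb M_k(\rho)$, $$\mathrm T_{\mathfrak p,r}(\mathcal P)(\mathbf z)=\mathfrak p^k\sum_{\gamma\in\bigcup_{\ell=1}^rB_{\ell,r}}j(\gamma;\mathbf z)^{-k}\det(\overline\gamma)\,\overline\gamma^{-1}\mathcal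 P(\gamma\cdot\mathbf z).$$ For $\mathcal G_r$ the weight is $k=\frac{q^{r-1}-1}{q-1}$. The form $\mathcal G_r$. $s_i(\mathbf z,t)=\sum_{n\ge0}\exp_{A^r\mathbf z}(z_i/\theta^{n+1})t^n\in\mathbb T$, where $A^r\mathbf z=Az_1+\dots+Az_r$. Call $\nu\in\mathbb F_q^r\setminus\{0\}$ monic if $\nu_\ell=1$ for the largest $\ell$ with $\nu_\ell\ne0$; $\mathrm{Eis}_\nu(\mathbf z)=\sum\frac1{a_1z_1+\dots+a_rz_r}$ over $(a_i)\in K^r$ with $(a_i)\equiv\theta^{-1}\nu\pmod{A^r}$; $h_r(\mathbf z)=\tilde\pi^{\frac{1-q^r}{q-1}}(-\theta)^{1/(q-1)}\prod_{\nu\text{ monic}}\mathrm{Eis}_\nu(\mathbf z)$. Then $$\mathcal G_r(\mathbf z,t)=\frac{\tilde\pi^{\frac{q^r-1}{q-1}}h_r(\mathbf z)}{\omega(t)^{(r-1)}}\big(s_1^{(r-1)}(\mathbf z,t),\dots,s_r^{(r-1)}(\mathbf z,t)\big)^{\mathrm{tr}}.$$ *)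

theory Defs
  imports
    "Jordan_Normal_Form.Determinant"
    "HOL-Algebra.Algebraic_Closure_Type"
    "HOL-Computational_Algebra.Computational_Algebra"
    "HOL-Library.Cardinality"
    "HOL-Library.Poly_Mapping"
    "HOL-Analysis.Infinite_Sum"
begin

text \<open>
  Vectors and matrices are those of \<open>Jordan_Normal_Form\<close>; their indices start at 0, so the
  entries \<open>z\<^sub>1, \<dots>, z\<^sub>r\<close> are \<open>z $ 0, \<dots>, z $ (r - 1)\<close>.

  The finite field is a type \<open>'k\<close> with \<open>q = CARD('k)\<close>. The ring \<open>A\<close> is \<open>'k poly\<close>
  and the completion of its quotient field at infinity is \<open>'k fls\<close>, whose
  variable \<open>fls_X\<close> is \<open>1/\<theta>\<close>, so that \<open>\<theta> = fls_X_inv\<close>.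
\<close>

text \<open>The absolute value is the distance to 0; the library's \<open>norm\<close> is reserved for
  real normed spaces, which do not exist in positive characteristic.\<close>

class complete_nonarch_field = field + complete_space +
  assumes dist_diff: "dist x y = dist (x - y) 0"
    and dist_zero_mult: "dist (x * y) 0 = dist x 0 * dist y 0"
    and dist_zero_add: "dist (x + y) 0 \<le> max (dist x 0) (dist y 0)"

definition vabs :: "'c::complete_nonarch_field \<Rightarrow> real" where
  "vabs x = dist x 0"

definition poly_to_Kinf :: "'k::field poly \<Rightarrow> 'k fls" where
  "poly_to_Kinf a = poly (map_poly fls_const a) fls_X_inv"

definition K_set :: "'k::field fls set" where
  "K_set = {poly_to_Kinf a / poly_to_Kinf b | a b. b \<noteq> 0}"

definition vnorm :: "'c::complete_nonarch_field vec \<Rightarrow> real" where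
  "vnorm z = Max ((\<lambda>i. vabs (z $ i)) ` {..<dim_vec z})"

definition tl_vec :: "'c vec \<Rightarrow> 'c vec" where
  "tl_vec z = vec (dim_vec z - 1) (\<lambda>i. z $ Suc i)"

definition GL_A :: "nat \<Rightarrow> 'k::field poly mat set" where
  "GL_A r = {\<gamma> \<in> carrier_mat r r. invertible_mat \<gamma>}"

subsection \<open>The Tate algebra, as a subset of the formal power series in \<open>t\<close>\<close>

definition tate :: "'c::complete_nonarch_field fps set" where
  "tate = {g. (\<lambda>n. vabs (fps_nth g n)) \<longlonglongrightarrow> 0}"

definition gauss_norm :: "'c::complete_nonarch_field fps \<Rightarrow> real" where
  "gauss_norm g = (SUP n. vabs (fps_nth g n))"

text \<open>The metric of the type \<open>'c fps\<close> is the \<open>t\<close>-adic one, so limits for the Gauss norm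
  are spelled out.\<close>

definition tate_lim :: "(nat \<Rightarrow> 'c::complete_nonarch_field fps) \<Rightarrow> 'c fps" where
  "tate_lim g = (THE h. h \<in> tate \<and> (\<lambda>n. gauss_norm (g n - h)) \<longlonglongrightarrow> 0)"

definition tate_units :: "'c::complete_nonarch_field fps set" where
  "tate_units = {g \<in> tate. \<exists>h\<in>tate. g * h = 1}"

text \<open>Polynomials in \<open>z\<^sub>1, \<dots>, z\<^bsub>r-1\<^esub>\<close> over the Tate algebra are finitely supported maps
  from exponents to coefficients.\<close>

definition tate_polys :: "nat \<Rightarrow> ((nat \<Rightarrow>\<^sub>0 nat) \<Rightarrow>\<^sub>0 'c::complete_nonarch_field fps) set" where
  "tate_polys r = {P. \<forall>m\<in>Poly_Mapping.keys P.
     Poly_Mapping.lookup P m \<in> tate \<and> Poly_Mapping.keys m \<subseteq> {..<r - 1}}"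

definition tate_poly_eval ::
    "((nat \<Rightarrow>\<^sub>0 nat) \<Rightarrow>\<^sub>0 'c::complete_nonarch_field fps) \<Rightarrow> 'c vec \<Rightarrow> 'c fps" where
  "tate_poly_eval P z =
     (\<Sum>m\<in>Poly_Mapping.keys P. Poly_Mapping.lookup P m *
        fps_const (\<Prod>i\<in>Poly_Mapping.keys m. (z $ i) ^ Poly_Mapping.lookup m i))"

text \<open>Values on \<open>S\<close> of rational functions without poles in \<open>S\<close>. Regularity at \<open>z\<close> of a
  Tate-algebra-valued function means that the denominator of a reduced fraction takes a unit
  value at \<open>z\<close>. Since polynomial rings over the Tate algebra are factorial, the reduced
  denominator divides all others, so a single fraction works for all points of \<open>S\<close>.\<close>

definition regular_rational :: "nat \<Rightarrow> 'c::complete_nonarch_field vec set \<Rightarrow> ('c vec \<Rightarrow> 'c fps) set"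
  where "regular_rational r S =
    {f. \<exists>P\<in>tate_polys r. \<exists>Q\<in>tate_polys r.
        \<forall>z\<in>S. tate_poly_eval Q z \<in> tate_units \<and>
              f z = tate_poly_eval P z * inverse (tate_poly_eval Q z)}"

definition frob_twist :: "nat \<Rightarrow> nat \<Rightarrow> 'c::complete_nonarch_field fps \<Rightarrow> 'c fps" where
  "frob_twist q l g = Abs_fps (\<lambda>n. fps_nth g n ^ (q ^ l))"

subsection \<open>The exponential function of a discrete subgroup\<close>

text \<open>The infinite product is the limit of the net of finite subproducts.\<close>

definition lattice_exp :: "'c::complete_nonarch_field set \<Rightarrow> 'c \<Rightarrow> 'c" where
  "lattice_exp L x =
     x * Lim (finite_subsets_at_top (L - {0})) (\<lambda>F. \<Prod>y\<in>F. 1 - x / y)"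

subsection \<open>The matrices of the Hecke correspondence\<close>

definition hecke_B :: "'k::field poly \<Rightarrow> nat \<Rightarrow> nat \<Rightarrow> 'k poly mat set" where
  "hecke_B \<pp> r l =
     {mat r r (\<lambda>(i, j). if j \<noteq> l then (if i = j then 1 else 0)
                         else if i < l then b i else if i = l then \<pp> else 0)
      | b. \<forall>i<l. Polynomial.degree (b i) < Polynomial.degree \<pp>}"

text \<open>In the Hecke operator, \<open>det(\<gamma>) \<gamma>\<^sup>-\<^sup>1\<close> has entries in the Tate algebra although \<open>\<gamma>\<close>
  need not be invertible over it; it is written as the adjugate matrix. The following lemma
  identifies the two over the field of Laurent series in \<open>t\<close>.\<close>

lemma adj_mat_eq_det_smult_inverse:
  fixes M :: "'c::field fps mat" and N :: "'c fls mat"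
  assumes M: "M \<in> carrier_mat n n" and N: "N \<in> carrier_mat n n"
    and inv: "map_mat fps_to_fls M * N = 1\<^sub>m n"
  shows "map_mat fps_to_fls (adj_mat M) = fps_to_fls (det M) \<cdot>\<^sub>m N"
proof -
  interpret h: comm_ring_hom "fps_to_fls :: 'c fps \<Rightarrow> 'c fls"
    by unfold_locales (auto simp: fls_eq_iff fls_times_fps_to_fls)
  note adj = adj_mat[OF M]
  have "map_mat fps_to_fls (adj_mat M) * map_mat fps_to_fls M
      = map_mat fps_to_fls (det M \<cdot>\<^sub>m 1\<^sub>m n)"
    using h.mat_hom_mult[OF adj(1) M] adj(3) by simp
  also have "\<dots> = fps_to_fls (det M) \<cdot>\<^sub>m 1\<^sub>m n"
    by (auto intro!: eq_matI)
  finally have *: "map_mat fps_to_fls (adj_mat M) * map_mat fps_to_fls M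
      = fps_to_fls (det M) \<cdot>\<^sub>m 1\<^sub>m n" .
  have "map_mat fps_to_fls (adj_mat M)
      = map_mat fps_to_fls (adj_mat M) * (map_mat fps_to_fls M * N)"
    using adj(1) inv by simp
  also have "\<dots> = map_mat fps_to_fls (adj_mat M) * map_mat fps_to_fls M * N"
    using adj(1) M N by (subst assoc_mult_mat[where n\<^sub>1 = n and n\<^sub>2 = n and n\<^sub>3 = n and n\<^sub>4 = n]) auto
  also have "\<dots> = fps_to_fls (det M) \<cdot>\<^sub>m N"
    unfolding * using N by (subst mult_smult_assoc_mat[where nr = n and n = n and nc = n]) auto
  finally show ?thesis .
qed

subsection \<open>The field of constants and the vectorial forms\<close>

text \<open>The type \<open>'c\<close> with the map \<open>\<iota>\<close> is a completion of an algebraic closure of \<open>'k fls\<close>: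
  a complete valued field in which the algebraic closure embeds with dense image, the absolute value
  extending the one of \<open>'k fls\<close>. The element \<open>\<kappa>\<close> is the fixed root of \<open>-\<theta>\<close>.\<close>

locale drinfeld_setting =
  fixes \<iota> :: "'k::{field,finite} fls alg_closure \<Rightarrow> 'c::complete_nonarch_field"
    and \<kappa> :: 'c
  assumes emb_add: "\<iota> (x + y) = \<iota> x + \<iota> y"
    and emb_mult: "\<iota> (x * y) = \<iota> x * \<iota> y"
    and emb_one: "\<iota> 1 = 1"
    and emb_norm: "b \<noteq> 0 \<Longrightarrow> vabs (\<iota> (to_ac b)) = real CARD('k) powi (- fls_subdegree b)"
    and emb_dense: "closure (range \<iota>) = UNIV"
    and kappa_root: "\<kappa> ^ (CARD('k) - 1) = - \<iota> (to_ac fls_X_inv)"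
begin

definition of_Kinf :: "'k fls \<Rightarrow> 'c" where
  "of_Kinf b = \<iota> (to_ac b)"

definition of_A :: "'k poly \<Rightarrow> 'c" where
  "of_A a = of_Kinf (poly_to_Kinf a)"

definition theta :: 'c where
  "theta = of_Kinf fls_X_inv"

definition at_t :: "'k poly \<Rightarrow> 'c fps" where
  "at_t a = fps_of_poly (map_poly (\<lambda>c. of_Kinf (fls_const c)) a)"

definition bar :: "'k poly mat \<Rightarrow> 'c fps mat" where
  "bar \<gamma> = map_mat at_t \<gamma>"

definition carlitz_period :: 'c where
  "carlitz_period =
     theta * \<kappa> * lim (\<lambda>N. \<Prod>i=1..N. inverse (1 - inverse (theta ^ (CARD('k) ^ i - 1))))"

definition omega :: "'c fps" where
  "omega = fps_const \<kappa> *
     tate_lim (\<lambda>N. \<Prod>i<N. inverse (1 - fps_const (inverse (theta ^ (CARD('k) ^ i))) * fps_X))"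

definition lin_comb :: "'k fls vec \<Rightarrow> 'c vec \<Rightarrow> 'c" where
  "lin_comb b z = (\<Sum>i<dim_vec z. of_Kinf (b $ i) * z $ i)"

definition Omega :: "nat \<Rightarrow> 'c vec set" where
  "Omega r = {z \<in> carrier_vec r. z $ (r - 1) = 1 \<and>
     (\<forall>b\<in>carrier_vec r. lin_comb b z = 0 \<longrightarrow> b = 0\<^sub>v r)}"

definition im_norm :: "'c vec \<Rightarrow> real" where
  "im_norm z = (INF b\<in>carrier_vec (dim_vec z - 1). vabs (z $ 0 - lin_comb b (tl_vec z)))"

definition cusp_domain :: "nat \<Rightarrow> 'c vec \<Rightarrow> 'c vec set" where
  "cusp_domain r w = {z \<in> Omega r. tl_vec z = w \<and> vabs (z $ 0) = im_norm z}"

definition Omega_n :: "nat \<Rightarrow> nat \<Rightarrow> 'c vec set" where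
  "Omega_n r n = {z \<in> Omega r. \<forall>b\<in>carrier_vec r. vnorm (map_vec of_Kinf b) = 1 \<longrightarrow>
     vabs (lin_comb b z) \<ge> real CARD('k) powi (- int n) * vnorm z}"

definition Hol :: "nat \<Rightarrow> ('c vec \<Rightarrow> 'c fps vec) set" where
  "Hol r = {P. (\<forall>z\<in>Omega r. P z \<in> carrier_vec r \<and> (\<forall>i<r. P z $ i \<in> tate)) \<and>
     (\<forall>i<r. \<forall>n\<ge>1. \<forall>\<epsilon>>0. \<exists>f\<in>regular_rational r (Omega_n r n).
        \<forall>z\<in>Omega_n r n. gauss_norm (P z $ i - f z) < \<epsilon>)}"

definition jfac :: "'k fls mat \<Rightarrow> 'c vec \<Rightarrow> 'c" where
  "jfac \<gamma> z = lin_comb (row \<gamma> (dim_row \<gamma> - 1)) z"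

definition act :: "'k fls mat \<Rightarrow> 'c vec \<Rightarrow> 'c vec" where
  "act \<gamma> z = inverse (jfac \<gamma> z) \<cdot>\<^sub>v (map_mat of_Kinf \<gamma> *\<^sub>v z)"

text \<open>For \<open>\<gamma> \<in> GL_A r\<close> the determinant of \<open>bar \<gamma>\<close> is a nonzero constant, hence the inverse
  in the ring of power series is the one in the Tate algebra.\<close>

definition rho :: "'k poly mat \<Rightarrow> 'c fps mat" where
  "rho \<gamma> = inverse (det (bar \<gamma>)) \<cdot>\<^sub>m bar \<gamma>"

definition A_lattice :: "'c vec \<Rightarrow> 'c set" where
  "A_lattice z = {lin_comb (map_vec poly_to_Kinf a) z | a. a \<in> carrier_vec (dim_vec z)}"

definition u_param :: "'c vec \<Rightarrow> 'c" where
  "u_param z = inverse carlitz_period * inverse (lattice_exp (A_lattice (tl_vec z)) (z $ 0))"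

definition vect_forms :: "nat \<Rightarrow> nat \<Rightarrow> ('c vec \<Rightarrow> 'c fps vec) set" where
  "vect_forms r k = {P \<in> Hol r.
     (\<forall>\<gamma>\<in>GL_A r. \<forall>z\<in>Omega r.
        P (act (map_mat poly_to_Kinf \<gamma>) z) =
          fps_const (jfac (map_mat poly_to_Kinf \<gamma>) z ^ k) \<cdot>\<^sub>v (rho \<gamma> *\<^sub>v P z)) \<and>
     (\<forall>w\<in>Omega (r - 1). \<forall>\<epsilon>>0. \<exists>R. \<forall>z\<in>cusp_domain r w. vnorm z > R \<longrightarrow>
        gauss_norm (fps_const (u_param z) * P z $ 0) < \<epsilon> \<and>
        (\<forall>i\<in>{1..<r}. gauss_norm (P z $ i) < \<epsilon>))}"

definition hecke :: "'k poly \<Rightarrow> nat \<Rightarrow> nat \<Rightarrow> ('c vec \<Rightarrow> 'c fps vec) \<Rightarrow> 'c vec \<Rightarrow> 'c fps vec" where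
  "hecke \<pp> r k P z = vec r (\<lambda>i. fps_const (of_A \<pp> ^ k) *
     (\<Sum>\<gamma>\<in>(\<Union>l<r. hecke_B \<pp> r l).
        fps_const (inverse (jfac (map_mat poly_to_Kinf \<gamma>) z ^ k)) *
        (adj_mat (bar \<gamma>) *\<^sub>v P (act (map_mat poly_to_Kinf \<gamma>) z)) $ i))"

text \<open>Eigenforms are nonzero, and eigenvectors of the operators at all monic primes, with
  eigenvalues in the base ring of the module of vectorial forms.\<close>

definition hecke_eigenform :: "nat \<Rightarrow> nat \<Rightarrow> ('c vec \<Rightarrow> 'c fps vec) \<Rightarrow> bool" where
  "hecke_eigenform r k P \<longleftrightarrow>
     P \<in> vect_forms r k \<and> (\<exists>z\<in>Omega r. P z \<noteq> 0\<^sub>v r) \<and>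
     (\<forall>\<pp>. Factorial_Ring.irreducible \<pp> \<and> Polynomial.lead_coeff \<pp> = 1 \<longrightarrow>
        (\<exists>c\<in>tate. \<forall>z\<in>Omega r. hecke \<pp> r k P z = c \<cdot>\<^sub>v P z))"

definition s_fun :: "nat \<Rightarrow> 'c vec \<Rightarrow> 'c fps" where
  "s_fun i z = Abs_fps (\<lambda>n. lattice_exp (A_lattice z) (z $ i / theta ^ (n + 1)))"

definition monic_vecs :: "nat \<Rightarrow> 'k vec set" where
  "monic_vecs r = {\<nu> \<in> carrier_vec r. \<exists>l<r. \<nu> $ l = 1 \<and> (\<forall>i. l < i \<and> i < r \<longrightarrow> \<nu> $ i = 0)}"

definition Eis :: "'k vec \<Rightarrow> 'c vec \<Rightarrow> 'c" where
  "Eis \<nu> z = (\<Sum>\<^sub>\<infinity>a\<in>{a \<in> carrier_vec (dim_vec z). \<forall>i<dim_vec z. a $ i \<in> K_set \<and>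
        a $ i - fls_const (\<nu> $ i) / fls_X_inv \<in> range poly_to_Kinf}.
      inverse (lin_comb a z))"

definition h_fun :: "nat \<Rightarrow> 'c vec \<Rightarrow> 'c" where
  "h_fun r z = inverse carlitz_period ^ ((CARD('k) ^ r - 1) div (CARD('k) - 1)) * \<kappa> *
     (\<Prod>\<nu>\<in>monic_vecs r. Eis \<nu> z)"

definition G_form :: "nat \<Rightarrow> 'c vec \<Rightarrow> 'c fps vec" where
  "G_form r z = vec r (\<lambda>i.
     fps_const (carlitz_period ^ ((CARD('k) ^ r - 1) div (CARD('k) - 1)) * h_fun r z) *
     inverse (frob_twist CARD('k) (r - 1) omega) * frob_twist CARD('k) (r - 1) (s_fun i z))"

end

end

theory Submission
  imports Defs "Jordan_Normal_Form.Char_Poly"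
begin

text \<open>
  The form is a vector product of Eisenstein series. Put \<open>E\<^sub>j = \<Sum> a(t) / (a \<cdot> z)\<^bsup>q\<^sup>j\<^esup>\<close>, a row vector,
  the sum being over \<open>a \<in> A\<^sup>r\<close>, \<open>a \<noteq> 0\<close>, and let \<open>s\<^bsup>(i)\<^esup>\<close> be the \<open>i\<close>-th twist of
  \<open>(s\<^sub>1, \<dots>, s\<^sub>r)\<close>. Sums of powers over torsion points show that \<open>E\<^sub>j \<cdot> s\<^bsup>(i)\<^esup>\<close> vanishes for
  \<open>0 < i - j < r\<close> and is \<open>1 / (t - \<theta>\<^bsup>q\<^sup>j\<^esup>)\<close> for \<open>i = j\<close>. So the vector product of
  \<open>E\<^sub>0, \<dots>, E\<^bsub>r-2\<^esub>\<close> is proportional to \<open>s\<^bsup>(r-1)\<^esup>\<close>. The factor contains the determinant \<open>D\<close>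
  of the matrix of the \<open>s\<^bsup>(i)\<^esup>\<close>. It satisfies the same twist equation as \<open>\<omega>\<close> up to a constant,
  whence \<open>D\<close> is a constant multiple of \<open>\<omega>\<close>, and its value at \<open>t = 0\<close>
  is a Moore determinant, the inverse of the product of the \<open>Eis\<^sub>\<nu>\<close>. Altogether the vector product
  equals the form exactly.

  Expanded, the vector product is a sum over \<open>(r - 1)\<close>-tuples of vectors of \<open>A\<^sup>r\<close>. A matrix \<open>\<gamma>\<close> of the
  Hecke correspondence restricts the sum to tuples in the sublattice \<open>A\<^sup>r \<gamma>\<close> of index
  \<open>|A/\<pp>|\<close>, and a given tuple lies in a number of these sublattices that is congruent to 1 modulo
  \<open>q\<close>. In characteristic \<open>p\<close> the sum over \<open>\<gamma>\<close> is therefore the form itself, and the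
  eigenvalue is the normalizing factor \<open>\<pp>\<^sup>k\<close>.
\<close>

section \<open>Complete non-archimedean fields\<close>

text \<open>The weight is built into the vector product: under the action the row
  \<open>E\<^sub>j\<close> acquires the factor \<open>jfac ^ (q ^ j)\<close>, and the exponents for
  \<open>j < r - 1\<close> add up to \<open>k\<close>. The adjugate in the Hecke operator undoes the
  matrix that the action leaves behind, and \<open>j^(-k)\<close> undoes the factor, so each summand
  is the same determinant with all its series restricted to a sublattice. This turns the Hecke sum
  into a matter of counting.

  Two obstacles shape the rest. A product of \<open>r - 1\<close> infinite series is hard to
  rearrange by tuples, so the count is made for lattice vectors in a ball, where everything is
  finite, and the ball then grows; coefficientwise convergence in \<open>t\<close> suffices. And a
  twist equation determines a power series only up to factors fixed by the twist, so comparing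
  \<open>D\<close> with \<open>omega\<close> also uses that both are units of the Tate algebra. The
  Eisenstein side is also the source of the analytic properties: its series converge uniformly on
  \<open>Omega_n\<close> and can be estimated termwise at the cusps, so holomorphy and the cusp
  condition are read off the determinant and not off \<open>s\<close>.\<close>

lemma dist_eq_vabs: "dist x y = vabs (x - y)"
  for x y :: "'c::complete_nonarch_field"
  unfolding vabs_def by (rule dist_diff)

lemma vabs_zero [simp]: "vabs 0 = 0"
  by (simp add: vabs_def)

lemma vabs_nonneg [simp]: "0 \<le> vabs x"
  by (simp add: vabs_def)

lemma vabs_eq_0_iff [simp]: "vabs x = 0 \<longleftrightarrow> x = 0"
  by (simp add: vabs_def)

lemma vabs_pos_iff [simp]: "0 < vabs x \<longleftrightarrow> x \<noteq> 0"
  by (simp add: vabs_def)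

lemma vabs_mult: "vabs (x * y) = vabs x * vabs y"
  by (simp add: vabs_def dist_zero_mult)

lemma vabs_one [simp]: "vabs 1 = 1"
proof -
  have "vabs (1::'a) * vabs (1::'a) = vabs (1::'a)"
    by (metis mult_1 vabs_mult)
  then show ?thesis by simp
qed

lemma vabs_minus [simp]: "vabs (- x) = vabs x"
proof -
  have "vabs (-1::'a) ^ 2 = 1"
    by (metis mult_minus1 power2_eq_square vabs_mult vabs_one minus_minus)
  then have "vabs (-1::'a) = 1"
    using vabs_nonneg[of "-1::'a"] by (auto simp: power2_eq_1_iff)
  then show ?thesis
    by (metis mult_minus1 vabs_mult mult_1)
qed

lemma vabs_minus_commute: "vabs (x - y) = vabs (y - x)"
  by (metis minus_diff_eq vabs_minus)

lemma vabs_add_le_max: "vabs (x + y) \<le> max (vabs x) (vabs y)"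
  by (simp add: vabs_def dist_zero_add)

lemma vabs_diff_le_max: "vabs (x - y) \<le> max (vabs x) (vabs y)"
  using vabs_add_le_max[of x "- y"] by simp

lemma vabs_add_le: "vabs x \<le> B \<Longrightarrow> vabs y \<le> B \<Longrightarrow> vabs (x + y) \<le> B"
  using vabs_add_le_max[of x y] by linarith

lemma vabs_diff_le: "vabs x \<le> B \<Longrightarrow> vabs y \<le> B \<Longrightarrow> vabs (x - y) \<le> B"
  using vabs_diff_le_max[of x y] by linarith

lemma vabs_add_eq: "vabs x < vabs y \<Longrightarrow> vabs (x + y) = vabs y"
  using vabs_add_le_max[of x y] vabs_diff_le_max[of "x + y" x] by auto

lemma vabs_one_minus: "vabs x < 1 \<Longrightarrow> vabs (1 - x) = 1"
  using vabs_add_eq[of "- x" 1] by simp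

lemma vabs_power: "vabs (x ^ n) = vabs x ^ n"
  by (induction n) (auto simp: vabs_mult)

lemma vabs_inverse: "vabs (inverse x) = inverse (vabs x)"
proof (cases "x = 0")
  case False
  then have "vabs x * vabs (inverse x) = 1"
    by (metis right_inverse vabs_mult vabs_one)
  then show ?thesis by (metis inverse_unique)
qed auto

lemma vabs_divide: "vabs (x / y) = vabs x / vabs y"
  by (simp add: divide_inverse vabs_mult vabs_inverse)

lemma vabs_prod: "vabs (prod f S) = (\<Prod>i\<in>S. vabs (f i))"
  by (induction S rule: infinite_finite_induct) (auto simp: vabs_mult)

lemma vabs_sum_le: "0 \<le> B \<Longrightarrow> (\<And>i. i \<in> S \<Longrightarrow> vabs (f i) \<le> B) \<Longrightarrow> vabs (sum f S) \<le> B"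
  by (induction S rule: infinite_finite_induct) (auto intro: vabs_add_le)

lemma vabs_sum_less:
  assumes "0 < B" "\<And>i. i \<in> S \<Longrightarrow> vabs (f i) < B"
  shows "vabs (sum f S) < B"
  using assms(2)
proof (induction S rule: infinite_finite_induct)
  case (insert i S)
  then have "max (vabs (f i)) (vabs (sum f S)) < B" by simp
  from le_less_trans[OF vabs_add_le_max this] show ?case using insert.hyps by simp
qed (use assms(1) in auto)

lemma vabs_triangle: "vabs (x + y) \<le> vabs x + vabs y"
  by (rule vabs_add_le) simp_all

lemma tendsto_vabs_iff: "(f \<longlongrightarrow> l) F \<longleftrightarrow> ((\<lambda>x. vabs (f x - l)) \<longlongrightarrow> 0) F"
  for l :: "'c::complete_nonarch_field"
  by (subst tendsto_dist_iff) (simp only: dist_eq_vabs)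

lemma tendsto_vabsI:
  fixes l :: "'c::complete_nonarch_field"
  assumes "(g \<longlongrightarrow> 0) F" "eventually (\<lambda>x. vabs (f x - l) \<le> g x) F"
  shows "(f \<longlongrightarrow> l) F"
  unfolding tendsto_vabs_iff
  by (rule tendsto_sandwich[OF _ assms(2) tendsto_const assms(1)]) auto

text \<open>Continuity of the field operations makes the generic results on limits and unordered
  sums available for these fields.\<close>

instance complete_nonarch_field \<subseteq> topological_ab_group_add
proof
  fix a b :: "'a::complete_nonarch_field"
  have fst: "((\<lambda>p. vabs (fst p - a)) \<longlongrightarrow> 0) (nhds a \<times>\<^sub>F nhds b)"
    unfolding tendsto_vabs_iff[symmetric] by (rule filterlim_fst)
  have snd: "((\<lambda>p. vabs (snd p - b)) \<longlongrightarrow> 0) (nhds a \<times>\<^sub>F nhds b)"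
    unfolding tendsto_vabs_iff[symmetric] by (rule filterlim_snd)
  have *: "((\<lambda>p. vabs (fst p - a) + vabs (snd p - b)) \<longlongrightarrow> 0) (nhds a \<times>\<^sub>F nhds b)"
    using tendsto_add[OF fst snd] by simp
  show "LIM x (nhds a \<times>\<^sub>F nhds b). fst x + snd x :> nhds (a + b)"
    by (rule tendsto_vabsI[OF *], rule always_eventually)
      (auto intro!: order_trans[OF _ vabs_triangle] simp: algebra_simps)
  have "((\<lambda>x. vabs (x - a)) \<longlongrightarrow> 0) (nhds a)"
    unfolding tendsto_vabs_iff[symmetric] by (rule filterlim_ident)
  then show "(uminus \<longlongrightarrow> - a) (nhds a)"
    unfolding tendsto_vabs_iff minus_diff_minus vabs_minus .
qed

instance complete_nonarch_field \<subseteq> topological_semigroup_mult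
proof
  fix a b :: "'a::complete_nonarch_field"
  let ?F = "nhds a \<times>\<^sub>F nhds b"
  have fst: "((\<lambda>p. vabs (fst p - a)) \<longlongrightarrow> 0) ?F"
    unfolding tendsto_vabs_iff[symmetric] by (rule filterlim_fst)
  have snd: "((\<lambda>p. vabs (snd p - b)) \<longlongrightarrow> 0) ?F"
    unfolding tendsto_vabs_iff[symmetric] by (rule filterlim_snd)
  have *: "((\<lambda>p. vabs (fst p - a) * vabs (snd p - b) + (vabs (fst p - a) * vabs b
      + vabs a * vabs (snd p - b))) \<longlongrightarrow> 0) ?F"
    using tendsto_add[OF tendsto_mult[OF fst snd] tendsto_add[OF tendsto_mult_right[OF fst]
          tendsto_mult_left[OF snd]], of "vabs b" "vabs a"] by simp
  show "LIM x ?F. fst x * snd x :> nhds (a * b)"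
  proof (rule tendsto_vabsI[OF *], rule always_eventually, rule allI)
    fix p :: "'a \<times> 'a"
    have "fst p * snd p - a * b = (fst p - a) * (snd p - b) + ((fst p - a) * b + a * (snd p - b))"
      by (simp add: algebra_simps)
    then show "vabs (fst p * snd p - a * b) \<le> vabs (fst p - a) * vabs (snd p - b)
        + (vabs (fst p - a) * vabs b + vabs a * vabs (snd p - b))"
      by (simp only: vabs_mult[symmetric])
        (intro order_trans[OF vabs_triangle] add_left_mono vabs_triangle)
  qed
qed

instance complete_nonarch_field \<subseteq> topological_monoid_mult ..
instance complete_nonarch_field \<subseteq> topological_comm_monoid_mult ..

lemma tendsto_pow_nonarch: "(f \<longlongrightarrow> l) F \<Longrightarrow> ((\<lambda>x. f x ^ n) \<longlongrightarrow> l ^ n) F"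
  for l :: "'c::complete_nonarch_field"
  by (induction n) (auto intro: tendsto_mult)

lemma tendsto_vabs: "(f \<longlongrightarrow> l) F \<Longrightarrow> ((\<lambda>x. vabs (f x)) \<longlongrightarrow> vabs l) F"
  for l :: "'c::complete_nonarch_field"
  unfolding vabs_def by (intro tendsto_intros)

lemma tendsto_inverse_nonarch:
  fixes l :: "'c::complete_nonarch_field"
  assumes f: "(f \<longlongrightarrow> l) F" and l: "l \<noteq> 0"
  shows "((\<lambda>x. inverse (f x)) \<longlongrightarrow> inverse l) F"
proof (rule tendsto_vabsI)
  show "((\<lambda>x. vabs (f x - l) / (vabs (f x) * vabs l)) \<longlongrightarrow> 0) F"
    using tendsto_divide[OF f[unfolded tendsto_vabs_iff]
        tendsto_mult_right[OF tendsto_vabs[OF f]], of "vabs l"] l by simp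
  have "eventually (\<lambda>x. f x \<noteq> 0) F"
    using l f by (rule tendsto_imp_eventually_ne[rotated])
  then show "eventually (\<lambda>x. vabs (inverse (f x) - inverse l)
      \<le> vabs (f x - l) / (vabs (f x) * vabs l)) F"
  proof eventually_elim
    case (elim x)
    then have "inverse (f x) - inverse l = (l - f x) / (f x * l)"
      using l by (simp add: field_simps)
    then show ?case by (simp add: vabs_divide vabs_mult vabs_minus_commute)
  qed
qed

text \<open>By the ultrametric inequality, closeness of all later terms to the single term
  \<open>s N\<close> already bounds their mutual distances.\<close>

lemma Cauchy_vabsI:
  fixes s :: "nat \<Rightarrow> 'c::complete_nonarch_field"
  assumes "\<And>e. e > 0 \<Longrightarrow> \<exists>N. \<forall>n\<ge>N. vabs (s n - s N) < e"
  shows "convergent s"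
proof -
  have "Cauchy s"
    unfolding Cauchy_def dist_eq_vabs
  proof (intro allI impI)
    fix e :: real assume "e > 0"
    then obtain N where N: "\<And>n. n \<ge> N \<Longrightarrow> vabs (s n - s N) < e"
      using assms by blast
    have "vabs (s m - s n) < e" if "m \<ge> N" "n \<ge> N" for m n
      using vabs_diff_le_max[of "s m - s N" "s n - s N"] N[OF that(1)] N[OF that(2)]
      by (simp add: algebra_simps)
    then show "\<exists>M. \<forall>m\<ge>M. \<forall>n\<ge>M. vabs (s m - s n) < e" by blast
  qed
  then show ?thesis by (simp add: Cauchy_convergent_iff)
qed

lemma tendsto_vabs_le:
  fixes l :: "'c::complete_nonarch_field"
  assumes "(f \<longlongrightarrow> l) F" "F \<noteq> bot" "eventually (\<lambda>x. vabs (f x) \<le> B) F"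
  shows "vabs l \<le> B"
  using tendsto_upperbound[OF tendsto_vabs[OF assms(1)] assms(3,2)] .

subsection \<open>Families tending to zero\<close>

text \<open>Convergence to 0 along the cofinite filter on \<open>I\<close>; over a complete
  non-archimedean field this is the natural criterion for unordered summability.\<close>

definition vanishing :: "('i \<Rightarrow> 'c::complete_nonarch_field) \<Rightarrow> 'i set \<Rightarrow> bool" where
  "vanishing f I \<longleftrightarrow> (\<forall>e>0. finite {i \<in> I. e \<le> vabs (f i)})"

lemma vanishingD: "vanishing f I \<Longrightarrow> e > 0 \<Longrightarrow> finite {i \<in> I. e \<le> vabs (f i)}"
  by (simp add: vanishing_def)

lemma vanishing_le:
  assumes "vanishing f I" "\<And>i. i \<in> I \<Longrightarrow> vabs (g i) \<le> C * vabs (f i)" "C > 0"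
  shows "vanishing g I"
  unfolding vanishing_def
proof (intro allI impI)
  fix e :: real assume e: "e > 0"
  have "{i \<in> I. e \<le> vabs (g i)} \<subseteq> {i \<in> I. e / C \<le> vabs (f i)}"
    using assms(2,3) by (auto simp: field_simps intro: order_trans)
  then show "finite {i \<in> I. e \<le> vabs (g i)}"
    using vanishingD[OF assms(1), of "e / C"] e assms(3) finite_subset by auto
qed

lemma vanishing_subset: "vanishing f I \<Longrightarrow> J \<subseteq> I \<Longrightarrow> vanishing f J"
  unfolding vanishing_def
proof (intro allI impI)
  fix e :: real assume "\<forall>e>0. finite {i \<in> I. e \<le> vabs (f i)}" "J \<subseteq> I" "e > 0"
  then show "finite {i \<in> J. e \<le> vabs (f i)}"
    by (intro finite_subset[of "{i \<in> J. e \<le> vabs (f i)}" "{i \<in> I. e \<le> vabs (f i)}"]) auto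
qed

text \<open>The finite set \<open>F n\<close> collects the terms of size at least
  \<open>1 / (n + 1)\<close>. By the ultrametric inequality a finite sum over any larger set differs
  from the sum over \<open>F n\<close> by at most \<open>1 / (n + 1)\<close>, however many terms are
  added.\<close>

lemma vanishing_imp_summable:
  assumes f: "vanishing f I"
  shows "f summable_on I"
proof -
  define F where "F n = {i \<in> I. 1 / real (Suc n) \<le> vabs (f i)}" for n
  have fin: "finite (F n)" and sub: "F n \<subseteq> I" for n
    using vanishingD[OF f, of "1 / real (Suc n)"] by (auto simp: F_def)
  have out: "vabs (f i) \<le> 1 / real (Suc n)" if "i \<in> I - F n" for i n
    using that by (auto simp: F_def)
  have mono: "F m \<subseteq> F n" if "m \<le> n" for m n
  proof -
    have "1 / real (Suc n) \<le> 1 / real (Suc m)" using that by (simp add: field_simps)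
    then show ?thesis by (auto simp: F_def)
  qed
  have diff: "vabs (sum f G - sum f (F n)) \<le> 1 / real (Suc n)"
    if "finite G" "G \<subseteq> I" "F n \<subseteq> G" for G n
  proof -
    have "sum f G - sum f (F n) = sum f (G - F n)"
      using that by (simp add: sum_diff)
    also have "vabs \<dots> \<le> 1 / real (Suc n)"
      using that by (intro vabs_sum_le out) auto
    finally show ?thesis .
  qed
  have "convergent (\<lambda>n. sum f (F n))"
  proof (rule Cauchy_vabsI)
    fix e :: real assume "e > 0"
    then obtain N where N: "1 / real (Suc N) < e" using nat_approx_posE by blast
    have "vabs (sum f (F n) - sum f (F N)) < e" if "n \<ge> N" for n
      using diff[OF fin sub mono[OF that]] N by linarith
    then show "\<exists>N. \<forall>n\<ge>N. vabs (sum f (F n) - sum f (F N)) < e" by blast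
  qed
  then obtain L where L: "(\<lambda>n. sum f (F n)) \<longlonglongrightarrow> L" by (auto simp: convergent_def)
  have Ln: "vabs (L - sum f (F n)) \<le> 1 / real (Suc n)" for n
  proof (rule tendsto_vabs_le)
    show "(\<lambda>m. sum f (F m) - sum f (F n)) \<longlonglongrightarrow> L - sum f (F n)"
      by (intro tendsto_intros L)
    show "\<forall>\<^sub>F m in sequentially. vabs (sum f (F m) - sum f (F n)) \<le> 1 / real (Suc n)"
      using eventually_ge_at_top[of n] by eventually_elim (intro diff fin sub mono)
  qed auto
  have "(f has_sum L) I"
    unfolding has_sum_def tendsto_iff
  proof (intro allI impI)
    fix e :: real assume "e > 0"
    then obtain N where N: "1 / real (Suc N) < e" using nat_approx_posE by blast
    have "dist (sum f G) L < e" if "finite G" "G \<subseteq> I" "F N \<subseteq> G" for G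
    proof -
      have "sum f G - L = (sum f G - sum f (F N)) - (L - sum f (F N))" by simp
      also have "vabs \<dots> \<le> 1 / real (Suc N)"
        by (intro vabs_diff_le diff Ln that)
      finally show ?thesis using N by (simp add: dist_eq_vabs)
    qed
    then show "\<forall>\<^sub>F G in finite_subsets_at_top I. dist (sum f G) L < e"
      unfolding eventually_finite_subsets_at_top
      by (intro exI[of _ "F N"]) (simp add: fin sub)
  qed
  then show ?thesis by (auto simp: summable_on_def)
qed

lemma vabs_has_sum_le:
  assumes "(f has_sum S) I" "0 \<le> B" "\<And>i. i \<in> I \<Longrightarrow> vabs (f i) \<le> B"
  shows "vabs S \<le> B"
proof (rule tendsto_vabs_le)
  show "(sum f \<longlongrightarrow> S) (finite_subsets_at_top I)" using assms(1) by (simp add: has_sum_def)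
  show "\<forall>\<^sub>F F in finite_subsets_at_top I. vabs (sum f F) \<le> B"
    by (rule eventually_finite_subsets_at_top_weakI) (auto intro!: vabs_sum_le assms)
qed auto

lemma vabs_infsum_le:
  assumes "0 \<le> B" "\<And>i. i \<in> I \<Longrightarrow> vabs (f i) \<le> B"
  shows "vabs (infsum f I) \<le> B"
proof (cases "f summable_on I")
  case True
  then show ?thesis using vabs_has_sum_le assms has_sum_infsum by blast
qed (use assms in \<open>simp add: infsum_not_exists\<close>)

lemma vabs_infsum_diff_le:
  assumes "vanishing f I" "finite S" "S \<subseteq> I" "0 \<le> B" "\<And>i. i \<in> I - S \<Longrightarrow> vabs (f i) \<le> B"
  shows "vabs (infsum f I - sum f S) \<le> B"
proof -
  have "infsum f I = infsum f S + infsum f (I - S)"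
    using assms(1,2,3) infsum_Un_disjoint[of f S "I - S"]
    by (simp add: Un_absorb1 vanishing_imp_summable vanishing_subset Diff_disjoint)
  moreover have "vabs (infsum f (I - S)) \<le> B"
    by (rule vabs_infsum_le[OF assms(4,5)])
  ultimately show ?thesis using assms(2) by simp
qed

text \<open>Lets unordered sums and products be evaluated along a sequence of balls.\<close>

lemma filterlim_finite_exhaustion:
  assumes "\<And>n. finite (B n)" "\<And>n. B n \<subseteq> I" "mono B" "I \<subseteq> (\<Union>n. B n)"
  shows "filterlim B (finite_subsets_at_top I) sequentially"
  unfolding filterlim_iff eventually_finite_subsets_at_top
proof (intro allI impI)
  fix P assume "\<exists>Z. finite Z \<and> Z \<subseteq> I \<and> (\<forall>Y. finite Y \<and> Z \<subseteq> Y \<and> Y \<subseteq> I \<longrightarrow> P Y)"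
  then obtain Z where Z: "finite Z" "Z \<subseteq> I" and P: "\<And>Y. finite Y \<Longrightarrow> Z \<subseteq> Y \<Longrightarrow> Y \<subseteq> I \<Longrightarrow> P Y"
    by metis
  have "\<exists>n. Z \<subseteq> B n"
    using Z
  proof (induction Z rule: finite_induct)
    case (insert x Z)
    then obtain n where n: "Z \<subseteq> B n" by auto
    obtain m where m: "x \<in> B m" using insert.prems assms(4) by auto
    have "insert x Z \<subseteq> B (max m n)"
      using m n monoD[OF assms(3), of m "max m n"] monoD[OF assms(3), of n "max m n"] by auto
    then show ?case by blast
  qed auto
  then obtain n where n: "Z \<subseteq> B n" by blast
  have "P (B m)" if "m \<ge> n" for m
    using P[OF assms(1), of m] n monoD[OF assms(3) that] assms(2) by blast
  then show "\<forall>\<^sub>F x in sequentially. P (B x)"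
    unfolding eventually_sequentially by blast
qed

lemma has_sum_exhaustion:
  assumes "(f has_sum S) I" "\<And>n. finite (B n)" "\<And>n. B n \<subseteq> I" "mono B" "I \<subseteq> (\<Union>n. B n)"
  shows "(\<lambda>n. sum f (B n)) \<longlonglongrightarrow> S"
  using filterlim_compose[OF assms(1)[unfolded has_sum_def] filterlim_finite_exhaustion[OF assms(2-5)]] .

no_notation fps_nth (infixl \<open>$\<close> 75)

section \<open>Finite subgroups of fields\<close>

definition add_subgroup :: "'c::field set \<Rightarrow> bool" where
  "add_subgroup V \<longleftrightarrow> 0 \<in> V \<and> (\<forall>x\<in>V. \<forall>y\<in>V. x + y \<in> V) \<and> (\<forall>x\<in>V. - x \<in> V)"

lemma add_subgroupD:
  assumes "add_subgroup V"
  shows "0 \<in> V" "x \<in> V \<Longrightarrow> y \<in> V \<Longrightarrow> x + y \<in> V" "x \<in> V \<Longrightarrow> - x \<in> V"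
    "x \<in> V \<Longrightarrow> y \<in> V \<Longrightarrow> x - y \<in> V"
  using assms by (auto simp: add_subgroup_def) (metis add_uminus_conv_diff)

lemma subgroup_prod_minus:
  assumes "add_subgroup V"
  shows "(\<Prod>v\<in>V. f (- v)) = (\<Prod>v\<in>V. f v)"
  by (rule prod.reindex_bij_witness[of _ uminus uminus]) (auto intro: add_subgroupD[OF assms])

lemma subgroup_sum_minus:
  assumes "add_subgroup V"
  shows "(\<Sum>v\<in>V. f (- v)) = (\<Sum>v\<in>V. f v)"
  by (rule sum.reindex_bij_witness[of _ uminus uminus]) (auto intro: add_subgroupD[OF assms])

lemma subgroup_prod_shift:
  assumes "add_subgroup V" "w \<in> V"
  shows "(\<Prod>v\<in>V. f (v + w)) = (\<Prod>v\<in>V. f v)"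
  by (rule prod.reindex_bij_witness[of _ "\<lambda>v. v - w" "\<lambda>v. v + w"])
    (use assms in \<open>auto intro: add_subgroupD[OF assms(1)]\<close>)

lemma degree_prod_linear:
  "finite V \<Longrightarrow> Polynomial.degree (\<Prod>v\<in>V. [:- v, 1::'c::field:]) = card V"
  by (subst degree_prod_sum_eq) auto

lemma coeff_prod_linear:
  assumes "finite V"
  shows "poly.coeff (\<Prod>v\<in>V. [:- v, 1::'c::field:]) (card V) = 1"
  using lead_coeff_prod[of "\<lambda>v. [:- v, 1::'c:]" V] degree_prod_linear[OF assms] by simp

text \<open>Lagrange interpolation on \<open>V\<close>. For a subgroup the denominators
  \<open>\<Prod>w\<in>V - {v}. v - w\<close> all equal the product of the nonzero elements, so they
  can be moved to the other side as one constant.\<close>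

lemma lagrange_subgroup:
  fixes f :: "'c::field poly"
  assumes V: "add_subgroup V" "finite V" and f: "Polynomial.degree f < card V"
  shows "(\<Sum>v\<in>V. Polynomial.smult (poly f v) (\<Prod>w\<in>V - {v}. [:- w, 1:]))
    = Polynomial.smult (\<Prod>u\<in>V - {0}. u) f" (is "?L = ?R")
proof (rule poly_eqI_degree[of V])
  fix x assume x: "x \<in> V"
  have "poly ?L x = (\<Sum>v\<in>V. poly f v * (\<Prod>w\<in>V - {v}. x - w))"
    by (simp add: poly_sum poly_prod)
  also have "\<dots> = (\<Sum>v\<in>{x}. poly f v * (\<Prod>w\<in>V - {v}. x - w))"
  proof (rule sum.mono_neutral_right)
    show "\<forall>v\<in>V - {x}. poly f v * (\<Prod>w\<in>V - {v}. x - w) = 0"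
      using V(2) x by (auto intro!: prod_zero)
  qed (use V x in auto)
  also have "(\<Prod>w\<in>V - {x}. x - w) = (\<Prod>u\<in>V - {0}. u)"
    by (rule prod.reindex_bij_witness[of _ "\<lambda>u. x - u" "\<lambda>w. x - w"])
      (use x add_subgroupD[OF V(1)] in auto)
  then have "(\<Sum>v\<in>{x}. poly f v * (\<Prod>w\<in>V - {v}. x - w)) = poly ?R x" by simp
  finally show "poly ?L x = poly ?R x" .
next
  have "Polynomial.degree (\<Prod>w\<in>V - {v}. [:- w, 1:]) \<le> card V - 1" if "v \<in> V" for v
    using degree_prod_linear[of "V - {v}"] V that by simp
  then have "Polynomial.degree ?L \<le> card V - 1"
    by (intro degree_sum_le V(2) order_trans[OF degree_smult_le])
  moreover have "card V \<noteq> 0"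
    using V(2) add_subgroupD(1)[OF V(1)] by auto
  ultimately show "Polynomial.degree ?L < card V" by linarith
  show "Polynomial.degree ?R < card V"
    using f degree_smult_le le_less_trans by blast
qed

text \<open>Compare the coefficients of degree \<open>card V - 1\<close> in the interpolation
  formula: the products on the left are monic of that degree, and \<open>f\<close> has smaller
  degree.\<close>

lemma sum_poly_subgroup_eq_0:
  fixes f :: "'c::field poly"
  assumes V: "add_subgroup V" "finite V" and f: "Polynomial.degree f < card V - 1"
  shows "(\<Sum>v\<in>V. poly f v) = 0"
proof -
  have c: "poly.coeff (\<Prod>w\<in>V - {v}. [:- w, 1:]) (card V - Suc 0) = 1" if "v \<in> V" for v
    using coeff_prod_linear[of "V - {v}"] V that by simp
  have "(\<Sum>v\<in>V. poly f v)
      = poly.coeff (\<Sum>v\<in>V. Polynomial.smult (poly f v) (\<Prod>w\<in>V - {v}. [:- w, 1:])) (card V - 1)"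
    by (simp add: Polynomial.coeff_sum c)
  also have "\<dots> = (\<Prod>u\<in>V - {0}. u) * poly.coeff f (card V - 1)"
    using f by (subst lagrange_subgroup[OF V]) auto
  also have "poly.coeff f (card V - 1) = 0"
    using f by (rule Polynomial.coeff_eq_0)
  finally show ?thesis by simp
qed

text \<open>The additive polynomial with zero set \<open>V\<close> (for a finite subgroup),
  normalized to have linear coefficient 1. Along the balls of a discrete subgroup it tends to
  \<open>lattice_exp\<close>.\<close>

definition fin_exp :: "'c::field set \<Rightarrow> 'c \<Rightarrow> 'c" where
  "fin_exp V x = x * (\<Prod>u\<in>V - {0}. 1 - x / u)"

lemma fin_exp_eq:
  assumes V: "add_subgroup V" "finite V"
  shows "(\<Prod>u\<in>V - {0}. u) * fin_exp V x = (\<Prod>v\<in>V. x - v)"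
proof -
  have "(\<Prod>u\<in>V - {0}. 1 - x / u) = (\<Prod>u\<in>V - {0}. 1 + x / u)"
    by (rule prod.reindex_bij_witness[of _ uminus uminus]) (use add_subgroupD[OF V(1)] in auto)
  then have "(\<Prod>u\<in>V - {0}. u) * fin_exp V x = x * ((\<Prod>u\<in>V - {0}. u) * (\<Prod>u\<in>V - {0}. 1 + x / u))"
    by (simp add: fin_exp_def)
  also have "(\<Prod>u\<in>V - {0}. u) * (\<Prod>u\<in>V - {0}. 1 + x / u) = (\<Prod>u\<in>V - {0}. x + u)"
    unfolding prod.distrib[symmetric] by (rule prod.cong) (auto simp: field_simps)
  also have "x * \<dots> = (\<Prod>u\<in>V. x + u)"
    using prod.remove[OF V(2) add_subgroupD(1)[OF V(1)], of "\<lambda>u. x + u"] by simp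
  also have "\<dots> = (\<Prod>v\<in>V. x - v)"
    using subgroup_prod_minus[OF V(1), of "\<lambda>v. x - v"] by simp
  finally show ?thesis .
qed

lemma subgroup_prod_nonzero: "finite V \<Longrightarrow> (\<Prod>u\<in>V - {0}. u) \<noteq> (0::'c::field)"
  by simp

text \<open>For fixed \<open>y\<close> the monic polynomials \<open>P(X + y)\<close> and
  \<open>P(X) + P(y)\<close> have the same degree \<open>card V\<close> and agree on all of
  \<open>V\<close>, because translation by an element of \<open>V\<close> permutes the factors.
  Their difference has too many zeros for its degree.\<close>

lemma subgroup_prod_add:
  fixes V :: "'c::field set"
  assumes V: "add_subgroup V" "finite V"
  shows "(\<Prod>v\<in>V. x + y - v) = (\<Prod>v\<in>V. x - v) + (\<Prod>v\<in>V. y - v)"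
proof -
  let ?P = "\<Prod>v\<in>V. [:- v, 1:]" and ?Q = "\<Prod>v\<in>V. [:- (v - y), 1:]"
  have inj: "inj_on (\<lambda>v. v - y) V" by (auto simp: inj_on_def)
  have Q: "?Q = (\<Prod>v\<in>(\<lambda>v. v - y) ` V. [:- v, 1:])"
    by (simp add: prod.reindex[OF inj])
  have "?Q = ?P + [:\<Prod>v\<in>V. y - v:]"
  proof (rule poly_eqI_degree_lead_coeff[of _ "card V" _ V])
    have "0 < card V" using V add_subgroupD(1)[OF V(1)] by (auto simp: card_gt_0_iff)
    then have "poly.coeff [:\<Prod>v\<in>V. y - v:] (card V) = 0" by (cases "card V") auto
    then show "poly.coeff ?Q (card V) = poly.coeff (?P + [:\<Prod>v\<in>V. y - v:]) (card V)"
      using coeff_prod_linear[OF V(2)] coeff_prod_linear[of "(\<lambda>v. v - y) ` V"] V(2)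
      by (simp only: Q card_image[OF inj] finite_imageI Polynomial.coeff_add add_0_right)
    show "Polynomial.degree ?Q \<le> card V"
      using degree_prod_linear[of "(\<lambda>v. v - y) ` V"] V(2)
      by (simp only: Q card_image[OF inj] finite_imageI order_refl)
    show "Polynomial.degree (?P + [:\<Prod>v\<in>V. y - v:]) \<le> card V"
      by (rule degree_add_le) (auto simp: degree_prod_linear[OF V(2)])
    fix z assume z: "z \<in> V"
    have "poly ?Q z = (\<Prod>v\<in>V. y - (v + - z))" by (simp add: poly_prod algebra_simps)
    also have "\<dots> = (\<Prod>v\<in>V. y - v)"
      by (rule subgroup_prod_shift[OF V(1), where f = "\<lambda>v. y - v"]) (use z add_subgroupD[OF V(1)] in auto)
    finally show "poly ?Q z = poly (?P + [:\<Prod>v\<in>V. y - v:]) z"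
      using V(2) z by (simp add: poly_prod prod_zero_iff)
  qed auto
  then have "poly ?Q x = poly (?P + [:\<Prod>v\<in>V. y - v:]) x" by simp
  then show ?thesis by (simp add: poly_prod algebra_simps)
qed

lemma fin_exp_add:
  assumes V: "add_subgroup V" "finite V"
  shows "fin_exp V (x + y) = fin_exp V x + fin_exp V y"
proof -
  have "(\<Prod>u\<in>V - {0}. u) * fin_exp V (x + y) = (\<Prod>u\<in>V - {0}. u) * (fin_exp V x + fin_exp V y)"
    by (simp only: fin_exp_eq[OF V] subgroup_prod_add[OF V] distrib_left)
  then show ?thesis using subgroup_prod_nonzero[OF V(2)] mult_left_cancel by blast
qed

text \<open>The partial fraction expansion of the reciprocal of
  \<open>\<Prod>v\<in>V. x - v\<close>, obtained by interpolating the constant 1. It is the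
  logarithmic derivative of an additive polynomial, whose derivative is constant.\<close>

lemma sum_inverse_subgroup:
  assumes V: "add_subgroup V" "finite V" and x: "x \<notin> V"
  shows "(\<Sum>v\<in>V. inverse (x + v)) = inverse (fin_exp V x)"
proof -
  let ?c = "\<Prod>u\<in>V - {0}. u"
  have nz: "(\<Prod>v\<in>V. x - v) \<noteq> 0" using V(2) x by auto
  have card: "0 < card V" using V add_subgroupD(1)[OF V(1)] by (auto simp: card_gt_0_iff)
  have "(\<Sum>v\<in>V. inverse (x - v)) * (\<Prod>v\<in>V. x - v) = (\<Sum>v\<in>V. \<Prod>w\<in>V - {v}. x - w)"
    unfolding sum_distrib_right
  proof (rule sum.cong[OF refl])
    fix v assume v: "v \<in> V"
    then have "x - v \<noteq> 0" using x by auto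
    then show "inverse (x - v) * (\<Prod>v\<in>V. x - v) = (\<Prod>w\<in>V - {v}. x - w)"
      by (simp add: prod.remove[OF V(2) v] field_simps)
  qed
  also have "\<dots> = poly (\<Sum>v\<in>V. Polynomial.smult (poly 1 v) (\<Prod>w\<in>V - {v}. [:- w, 1:])) x"
    by (simp add: poly_sum poly_prod)
  also have "\<dots> = ?c"
    using card by (subst lagrange_subgroup[OF V]) auto
  finally have 1: "(\<Sum>v\<in>V. inverse (x - v)) * (?c * fin_exp V x) = ?c"
    by (simp only: fin_exp_eq[OF V])
  then have "(\<Sum>v\<in>V. inverse (x - v)) * fin_exp V x = 1"
    using subgroup_prod_nonzero[OF V(2)] by (simp add: field_simps)
  moreover have "(\<Sum>v\<in>V. inverse (x + v)) = (\<Sum>v\<in>V. inverse (x - v))"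
    using subgroup_sum_minus[OF V(1), of "\<lambda>v. inverse (x - v)"] by simp
  ultimately show ?thesis by (metis inverse_unique mult.commute inverse_inverse_eq)
qed

section \<open>Counting vectors with entries in a finite set\<close>

lemma vecs_bij:
  "bij_betw (\<lambda>g. vec n g) (PiE {..<n} (\<lambda>_. S)) {v \<in> carrier_vec n. \<forall>i<n. v $ i \<in> S}"
proof (rule bij_betw_byWitness[where f' = "\<lambda>v. restrict (\<lambda>i. v $ i) {..<n}"])
  show "\<forall>g\<in>{..<n} \<rightarrow>\<^sub>E S. restrict (\<lambda>i. vec n g $ i) {..<n} = g"
    by (auto simp: fun_eq_iff restrict_def PiE_def extensional_def)
  show "\<forall>v\<in>{v \<in> carrier_vec n. \<forall>i<n. v $ i \<in> S}. vec n (restrict (\<lambda>i. v $ i) {..<n}) = v"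
    by (intro ballI eq_vecI) auto
  show "vec n ` ({..<n} \<rightarrow>\<^sub>E S) \<subseteq> {v \<in> carrier_vec n. \<forall>i<n. v $ i \<in> S}"
    by (auto simp: PiE_def Pi_def)
  show "(\<lambda>v. restrict (\<lambda>i. v $ i) {..<n}) ` {v \<in> carrier_vec n. \<forall>i<n. v $ i \<in> S} \<subseteq> {..<n} \<rightarrow>\<^sub>E S"
    by (auto simp: restrict_def split: if_splits)
qed

lemma finite_vecs: "finite S \<Longrightarrow> finite {v \<in> carrier_vec n. \<forall>i<n. v $ i \<in> S}"
  using bij_betw_finite[OF vecs_bij] finite_PiE[of "{..<n}" "\<lambda>_. S"] by blast

lemma card_vecs: "card {v \<in> carrier_vec n. \<forall>i<n. v $ i \<in> S} = card S ^ n"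
  using bij_betw_same_card[OF vecs_bij, of n S] card_PiE[of "{..<n}" "\<lambda>_. S"] by simp

lemma finite_carrier_vec: "finite (carrier_vec n :: 'k::finite vec set)"
  using finite_vecs[of "UNIV :: 'k set" n] by simp

lemma card_carrier_vec: "card (carrier_vec n :: 'k::finite vec set) = CARD('k) ^ n"
  using card_vecs[of n "UNIV :: 'k set"] by simp

subsection \<open>Finite fields and the Frobenius\<close>

lemma of_nat_card_finite_field: "of_nat CARD('k) = (0 :: 'k::{field,finite})"
proof -
  have "(\<Sum>x\<in>(UNIV::'k set). x) = (\<Sum>x\<in>UNIV. x + 1)"
    by (rule sum.reindex_bij_witness[of _ "\<lambda>x. x + 1" "\<lambda>x. x - 1"]) auto
  then show ?thesis by (simp add: sum.distrib)
qed

lemma finite_field_power_card: "c ^ CARD('k) = (c :: 'k::{field,finite})"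
proof (cases "c = 0")
  case False
  have "(\<Prod>x\<in>-{0::'k}. x) = (\<Prod>x\<in>-{0}. c * x)"
    by (rule prod.reindex_bij_witness[of _ "\<lambda>x. c * x" "\<lambda>x. x / c"]) (use False in auto)
  also have "\<dots> = c ^ (CARD('k) - 1) * (\<Prod>x\<in>-{0}. x)"
    by (simp add: prod.distrib Compl_eq_Diff_UNIV card_Diff_singleton)
  finally have "c ^ (CARD('k) - 1) = 1" by simp
  then show ?thesis
    by (metis mult.right_neutral power_minus_mult zero_less_card_finite mult_1)
qed auto

lemma card_finite_field_ge_2: "2 \<le> CARD('k::{field,finite})"
  using card_mono[of "UNIV :: 'k set" "{0, 1}"] by auto

locale finite_field_hom =
  fixes e :: "'k::{field,finite} \<Rightarrow> 'c::field"
  assumes e_add: "e (x + y) = e x + e y"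
    and e_mult: "e (x * y) = e x * e y"
    and e_one [simp]: "e 1 = 1"
begin

lemma e_zero [simp]: "e 0 = 0"
  using e_add[of 0 0] by (metis add.right_neutral add_left_cancel)

lemma e_minus: "e (- x) = - e x"
  using e_add[of x "- x"] by (simp add: eq_neg_iff_add_eq_0 add.commute)

lemma e_eq_0_iff [simp]: "e x = 0 \<longleftrightarrow> x = 0"
  by (metis e_mult e_one e_zero mult_zero_left right_inverse zero_neq_one)

lemma e_eq_iff [simp]: "e x = e y \<longleftrightarrow> x = y"
  by (metis e_add e_minus e_eq_0_iff add_uminus_conv_diff right_minus_eq)

lemma e_power: "e (x ^ n) = e x ^ n"
  by (induction n) (auto simp: e_mult)

lemma e_of_nat: "e (of_nat n) = of_nat n"
  by (induction n) (auto simp: e_add)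

lemma of_nat_card_eq_0: "of_nat CARD('k) = (0::'c)"
  using e_of_nat[of "CARD('k)"] by (simp add: of_nat_card_finite_field)

lemma e_power_card: "e c ^ (CARD('k) ^ l) = e c"
proof (induction l)
  case (Suc l)
  then show ?case
    by (metis e_power finite_field_power_card power_Suc power_mult mult.commute)
qed simp

text \<open>The image of \<open>e\<close> is a finite subgroup whose product polynomial is
  \<open>X^q - X\<close>, so additivity of the \<open>q\<close>-th power is a case of
  \<open>subgroup_prod_add\<close>. The general case iterates it.\<close>

lemma frob_add: "(x + y) ^ (CARD('k) ^ l) = x ^ (CARD('k) ^ l) + y ^ (CARD('k) ^ l)" for x y :: 'c
proof (induction l)
  case (Suc l)
  let ?V = "range e" and ?q = "CARD('k)"
  have V: "add_subgroup ?V" "finite ?V"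
    by (auto simp: add_subgroup_def e_add[symmetric] e_minus[symmetric])
  have card: "card ?V = ?q" by (subst card_image) (auto simp: inj_on_def)
  have q: "2 \<le> ?q" by (rule card_finite_field_ge_2)
  have "Polynomial.monom 1 ?q - [:0, 1:] = (\<Prod>v\<in>?V. [:- v, 1::'c:])"
  proof (rule poly_eqI_degree_lead_coeff[of _ ?q _ ?V])
    show "poly.coeff (Polynomial.monom 1 ?q - [:0, 1:]) ?q = poly.coeff (\<Prod>v\<in>?V. [:- v, 1::'c:]) ?q"
      using coeff_prod_linear[OF V(2)] q by (simp add: card coeff_pCons split: nat.split)
    show "Polynomial.degree (Polynomial.monom 1 ?q - [:0, 1::'c:]) \<le> ?q"
      using q by (intro degree_diff_le) (auto simp: degree_monom_le)
    fix z assume "z \<in> ?V"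
    then show "poly (Polynomial.monom 1 ?q - [:0, 1:]) z = poly (\<Prod>v\<in>?V. [:- v, 1:]) z"
      using V(2) e_power_card[of _ 1] by (auto simp: poly_monom poly_prod)
  qed (simp_all add: card degree_prod_linear)
  from arg_cong[OF this, of "\<lambda>p. poly p _"]
  have *: "x ^ ?q - x = (\<Prod>v\<in>?V. x - v)" for x by (simp add: poly_monom poly_prod)
  have 1: "(x + y) ^ ?q = x ^ ?q + y ^ ?q" for x y :: 'c
    using subgroup_prod_add[OF V, of x y] by (simp add: *[symmetric])
  show ?case
    by (simp add: power_mult mult.commute[of ?q] Suc.IH 1)
qed simp

lemma frob_sum: "(\<Sum>i\<in>I. f i) ^ (CARD('k) ^ l) = (\<Sum>i\<in>I. f i ^ (CARD('k) ^ l))" for f :: "_ \<Rightarrow> 'c"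
  by (induction I rule: infinite_finite_induct) (auto simp: frob_add)

text \<open>The quotient of powers encodes \<open>v\<^bsup>Q' - Q\<^esup>\<close> with the value 0 at \<open>v = 0\<close>.\<close>

lemma frob_power_sum_eq_0:
  assumes V: "add_subgroup V" "finite V" and ij: "i < j" and card: "CARD('k) ^ (j - i) < card V"
  shows "(\<Sum>v\<in>V. v ^ (CARD('k) ^ j) * inverse v ^ (CARD('k) ^ i)) = (0::'c)"
proof -
  let ?q = "CARD('k)"
  have q: "2 \<le> ?q" by (rule card_finite_field_ge_2)
  have gt: "1 < ?q ^ (j - i)" using q ij by (intro one_less_power) auto
  have "v ^ (?q ^ j) * inverse v ^ (?q ^ i) = (v ^ (?q ^ (j - i) - 1)) ^ (?q ^ i)" for v :: 'c
  proof (cases "v = 0")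
    case False
    have "?q ^ j = (?q ^ (j - i) - 1) * ?q ^ i + ?q ^ i"
      using gt ij by (simp add: diff_mult_distrib power_add[symmetric] power_increasing)
    then have "v ^ (?q ^ j) = (v ^ (?q ^ (j - i) - 1)) ^ (?q ^ i) * v ^ (?q ^ i)"
      by (metis power_add power_mult)
    then show ?thesis using False by (simp add: power_inverse)
  qed (use gt q in \<open>simp add: power_0_left\<close>)
  then have "(\<Sum>v\<in>V. v ^ (?q ^ j) * inverse v ^ (?q ^ i))
      = (\<Sum>v\<in>V. poly (Polynomial.monom 1 (?q ^ (j - i) - 1)) v) ^ (?q ^ i)"
    by (simp add: frob_sum poly_monom)
  also have "(\<Sum>v\<in>V. poly (Polynomial.monom 1 (?q ^ (j - i) - 1)) v) = 0"
    by (rule sum_poly_subgroup_eq_0[OF V]) (use card gt in \<open>simp add: degree_monom_eq\<close>)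
  finally show ?thesis using q by (simp add: power_0_left)
qed

subsection \<open>The Moore determinant\<close>

definition moore :: "nat \<Rightarrow> (nat \<Rightarrow> 'c) \<Rightarrow> 'c mat" where
  "moore n x = mat n n (\<lambda>(i, j). x i ^ (CARD('k) ^ j))"

text \<open>One representative of each line in the coordinate space over the finite field.\<close>

definition monics :: "nat \<Rightarrow> 'k vec set" where
  "monics n = {\<nu> \<in> carrier_vec n. \<exists>l<n. \<nu> $ l = 1 \<and> (\<forall>i. l < i \<and> i < n \<longrightarrow> \<nu> $ i = 0)}"

definition flin :: "nat \<Rightarrow> (nat \<Rightarrow> 'c) \<Rightarrow> 'k vec \<Rightarrow> 'c" where
  "flin n x \<nu> = (\<Sum>i<n. e (\<nu> $ i) * x i)"

lemma flin_add: "\<nu> \<in> carrier_vec n \<Longrightarrow> \<mu> \<in> carrier_vec n \<Longrightarrow> flin n x (\<nu> + \<mu>) = flin n x \<nu> + flin n x \<mu>"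
  by (auto simp: flin_def e_add algebra_simps sum.distrib intro!: sum.cong)

lemma flin_minus: "\<nu> \<in> carrier_vec n \<Longrightarrow> flin n x (- \<nu>) = - flin n x \<nu>"
  by (auto simp: flin_def e_minus sum_negf intro!: sum.cong)

lemma flin_zero: "flin n x (0\<^sub>v n) = 0"
  by (simp add: flin_def)

lemma flin_subgroup: "add_subgroup (flin n x ` carrier_vec n)"
  unfolding add_subgroup_def
  by (safe; (rule image_eqI[where x = "0\<^sub>v n"] image_eqI[where x = "_ + _"] image_eqI[where x = "- _"]),
      (rule flin_add[symmetric] flin_minus[symmetric] flin_zero[symmetric])?) auto

lemma flin_inj:
  assumes "\<And>\<nu>. \<nu> \<in> carrier_vec n \<Longrightarrow> flin n x \<nu> = 0 \<Longrightarrow> \<nu> = 0\<^sub>v n"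
  shows "inj_on (flin n x) (carrier_vec n)"
proof (rule inj_onI)
  fix \<nu> \<mu> :: "'k vec"
  assume *: "\<nu> \<in> carrier_vec n" "\<mu> \<in> carrier_vec n" "flin n x \<nu> = flin n x \<mu>"
  then have "flin n x (\<nu> + - \<mu>) = 0" by (subst flin_add) (auto simp: flin_minus)
  then have "\<nu> + - \<mu> = 0\<^sub>v n" using * by (intro assms) auto
  then have "(\<nu> + - \<mu>) $ i = 0" if "i < n" for i using that by simp
  then show "\<nu> = \<mu>" using * by (intro eq_vecI) auto
qed

definition vec_snoc :: "nat \<Rightarrow> 'k vec \<Rightarrow> 'k \<Rightarrow> 'k vec" where
  "vec_snoc n \<nu> c = vec (Suc n) (\<lambda>i. if i < n then \<nu> $ i else c)"

lemma flin_snoc: "flin (Suc n) x (vec_snoc n \<nu> c) = flin n x \<nu> + e c * x n"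
  by (simp add: flin_def vec_snoc_def)

lemma vec_snoc_inj: "inj_on (\<lambda>\<nu>. vec_snoc n \<nu> c) (carrier_vec n)"
proof (rule inj_onI)
  fix \<nu> \<mu> :: "'k vec" assume *: "\<nu> \<in> carrier_vec n" "\<mu> \<in> carrier_vec n" "vec_snoc n \<nu> c = vec_snoc n \<mu> c"
  have "\<nu> $ i = \<mu> $ i" if "i < n" for i
    using that arg_cong[OF *(3), of "\<lambda>v. v $ i"] by (simp add: vec_snoc_def)
  then show "\<nu> = \<mu>" using * by (intro eq_vecI) auto
qed

lemma monics_Suc:
  "monics (Suc n) = (\<lambda>\<nu>. vec_snoc n \<nu> 0) ` monics n \<union> (\<lambda>\<nu>. vec_snoc n \<nu> 1) ` carrier_vec n"
proof (intro equalityI subsetI)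
  fix \<nu> assume "\<nu> \<in> monics (Suc n)"
  then obtain l where l: "\<nu> \<in> carrier_vec (Suc n)" "l < Suc n" "\<nu> $ l = 1"
      "\<And>i. l < i \<Longrightarrow> i < Suc n \<Longrightarrow> \<nu> $ i = 0"
    by (auto simp: monics_def)
  define \<mu> where "\<mu> = vec n (\<lambda>i. \<nu> $ i)"
  have \<mu>: "\<mu> \<in> carrier_vec n" by (simp add: \<mu>_def)
  have \<nu>: "\<nu> = vec_snoc n \<mu> (\<nu> $ n)"
    using l(1) by (intro eq_vecI) (auto simp: vec_snoc_def \<mu>_def less_Suc_eq)
  show "\<nu> \<in> (\<lambda>\<nu>. vec_snoc n \<nu> 0) ` monics n \<union> (\<lambda>\<nu>. vec_snoc n \<nu> 1) ` carrier_vec n"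
  proof (cases "l = n")
    case True
    then show ?thesis using \<nu> \<mu> l(3) by auto
  next
    case False
    then have "l < n" "\<nu> $ n = 0" using l by auto
    moreover have "\<mu> \<in> monics n"
      using \<open>l < n\<close> l by (auto simp: monics_def \<mu>_def intro!: exI[of _ l])
    ultimately show ?thesis using \<nu> by auto
  qed
next
  fix \<nu> assume "\<nu> \<in> (\<lambda>\<nu>. vec_snoc n \<nu> 0) ` monics n \<union> (\<lambda>\<nu>. vec_snoc n \<nu> 1) ` carrier_vec n"
  then show "\<nu> \<in> monics (Suc n)"
  proof
    assume "\<nu> \<in> (\<lambda>\<nu>. vec_snoc n \<nu> 0) ` monics n"
    then obtain \<mu> l where "\<nu> = vec_snoc n \<mu> 0" "l < n" "\<mu> $ l = 1" "\<And>i. l < i \<Longrightarrow> i < n \<Longrightarrow> \<mu> $ i = 0"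
      by (auto simp: monics_def)
    then show ?thesis by (auto simp: monics_def vec_snoc_def intro!: exI[of _ l])
  next
    assume "\<nu> \<in> (\<lambda>\<nu>. vec_snoc n \<nu> 1) ` carrier_vec n"
    then show ?thesis by (auto simp: monics_def vec_snoc_def intro!: exI[of _ n])
  qed
qed

text \<open>Moore's formula by induction. With the last row replaced by the powers of a variable
  \<open>y\<close>, the determinant is a polynomial in \<open>y\<close> of degree at most
  \<open>q^n\<close>, its coefficient there is the smaller Moore determinant, and it vanishes on the
  span \<open>V\<close> of the earlier entries. Independence gives \<open>V\<close> exactly
  \<open>q^n\<close> elements, so all zeros are known; evaluate at \<open>x n\<close>.\<close>

lemma moore_det:
  assumes "\<And>\<nu>. \<nu> \<in> carrier_vec n \<Longrightarrow> flin n x \<nu> = 0 \<Longrightarrow> \<nu> = 0\<^sub>v n"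
  shows "det (moore n x) = (\<Prod>\<nu>\<in>monics n. flin n x \<nu>)"
  using assms
proof (induction n)
  case 0
  have "monics 0 = {}" by (auto simp: monics_def)
  moreover have "det (moore 0 x) = 1" by (rule det_dim_zero) (simp add: moore_def)
  ultimately show ?case by simp
next
  case (Suc n)
  let ?q = "CARD('k)"
  have indep: "\<nu> = 0\<^sub>v n" if "\<nu> \<in> carrier_vec n" "flin n x \<nu> = 0" for \<nu>
  proof -
    have "vec_snoc n \<nu> 0 = 0\<^sub>v (Suc n)"
      by (rule Suc.prems) (use that in \<open>auto simp: flin_snoc\<close>, simp add: vec_snoc_def)
    then have "vec_snoc n \<nu> 0 $ i = 0" if "i < n" for i using that by simp
    then show ?thesis using that by (intro eq_vecI) (auto simp: vec_snoc_def)
  qed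
  note IH = Suc.IH[OF indep]
  define V where "V = flin n x ` carrier_vec n"
  have inj: "inj_on (flin n x) (carrier_vec n)" by (rule flin_inj[OF indep])
  have V: "add_subgroup V" "finite V" "card V = ?q ^ n"
    using flin_subgroup finite_carrier_vec card_image[OF inj] by (auto simp: V_def card_carrier_vec)
  define B where "B y = mat (Suc n) (Suc n) (\<lambda>(i, j). if i < n then x i ^ (?q ^ j) else y ^ (?q ^ j))"
    for y :: 'c
  have B: "B y \<in> carrier_mat (Suc n) (Suc n)" for y by (simp add: B_def)
  define cf where "cf j = cofactor (B 0) n j" for j
  have cf: "cofactor (B y) n j = cf j" if "j < Suc n" for y j
    using that by (auto simp: cf_def cofactor_def mat_delete_def B_def intro!: arg_cong[of _ _ det] eq_matI)
  have detB: "det (B y) = (\<Sum>j<Suc n. y ^ (?q ^ j) * cf j)" for y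
    by (subst laplace_expansion_row[OF B, of n]) (auto simp: cf intro!: sum.cong, simp add: B_def)
  have "mat_delete (B 0) n n = moore n x"
    by (rule eq_matI) (auto simp: mat_delete_def B_def moore_def)
  then have cfn: "cf n = det (moore n x)"
    by (simp add: cf_def cofactor_def)
  define p where "p = (\<Sum>j<Suc n. Polynomial.monom (cf j) (?q ^ j))"
  have p: "poly p y = det (B y)" for y
    by (simp add: p_def poly_sum poly_monom detB mult.commute)
  \<comment> \<open>The cofactors do not involve \<open>y\<close>, and only powers
    \<open>y ^ (q ^ j)\<close> occur, so the determinant is linear over the finite field in
    \<open>y\<close>.\<close>
  have lin: "det (B (flin n x \<nu>)) = (\<Sum>i<n. e (\<nu> $ i) * det (B (x i)))" for \<nu>
    by (simp add: detB flin_def frob_sum power_mult_distrib e_power_card sum_distrib_left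
        sum_distrib_right distrib_left sum.distrib sum.swap[of _ "{..<n}"] mult.assoc del: sum.lessThan_Suc)
  have detx: "det (B (x i)) = 0" if "i < n" for i
    by (rule det_identical_rows[OF B, of i n]) (use that in \<open>auto simp: B_def\<close>)
  have q: "2 \<le> ?q" by (rule card_finite_field_ge_2)
  have "p = Polynomial.smult (cf n) (\<Prod>v\<in>V. [:- v, 1:])"
  proof (rule poly_eqI_degree_lead_coeff[of _ "?q ^ n" _ V])
    have "poly.coeff p (?q ^ n) = (\<Sum>j<Suc n. if j = n then cf j else 0)"
      unfolding p_def Polynomial.coeff_sum using q
      by (intro sum.cong) (auto simp: power_inject_exp)
    then show "poly.coeff p (?q ^ n) = poly.coeff (Polynomial.smult (cf n) (\<Prod>v\<in>V. [:- v, 1:])) (?q ^ n)"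
      using coeff_prod_linear[OF V(2)] by (simp add: V(3))
    show "Polynomial.degree p \<le> ?q ^ n"
      unfolding p_def using q
      by (intro degree_sum_le) (auto intro!: order_trans[OF degree_monom_le] power_increasing)
    show "Polynomial.degree (Polynomial.smult (cf n) (\<Prod>v\<in>V. [:- v, 1:])) \<le> ?q ^ n"
      using degree_smult_le degree_prod_linear[OF V(2)] V(3) by metis
    fix z assume z: "z \<in> V"
    then have "poly p z = 0" using detx by (auto simp: p V_def lin)
    moreover have "poly (\<Prod>v\<in>V. [:- v, 1:]) z = 0" using V(2) z by (simp add: poly_prod)
    ultimately show "poly p z = poly (Polynomial.smult (cf n) (\<Prod>v\<in>V. [:- v, 1:])) z" by simp
  qed (simp add: V(3))
  then have "det (B (x n)) = det (moore n x) * (\<Prod>v\<in>V. x n - v)"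
    by (simp add: p[symmetric] cfn poly_prod)
  also have "(\<Prod>v\<in>V. x n - v) = (\<Prod>v\<in>V. v + x n)"
    using subgroup_prod_minus[OF V(1), of "\<lambda>v. x n - v"] by (simp add: add.commute)
  also have "\<dots> = (\<Prod>\<nu>\<in>carrier_vec n. flin (Suc n) x (vec_snoc n \<nu> 1))"
    unfolding V_def by (subst prod.reindex[OF inj]) (simp add: flin_snoc)
  also have "\<dots> = (\<Prod>\<nu>\<in>(\<lambda>\<nu>. vec_snoc n \<nu> 1) ` carrier_vec n. flin (Suc n) x \<nu>)"
    by (subst prod.reindex[OF vec_snoc_inj]) simp
  also have "det (moore n x) = (\<Prod>\<nu>\<in>(\<lambda>\<nu>. vec_snoc n \<nu> 0) ` monics n. flin (Suc n) x \<nu>)"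
    by (subst prod.reindex[OF inj_on_subset[OF vec_snoc_inj]])
      (auto simp: IH flin_snoc monics_def)
  also have "(\<Prod>\<nu>\<in>(\<lambda>\<nu>. vec_snoc n \<nu> 0) ` monics n. flin (Suc n) x \<nu>)
      * (\<Prod>\<nu>\<in>(\<lambda>\<nu>. vec_snoc n \<nu> 1) ` carrier_vec n. flin (Suc n) x \<nu>)
      = (\<Prod>\<nu>\<in>monics (Suc n). flin (Suc n) x \<nu>)"
    unfolding monics_Suc
  proof (rule prod.union_disjoint[symmetric])
    have "finite (monics n)" by (rule finite_subset[OF _ finite_carrier_vec[of n]]) (auto simp: monics_def)
    then show "finite ((\<lambda>\<nu>. vec_snoc n \<nu> 0) ` monics n)" by simp
    show "finite ((\<lambda>\<nu>. vec_snoc n \<nu> (1::'k)) ` carrier_vec n)" by (rule finite_imageI[OF finite_carrier_vec])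
    have "vec_snoc n \<nu> c $ n = c" for \<nu> c by (simp add: vec_snoc_def)
    then show "(\<lambda>\<nu>. vec_snoc n \<nu> 0) ` monics n \<inter> (\<lambda>\<nu>. vec_snoc n \<nu> 1) ` carrier_vec n = {}"
      by (metis (no_types, lifting) disjoint_iff imageE zero_neq_one)
  qed
  also have "B (x n) = moore (Suc n) x"
    by (rule eq_matI) (auto simp: B_def moore_def less_Suc_eq)
  finally show ?case .
qed

end

section \<open>The exponential function of a discrete subgroup\<close>

lemma vabs_prod_one_minus_le:
  assumes "finite G" "\<And>i. i \<in> G \<Longrightarrow> vabs (f i) \<le> d" "0 \<le> d" "d \<le> 1"
  shows "vabs ((\<Prod>i\<in>G. 1 - f i) - 1) \<le> d"
  using assms(1,2)
proof (induction G rule: finite_induct)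
  case (insert j G)
  let ?P = "\<Prod>i\<in>G. 1 - f i"
  have 1: "vabs (1 - f j) \<le> 1" using insert.prems[of j] assms(4) by (intro vabs_diff_le) auto
  have 2: "vabs (?P - 1) \<le> d" using insert by auto
  have "(\<Prod>i\<in>insert j G. 1 - f i) - 1 = (?P - 1) * (1 - f j) - f j"
    using insert.hyps by (simp add: algebra_simps)
  moreover have "vabs ((?P - 1) * (1 - f j)) \<le> d"
    using mult_mono[OF 2 1] assms(3) by (simp add: vabs_mult)
  ultimately show ?case using insert.prems[of j] by (simp add: vabs_diff_le)
qed (use assms in simp)

text \<open>The set \<open>F 0\<close> contains all factors with \<open>vabs (f i) \<ge> 1\<close>.
  Every further factor \<open>1 - f i\<close> has absolute value 1, so the finite products beyond
  \<open>F 0\<close> have the constant size \<open>C\<close>. This gives both the Cauchy estimates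
  and, if \<open>C\<close> is not 0, a nonzero limit.\<close>

lemma nonarch_product_converges:
  fixes f :: "'i \<Rightarrow> 'c::complete_nonarch_field"
  assumes f: "vanishing f I"
  obtains P where "((\<lambda>F. \<Prod>i\<in>F. 1 - f i) \<longlongrightarrow> P) (finite_subsets_at_top I)"
    "(\<And>i. i \<in> I \<Longrightarrow> f i \<noteq> 1) \<Longrightarrow> P \<noteq> 0"
proof -
  define p where "p F = (\<Prod>i\<in>F. 1 - f i)" for F
  define F where "F n = {i \<in> I. 1 / real (Suc n) \<le> vabs (f i)}" for n
  define C where "C = vabs (p (F 0))"
  have fin: "finite (F n)" and sub: "F n \<subseteq> I" for n
    using vanishingD[OF f, of "1 / real (Suc n)"] by (auto simp: F_def)
  have out: "vabs (f i) \<le> 1 / real (Suc n)" if "i \<in> I - F n" for i n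
    using that by (auto simp: F_def)
  have mono: "F m \<subseteq> F n" if "m \<le> n" for m n
  proof -
    have "1 / real (Suc n) \<le> 1 / real (Suc m)" using that by (simp add: field_simps)
    then show ?thesis by (auto simp: F_def)
  qed
  have C: "vabs (p G) = C" if "finite G" "G \<subseteq> I" "F 0 \<subseteq> G" for G
  proof -
    have "p G = p (F 0) * p (G - F 0)"
      using that fin[of 0] by (simp add: p_def prod.subset_diff[of "F 0" G] mult.commute)
    moreover have "vabs (p (G - F 0)) = 1"
      unfolding p_def vabs_prod using that
      by (intro prod.neutral ballI vabs_one_minus) (auto simp: F_def)
    ultimately show ?thesis by (simp add: C_def vabs_mult)
  qed
  have diff: "vabs (p G - p (F n)) \<le> C / real (Suc n)"
    if G: "finite G" "G \<subseteq> I" "F n \<subseteq> G" for G n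
  proof -
    have "p G = p (F n) * p (G - F n)"
      using that fin[of n] by (simp add: p_def prod.subset_diff[of "F n" G] mult.commute)
    then have "p G - p (F n) = p (F n) * (p (G - F n) - 1)" by (simp add: algebra_simps)
    moreover have "vabs (p (G - F n) - 1) \<le> 1 / real (Suc n)"
      unfolding p_def using that by (intro vabs_prod_one_minus_le out) auto
    moreover have "vabs (p (F n)) = C" by (intro C fin sub mono) simp
    ultimately show ?thesis
      using mult_left_mono[of "vabs (p (G - F n) - 1)" "1 / real (Suc n)" C]
      by (simp add: vabs_mult C_def)
  qed
  have small: "\<exists>N. C / real (Suc N) < e" if "e > 0" for e
  proof -
    obtain N where "1 / real (Suc N) < e / (C + 1)"
      using nat_approx_posE[of "e / (C + 1)"] \<open>e > 0\<close> by (auto simp: C_def add_nonneg_pos)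
    moreover have "0 < C + 1" by (simp add: C_def add_nonneg_pos)
    ultimately have "(C + 1) / real (Suc N) < e"
      by (simp add: less_divide_eq mult.commute)
    moreover have "C / real (Suc N) \<le> (C + 1) / real (Suc N)" by (simp add: divide_right_mono)
    ultimately show ?thesis by (metis le_less_trans)
  qed
  have "convergent (\<lambda>n. p (F n))"
  proof (rule Cauchy_vabsI)
    fix e :: real assume "e > 0"
    then obtain N where N: "C / real (Suc N) < e" using small by blast
    have "vabs (p (F n) - p (F N)) < e" if "n \<ge> N" for n
      using diff[OF fin sub mono[OF that]] N by linarith
    then show "\<exists>N. \<forall>n\<ge>N. vabs (p (F n) - p (F N)) < e" by blast
  qed
  then obtain P where P: "(\<lambda>n. p (F n)) \<longlonglongrightarrow> P" by (auto simp: convergent_def)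
  have Pn: "vabs (P - p (F n)) \<le> C / real (Suc n)" for n
  proof (rule tendsto_vabs_le)
    show "(\<lambda>m. p (F m) - p (F n)) \<longlonglongrightarrow> P - p (F n)"
      by (intro tendsto_intros P)
    show "\<forall>\<^sub>F m in sequentially. vabs (p (F m) - p (F n)) \<le> C / real (Suc n)"
      using eventually_ge_at_top[of n] by eventually_elim (intro diff fin sub mono)
  qed auto
  have "(p \<longlongrightarrow> P) (finite_subsets_at_top I)"
    unfolding tendsto_iff
  proof (intro allI impI)
    fix e :: real assume "e > 0"
    then obtain N where N: "C / real (Suc N) < e" using small by blast
    have "dist (p G) P < e" if "finite G" "G \<subseteq> I" "F N \<subseteq> G" for G
    proof -
      have "p G - P = (p G - p (F N)) - (P - p (F N))" by simp
      also have "vabs \<dots> \<le> C / real (Suc N)"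
        by (intro vabs_diff_le diff Pn that)
      finally show ?thesis using N by (simp add: dist_eq_vabs)
    qed
    then show "\<forall>\<^sub>F G in finite_subsets_at_top I. dist (p G) P < e"
      unfolding eventually_finite_subsets_at_top
      by (intro exI[of _ "F N"]) (simp add: fin sub)
  qed
  moreover have "P \<noteq> 0" if "\<And>i. i \<in> I \<Longrightarrow> f i \<noteq> 1"
  proof
    assume "P = 0"
    then have "(\<lambda>n. C) \<longlonglongrightarrow> 0"
      using tendsto_vabs[OF P] C[OF fin sub mono] by simp
    then have "C = 0" by (simp add: LIMSEQ_const_iff)
    then show False using that sub[of 0] fin[of 0] by (auto simp: C_def p_def)
  qed
  ultimately show ?thesis using that unfolding p_def[abs_def] by blast
qed

locale discrete_subgroup =
  fixes L :: "'c::complete_nonarch_field set"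
  assumes subgroup: "add_subgroup L"
    and finite_ball: "finite {y \<in> L. vabs y \<le> M}"
begin

text \<open>By the ultrametric inequality a ball of \<open>L\<close> is itself a finite subgroup, so
  the results on \<open>fin_exp\<close> apply to it and pass to the limit.\<close>

definition lball :: "nat \<Rightarrow> 'c set" where
  "lball n = {y \<in> L. vabs y \<le> real n}"

lemma lball_subgroup: "add_subgroup (lball n)" and lball_finite: "finite (lball n)"
  and lball_subset: "lball n \<subseteq> L" and lball_mono: "mono lball"
  using add_subgroupD[OF subgroup] finite_ball
  by (auto simp: add_subgroup_def lball_def vabs_add_le mono_def intro: order_trans)

lemma lball_Union: "L \<subseteq> (\<Union>n. lball n)"
  by (auto simp: lball_def real_arch_simple)

lemma lball_tendsto_nonzero:
  "filterlim (\<lambda>n. lball n - {0}) (finite_subsets_at_top (L - {0})) sequentially"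
  by (rule filterlim_finite_exhaustion)
    (use lball_mono in \<open>auto simp: lball_finite mono_def dest: subsetD[OF lball_subset] subsetD[OF lball_Union]\<close>)

lemma vanishing_quotient: "vanishing (\<lambda>y. x / y) (L - {0})"
  unfolding vanishing_def
proof (intro allI impI)
  fix e :: real assume "e > 0"
  then have "{y \<in> L - {0}. e \<le> vabs (x / y)} \<subseteq> {y \<in> L. vabs y \<le> vabs x / e}"
    by (auto simp: vabs_divide field_simps)
  then show "finite {y \<in> L - {0}. e \<le> vabs (x / y)}"
    using finite_ball finite_subset by blast
qed

lemma lattice_exp_tendsto: "(\<lambda>n. fin_exp (lball n) x) \<longlonglongrightarrow> lattice_exp L x"
  and lattice_exp_nonzero: "x \<notin> L \<Longrightarrow> lattice_exp L x \<noteq> 0"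
proof -
  obtain P where P: "((\<lambda>F. \<Prod>y\<in>F. 1 - x / y) \<longlongrightarrow> P) (finite_subsets_at_top (L - {0}))"
    and nz: "(\<And>y. y \<in> L - {0} \<Longrightarrow> x / y \<noteq> 1) \<Longrightarrow> P \<noteq> 0"
    using nonarch_product_converges[OF vanishing_quotient[of x]] by blast
  have eq: "lattice_exp L x = x * P"
    unfolding lattice_exp_def using P by (simp add: tendsto_Lim)
  have "(\<lambda>n. \<Prod>y\<in>lball n - {0}. 1 - x / y) \<longlonglongrightarrow> P"
    by (rule filterlim_compose[OF P lball_tendsto_nonzero])
  then show "(\<lambda>n. fin_exp (lball n) x) \<longlonglongrightarrow> lattice_exp L x"
    unfolding eq fin_exp_def by (intro tendsto_intros)
  assume x: "x \<notin> L"
  then have "x \<noteq> 0" using add_subgroupD(1)[OF subgroup] by auto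
  moreover have "P \<noteq> 0" by (rule nz) (use x in auto)
  ultimately show "lattice_exp L x \<noteq> 0" by (simp add: eq)
qed

lemma lattice_exp_eqI: "(\<lambda>n. fin_exp (lball n) x) \<longlonglongrightarrow> y \<Longrightarrow> lattice_exp L x = y"
  using LIMSEQ_unique lattice_exp_tendsto by blast

lemma lattice_exp_zero [simp]: "lattice_exp L 0 = 0"
  by (simp add: lattice_exp_def)

lemma lattice_exp_add: "lattice_exp L (x + y) = lattice_exp L x + lattice_exp L y"
  by (rule lattice_exp_eqI)
    (simp only: fin_exp_add[OF lball_subgroup lball_finite], intro tendsto_intros lattice_exp_tendsto)

lemma lattice_exp_sum: "lattice_exp L (\<Sum>i\<in>I. f i) = (\<Sum>i\<in>I. lattice_exp L (f i))"
  by (induction I rule: infinite_finite_induct) (auto simp: lattice_exp_add)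

lemma lattice_exp_eq_0_iff: "lattice_exp L x = 0 \<longleftrightarrow> x \<in> L"
proof
  assume x: "x \<in> L"
  obtain N where N: "x \<in> lball N" using lball_Union x by auto
  have "\<forall>\<^sub>F n in sequentially. fin_exp (lball n) x = 0"
    using eventually_ge_at_top[of N]
  proof eventually_elim
    case (elim n)
    then have "x \<in> lball n" using N monoD[OF lball_mono, of N n] by auto
    then show ?case
      by (cases "x = 0") (auto simp: fin_exp_def lball_finite intro!: bexI[of _ x])
  qed
  then show "lattice_exp L x = 0" by (intro lattice_exp_eqI tendsto_eventually)
qed (use lattice_exp_nonzero in blast)

lemma lattice_exp_cong: "x - y \<in> L \<Longrightarrow> lattice_exp L x = lattice_exp L y"
  using lattice_exp_add[of "x - y" y] lattice_exp_eq_0_iff by simp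

text \<open>Multiplication by \<open>u\<close> permutes \<open>L\<close> and preserves absolute
  values, hence permutes each ball. Applied to nonzero constants \<open>u\<close>, it gives
  linearity over the finite field.\<close>

lemma lattice_exp_scale:
  assumes u: "\<And>y. y \<in> L \<Longrightarrow> u * y \<in> L" "\<And>y. y \<in> L \<Longrightarrow> inverse u * y \<in> L" "vabs u = 1"
  shows "lattice_exp L (u * x) = u * lattice_exp L x"
proof (rule lattice_exp_eqI)
  have u0: "u \<noteq> 0" using u(3) by auto
  have iu: "vabs (inverse u) = 1" using u(3) by (simp add: vabs_inverse)
  have "fin_exp (lball n) (u * x) = u * fin_exp (lball n) x" for n
  proof -
    have "(\<Prod>y\<in>lball n - {0}. 1 - u * x / y) = (\<Prod>y\<in>lball n - {0}. 1 - x / y)"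
      by (rule prod.reindex_bij_witness[of _ "\<lambda>y. u * y" "\<lambda>y. inverse u * y"])
        (use u u0 iu in \<open>auto simp: lball_def vabs_mult vabs_divide field_simps\<close>)
    then show ?thesis by (simp add: fin_exp_def)
  qed
  then show "(\<lambda>n. fin_exp (lball n) (u * x)) \<longlonglongrightarrow> u * lattice_exp L x"
    by (simp add: tendsto_mult lattice_exp_tendsto)
qed

lemma vanishing_inverse_shift: "vanishing (\<lambda>y. inverse (x + y)) L"
  unfolding vanishing_def
proof (intro allI impI)
  fix e :: real assume e: "e > 0"
  have "{y \<in> L. e \<le> vabs (inverse (x + y))} \<subseteq> {y \<in> L. vabs y \<le> max (inverse e) (vabs x)}"
  proof safe
    fix y assume y: "y \<in> L" "e \<le> vabs (inverse (x + y))"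
    then have "vabs (x + y) \<le> inverse e"
      using e by (metis vabs_inverse le_imp_inverse_le inverse_inverse_eq)
    then show "vabs y \<le> max (inverse e) (vabs x)"
      using vabs_diff_le_max[of "x + y" x] by auto
  qed
  then show "finite {y \<in> L. e \<le> vabs (inverse (x + y))}"
    using finite_ball finite_subset by blast
qed

lemma has_sum_inverse_lattice:
  assumes x: "x \<notin> L"
  shows "((\<lambda>y. inverse (x + y)) has_sum inverse (lattice_exp L x)) L"
proof -
  have s: "(\<lambda>y. inverse (x + y)) summable_on L"
    by (rule vanishing_imp_summable[OF vanishing_inverse_shift])
  have "(\<lambda>n. \<Sum>y\<in>lball n. inverse (x + y)) \<longlonglongrightarrow> infsum (\<lambda>y. inverse (x + y)) L"
    by (rule has_sum_exhaustion[OF has_sum_infsum[OF s] lball_finite lball_subset lball_mono lball_Union])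
  moreover have "(\<Sum>y\<in>lball n. inverse (x + y)) = inverse (fin_exp (lball n) x)" for n
    by (rule sum_inverse_subgroup[OF lball_subgroup lball_finite]) (use x lball_subset in blast)
  ultimately have "(\<lambda>n. inverse (fin_exp (lball n) x)) \<longlonglongrightarrow> infsum (\<lambda>y. inverse (x + y)) L"
    by simp
  moreover have "(\<lambda>n. inverse (fin_exp (lball n) x)) \<longlonglongrightarrow> inverse (lattice_exp L x)"
    by (rule tendsto_inverse_nonarch[OF lattice_exp_tendsto lattice_exp_nonzero[OF x]])
  ultimately have "infsum (\<lambda>y. inverse (x + y)) L = inverse (lattice_exp L x)"
    using LIMSEQ_unique by blast
  then show ?thesis using has_sum_infsum[OF s] by simp
qed

text \<open>Below the shortest lattice vector every factor \<open>1 - x / y\<close> has absolute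
  value 1. This makes the coefficients of \<open>s_fun\<close> tend to 0.\<close>

lemma vabs_lattice_exp_small:
  assumes "\<And>y. y \<in> L \<Longrightarrow> y \<noteq> 0 \<Longrightarrow> vabs x < vabs y"
  shows "vabs (lattice_exp L x) = vabs x"
proof -
  have "vabs (1 - x / y) = 1" if "y \<in> L - {0}" for y
    using assms[of y] that by (intro vabs_one_minus) (auto simp: vabs_divide)
  then have "vabs (fin_exp (lball n) x) = vabs x" for n
    using subsetD[OF lball_subset] by (auto simp: fin_exp_def vabs_mult vabs_prod intro!: prod.neutral)
  then show ?thesis
    using tendsto_vabs[OF lattice_exp_tendsto[of x]] by (simp add: LIMSEQ_const_iff)
qed

text \<open>The bound from below that controls \<open>u_param\<close> at the cusps.\<close>

lemma vabs_lattice_exp_ge: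
  assumes "\<And>y. y \<in> L \<Longrightarrow> y \<noteq> 0 \<Longrightarrow> 1 \<le> vabs (1 - x / y)"
  shows "vabs x \<le> vabs (lattice_exp L x)"
proof (rule tendsto_lowerbound[OF tendsto_vabs[OF lattice_exp_tendsto[of x]]])
  have "1 \<le> (\<Prod>y\<in>lball n - {0}. vabs (1 - x / y))" for n
    using assms subsetD[OF lball_subset] by (intro prod_ge_1) auto
  then have "vabs x \<le> vabs (fin_exp (lball n) x)" for n
    using mult_left_mono[of 1 "\<Prod>y\<in>lball n - {0}. vabs (1 - x / y)" "vabs x"]
    by (simp add: fin_exp_def vabs_mult vabs_prod)
  then show "\<forall>\<^sub>F n in sequentially. vabs x \<le> vabs (fin_exp (lball n) x)" by simp
qed simp

end

section \<open>The Tate algebra\<close>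

text \<open>A bound for the Gauss norm that needs no prior knowledge that the supremum of the
  coefficients exists, and that is stable under ring operations.\<close>

definition coeffs_le :: "'c::complete_nonarch_field fps \<Rightarrow> real \<Rightarrow> bool" where
  "coeffs_le f B \<longleftrightarrow> (\<forall>n. vabs (fps_nth f n) \<le> B)"

lemma coeffs_le_nonneg: "coeffs_le f B \<Longrightarrow> 0 \<le> B"
  using order_trans[OF vabs_nonneg] by (auto simp: coeffs_le_def)

lemma coeffs_le_trans: "coeffs_le f B \<Longrightarrow> B \<le> C \<Longrightarrow> coeffs_le f C"
  using order_trans by (auto simp: coeffs_le_def)

lemma coeffs_le_zero: "0 \<le> B \<Longrightarrow> coeffs_le 0 B"
  by (simp add: coeffs_le_def)

lemma coeffs_le_const: "coeffs_le (fps_const c) (vabs c)"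
  by (simp add: coeffs_le_def)

lemma coeffs_le_add: "coeffs_le f B \<Longrightarrow> coeffs_le g B \<Longrightarrow> coeffs_le (f + g) B"
  by (auto simp: coeffs_le_def intro: vabs_add_le)

lemma coeffs_le_minus: "coeffs_le f B \<Longrightarrow> coeffs_le (- f) B"
  by (auto simp: coeffs_le_def)

lemma coeffs_le_diff: "coeffs_le f B \<Longrightarrow> coeffs_le g B \<Longrightarrow> coeffs_le (f - g) B"
  by (auto simp: coeffs_le_def intro: vabs_diff_le)

lemma coeffs_le_mult:
  assumes "coeffs_le f B" "coeffs_le g C"
  shows "coeffs_le (f * g) (B * C)"
  unfolding coeffs_le_def fps_mult_nth
proof (intro allI vabs_sum_le)
  show "0 \<le> B * C" using assms coeffs_le_nonneg by (simp add: coeffs_le_nonneg)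
  fix n i show "vabs (fps_nth f i * fps_nth g (n - i)) \<le> B * C"
    using assms coeffs_le_nonneg[OF assms(1)] unfolding coeffs_le_def vabs_mult by (intro mult_mono) auto
qed

lemma coeffs_le_sum: "0 \<le> B \<Longrightarrow> (\<And>i. i \<in> I \<Longrightarrow> coeffs_le (f i) B) \<Longrightarrow> coeffs_le (sum f I) B"
  by (induction I rule: infinite_finite_induct) (auto intro: coeffs_le_add coeffs_le_zero)

lemma coeffs_le_prod:
  "(\<And>i. i \<in> I \<Longrightarrow> coeffs_le (f i) (B i)) \<Longrightarrow> coeffs_le (prod f I) (prod B I)"
  by (induction I rule: infinite_finite_induct)
    (auto intro: coeffs_le_mult coeffs_le_const[of 1, simplified])

lemma tate_coeffs_le:
  assumes "f \<in> tate"
  obtains B where "coeffs_le f B" "0 < B"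
proof -
  have "Bseq (\<lambda>n. vabs (fps_nth f n))"
    using assms convergentI convergent_imp_Bseq unfolding tate_def by blast
  then show ?thesis using that by (auto simp: Bseq_def coeffs_le_def)
qed

lemma gauss_norm_le: "coeffs_le f B \<Longrightarrow> gauss_norm f \<le> B"
  unfolding gauss_norm_def coeffs_le_def by (rule cSUP_least) auto

lemma coeffs_le_gauss_norm: "f \<in> tate \<Longrightarrow> coeffs_le f (gauss_norm f)"
proof -
  assume "f \<in> tate"
  then obtain B where "coeffs_le f B" using tate_coeffs_le by blast
  then have "bdd_above (range (\<lambda>n. vabs (fps_nth f n)))"
    by (auto simp: coeffs_le_def intro!: bdd_aboveI)
  then show ?thesis unfolding coeffs_le_def gauss_norm_def by (auto intro: cSUP_upper)
qed

lemma tate_const [simp]: "fps_const c \<in> tate"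
  unfolding tate_def
  by (auto intro!: tendsto_eventually eventually_sequentiallyI[of 1])

lemma tate_zero [simp]: "0 \<in> tate" and tate_one [simp]: "1 \<in> tate"
  using tate_const[of 0] tate_const[of 1] by simp_all

lemma tate_iff: "f \<in> tate \<longleftrightarrow> fps_nth f \<longlonglongrightarrow> 0"
  unfolding tate_def by (subst tendsto_vabs_iff) simp

lemma tate_add:
  assumes "f \<in> tate" "g \<in> tate"
  shows "f + g \<in> tate"
proof -
  have "(\<lambda>n. fps_nth f n + fps_nth g n) \<longlonglongrightarrow> 0 + 0"
    using assms by (intro tendsto_add) (simp_all add: tate_iff)
  moreover have "fps_nth (f + g) = (\<lambda>n. fps_nth f n + fps_nth g n)" by auto
  ultimately show ?thesis by (simp add: tate_iff)
qed

lemma tate_minus: "f \<in> tate \<Longrightarrow> - f \<in> tate"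
  by (simp add: tate_def)

lemma tate_diff: "f \<in> tate \<Longrightarrow> g \<in> tate \<Longrightarrow> f - g \<in> tate"
  using tate_add[of f "- g"] tate_minus[of g] by simp

lemma tate_finite_support:
  assumes "\<And>n. n > N \<Longrightarrow> fps_nth f n = 0"
  shows "f \<in> tate"
  unfolding tate_iff using assms by (auto intro!: tendsto_eventually eventually_sequentiallyI[of "Suc N"])

lemma tateE:
  assumes "f \<in> tate" "e > 0"
  obtains N where "\<And>n. n \<ge> N \<Longrightarrow> vabs (fps_nth f n) < e"
  using order_tendstoD(2)[of "\<lambda>n. vabs (fps_nth f n)" 0 sequentially e] assms
  unfolding tate_def eventually_sequentially by auto

lemma tateI:
  assumes "\<And>e. e > 0 \<Longrightarrow> \<exists>N. \<forall>n\<ge>N. vabs (fps_nth f n) \<le> e"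
  shows "f \<in> tate"
  unfolding tate_def mem_Collect_eq LIMSEQ_def
proof (intro allI impI)
  fix e :: real assume "e > 0"
  then obtain N where "\<forall>n\<ge>N. vabs (fps_nth f n) \<le> e / 2" using assms[of "e / 2"] by auto
  then show "\<exists>N. \<forall>n\<ge>N. dist (vabs (fps_nth f n)) 0 < e"
    using \<open>e > 0\<close> by (intro exI[of _ N]) fastforce
qed

lemma tate_mult:
  assumes f: "f \<in> tate" and g: "g \<in> tate"
  shows "f * g \<in> tate"
proof (rule tateI)
  fix e :: real assume e: "e > 0"
  obtain B where B: "coeffs_le f B" "0 < B" using tate_coeffs_le[OF f] by blast
  obtain C where C: "coeffs_le g C" "0 < C" using tate_coeffs_le[OF g] by blast
  obtain N where N: "\<And>n. n \<ge> N \<Longrightarrow> vabs (fps_nth f n) < e / C"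
    using tateE[OF f, of "e / C"] e C by auto
  obtain M where M: "\<And>n. n \<ge> M \<Longrightarrow> vabs (fps_nth g n) < e / B"
    using tateE[OF g, of "e / B"] e B by auto
  have "vabs (fps_nth (f * g) n) \<le> e" if n: "n \<ge> N + M" for n
    unfolding fps_mult_nth
  proof (rule vabs_sum_le)
    fix i assume "i \<in> {0..n}"
    show "vabs (fps_nth f i * fps_nth g (n - i)) \<le> e"
    proof (cases "i \<ge> N")
      case True
      have "vabs (fps_nth f i) * vabs (fps_nth g (n - i)) \<le> e / C * C"
        using N[OF True] C e by (intro mult_mono) (auto simp: coeffs_le_def)
      then show ?thesis using C by (simp add: vabs_mult)
    next
      case False
      then have "n - i \<ge> M" using n by simp
      then have "vabs (fps_nth f i) * vabs (fps_nth g (n - i)) \<le> B * (e / B)"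
        using M[of "n - i"] B e by (intro mult_mono) (auto simp: coeffs_le_def)
      then show ?thesis using B by (simp add: vabs_mult)
    qed
  qed (use e in simp)
  then show "\<exists>N. \<forall>n\<ge>N. vabs (fps_nth (f * g) n) \<le> e" by blast
qed

lemma tate_sum: "(\<And>i. i \<in> I \<Longrightarrow> f i \<in> tate) \<Longrightarrow> sum f I \<in> tate"
  by (induction I rule: infinite_finite_induct) (auto intro: tate_add)

lemma tate_prod: "(\<And>i. i \<in> I \<Longrightarrow> f i \<in> tate) \<Longrightarrow> prod f I \<in> tate"
  by (induction I rule: infinite_finite_induct) (auto intro: tate_mult)

lemma tate_X [simp]: "fps_X \<in> tate"
  by (rule tate_finite_support[of 1]) (auto simp: fps_X_def)

lemma tate_det:
  assumes "M \<in> carrier_mat n n" "\<And>i j. i < n \<Longrightarrow> j < n \<Longrightarrow> M $$ (i, j) \<in> tate"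
  shows "det M \<in> tate"
  unfolding det_def'[OF assms(1)]
  by (auto intro!: tate_sum tate_mult tate_prod assms(2) simp: sign_def permutes_in_image tate_minus
      atLeast0LessThan)

lemma tate_lim_eqI:
  assumes g: "\<And>n. g n \<in> tate" and h: "h \<in> tate"
    and lim: "\<And>n. coeffs_le (g n - h) (e n)" "e \<longlonglongrightarrow> 0"
  shows "tate_lim g = h"
  unfolding tate_lim_def
proof (rule the_equality)
  have nn: "0 \<le> gauss_norm (g n - h)" for n
    using coeffs_le_nonneg[OF coeffs_le_gauss_norm[OF tate_diff[OF g h]]] .
  have "(\<lambda>n. gauss_norm (g n - h)) \<longlonglongrightarrow> 0"
    by (rule tendsto_sandwich[OF _ _ tendsto_const lim(2)]) (auto simp: nn gauss_norm_le[OF lim(1)])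
  then show "h \<in> tate \<and> (\<lambda>n. gauss_norm (g n - h)) \<longlonglongrightarrow> 0" using h by simp
  fix h' assume h': "h' \<in> tate \<and> (\<lambda>n. gauss_norm (g n - h')) \<longlonglongrightarrow> 0"
  have coeff: "(\<lambda>n. fps_nth (g n) m) \<longlonglongrightarrow> fps_nth f m"
    if "f \<in> tate" "(\<lambda>n. gauss_norm (g n - f)) \<longlonglongrightarrow> 0" for f m
    using coeffs_le_gauss_norm[OF tate_diff[OF g that(1)]]
    by (intro tendsto_vabsI[OF that(2)] always_eventually allI) (simp add: coeffs_le_def)
  show "h' = h"
  proof (rule fps_ext)
    fix m show "fps_nth h' m = fps_nth h m"
      using LIMSEQ_unique[OF coeff coeff] h' h \<open>(\<lambda>n. gauss_norm (g n - h)) \<longlonglongrightarrow> 0\<close> by blast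
  qed
qed

section \<open>The fields \<open>K\<^sub>\<infinity>\<close> and \<open>\<complex>\<^sub>\<infinity>\<close>\<close>

interpretation fls_const_hom: comm_ring_hom "fls_const :: 'a::comm_ring_1 \<Rightarrow> 'a fls"
  by unfold_locales (auto simp: fls_plus_const)

interpretation fls_const_poly_hom: map_poly_comm_ring_hom "fls_const :: 'a::comm_ring_1 \<Rightarrow> 'a fls" ..

lemma poly_to_Kinf_add: "poly_to_Kinf (a + b) = poly_to_Kinf a + poly_to_Kinf b"
  by (simp add: poly_to_Kinf_def hom_distribs)

lemma poly_to_Kinf_mult: "poly_to_Kinf (a * b) = poly_to_Kinf a * poly_to_Kinf b"
  by (simp add: poly_to_Kinf_def hom_distribs)

lemma poly_to_Kinf_const: "poly_to_Kinf [:c:] = fls_const c"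
proof -
  have "map_poly fls_const [:c:] = [:fls_const c:]"
    by (rule poly_eqI) (simp add: coeff_map_poly coeff_pCons split: nat.split)
  then show ?thesis by (simp add: poly_to_Kinf_def)
qed

lemma poly_to_Kinf_0 [simp]: "poly_to_Kinf 0 = 0"
  and poly_to_Kinf_1 [simp]: "poly_to_Kinf 1 = 1"
  by (simp_all add: poly_to_Kinf_def)

lemma poly_to_Kinf_X: "poly_to_Kinf [:0, 1:] = fls_X_inv"
  by (simp add: poly_to_Kinf_def)

lemma poly_to_Kinf_uminus: "poly_to_Kinf (- a) = - poly_to_Kinf a"
  by (simp add: poly_to_Kinf_def hom_distribs)

lemma poly_to_Kinf_sum: "poly_to_Kinf (\<Sum>i\<in>I. f i) = (\<Sum>i\<in>I. poly_to_Kinf (f i))"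
  by (induction I rule: infinite_finite_induct) (auto simp: poly_to_Kinf_add)

context drinfeld_setting
begin

lemma q_ge_2: "2 \<le> CARD('k)"
  by (rule card_finite_field_ge_2)

lemma real_q_gt_1: "1 < real CARD('k)"
  using q_ge_2 by linarith

lemma of_Kinf_add: "of_Kinf (x + y) = of_Kinf x + of_Kinf y"
  by (simp add: of_Kinf_def emb_add)

lemma of_Kinf_mult: "of_Kinf (x * y) = of_Kinf x * of_Kinf y"
  by (simp add: of_Kinf_def emb_mult)

lemma of_Kinf_1 [simp]: "of_Kinf 1 = 1"
  by (simp add: of_Kinf_def emb_one)

lemma of_Kinf_0 [simp]: "of_Kinf 0 = 0"
  using of_Kinf_add[of 0 0] by (metis add.right_neutral add_left_cancel)

lemma of_Kinf_minus: "of_Kinf (- x) = - of_Kinf x"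
  using of_Kinf_add[of x "- x"] by (metis add_eq_0_iff of_Kinf_0 right_minus)

lemma of_Kinf_diff: "of_Kinf (x - y) = of_Kinf x - of_Kinf y"
  using of_Kinf_add[of x "- y"] by (simp add: of_Kinf_minus)

lemma of_Kinf_sum: "of_Kinf (\<Sum>i\<in>I. f i) = (\<Sum>i\<in>I. of_Kinf (f i))"
  by (induction I rule: infinite_finite_induct) (auto simp: of_Kinf_add)

lemma vabs_of_Kinf: "b \<noteq> 0 \<Longrightarrow> vabs (of_Kinf b) = real CARD('k) powi (- fls_subdegree b)"
  unfolding of_Kinf_def by (rule emb_norm)

lemma of_Kinf_eq_0_iff [simp]: "of_Kinf b = 0 \<longleftrightarrow> b = 0"
proof
  assume "of_Kinf b = 0"
  then have "vabs (of_Kinf b) = 0" by simp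
  then show "b = 0" using vabs_of_Kinf[of b] q_ge_2 by (cases "b = 0") auto
qed simp

lemma of_Kinf_inverse: "of_Kinf (inverse a) = inverse (of_Kinf a)"
proof (cases "a = 0")
  case False
  then have "of_Kinf a * of_Kinf (inverse a) = 1"
    by (metis of_Kinf_1 of_Kinf_mult right_inverse)
  then show ?thesis by (metis inverse_unique)
qed simp

lemma of_Kinf_divide: "of_Kinf (a / b) = of_Kinf a / of_Kinf b"
  by (simp add: divide_inverse of_Kinf_mult of_Kinf_inverse)

lemma vabs_of_Kinf_le:
  assumes "\<And>j. j < n \<Longrightarrow> fls_nth b j = 0"
  shows "vabs (of_Kinf b) \<le> real CARD('k) powi (- n)"
proof (cases "b = 0")
  case False
  then have "n \<le> fls_subdegree b" using assms by (intro fls_subdegree_geI) auto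
  then show ?thesis
    using False real_q_gt_1 by (simp add: vabs_of_Kinf power_int_increasing)
qed simp

lemma vabs_of_Kinf_less:
  assumes "vabs (of_Kinf b) < real CARD('k) powi (- n)" "j \<le> n"
  shows "fls_nth b j = 0"
proof (cases "b = 0")
  case False
  have "n < fls_subdegree b"
  proof (rule ccontr)
    assume "\<not> n < fls_subdegree b"
    then have "real CARD('k) powi (- n) \<le> real CARD('k) powi (- fls_subdegree b)"
      using real_q_gt_1 by (intro power_int_increasing) auto
    then show False using assms False by (simp add: vabs_of_Kinf)
  qed
  then show ?thesis using assms by simp
qed simp

lemma q_powi_tendsto_0: "(\<lambda>k::nat. real CARD('k) powi (- int k)) \<longlonglongrightarrow> 0"
proof -
  have "(\<lambda>k. inverse (real CARD('k)) ^ k) \<longlonglongrightarrow> 0"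
    using real_q_gt_1 by (intro LIMSEQ_realpow_zero) (auto simp: inverse_eq_divide)
  then show ?thesis by (simp add: power_int_minus power_inverse)
qed

text \<open>Distance below \<open>q^(-k)\<close> means equality of the coefficients up to index
  \<open>k\<close>. So the coefficient of index \<open>j\<close> is eventually constant and is read
  off at \<open>N j\<close>.\<close>

lemma Kinf_complete:
  fixes x :: "nat \<Rightarrow> 'k fls"
  assumes cauchy: "\<And>e. e > 0 \<Longrightarrow> \<exists>N. \<forall>m\<ge>N. vabs (of_Kinf (x m) - of_Kinf (x N)) < e"
  obtains y where "(\<lambda>m. of_Kinf (x m)) \<longlonglongrightarrow> of_Kinf y"
proof -
  have "\<exists>N. \<forall>m\<ge>N. vabs (of_Kinf (x m) - of_Kinf (x N)) < real CARD('k) powi (- k)" for k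
    by (rule cauchy) (use q_ge_2 in simp)
  then obtain N where N: "\<And>k m. m \<ge> N k \<Longrightarrow> vabs (of_Kinf (x m) - of_Kinf (x (N k))) < real CARD('k) powi (- k)"
    by metis
  have nth: "fls_nth (x m) j = fls_nth (x (N k)) j" if "m \<ge> N k" "j \<le> k" for m j k
    using vabs_of_Kinf_less[of "x m - x (N k)" k j] N[OF that(1)] that(2) by (simp add: of_Kinf_diff)
  define f where "f j = fls_nth (x (N j)) j" for j
  have f: "f j = fls_nth (x (N k)) j" if "j \<le> k" for j k
    using nth[of j "max (N j) (N k)" j] nth[of k "max (N j) (N k)" j] that by (simp add: f_def)
  \<comment> \<open>For negative indices the limit has the coefficients of \<open>x (N 0)\<close>,
    which bounds its pole order.\<close>
  obtain M where M: "\<forall>n<M. fls_nth (x (N 0)) n = 0" by (rule fls_nth_vanishes_belowE)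
  have y: "fls_nth (Abs_fls f) j = f j" for j
    by (rule nth_Abs_fls_lower_bound[of "min M 0"]) (use M f[of _ 0] in auto)
  have bound: "vabs (of_Kinf (x m) - of_Kinf (Abs_fls f)) \<le> real CARD('k) powi (- k)" if "m \<ge> N k" for m k
    unfolding of_Kinf_diff[symmetric] by (rule vabs_of_Kinf_le) (simp add: y nth[OF that] f[of _ k])
  have "(\<lambda>m. of_Kinf (x m)) \<longlonglongrightarrow> of_Kinf (Abs_fls f)"
    unfolding LIMSEQ_def dist_eq_vabs
  proof (intro allI impI)
    fix e :: real assume "e > 0"
    then obtain k where k: "real CARD('k) powi (- int k) < e"
      using order_tendstoD(2)[OF q_powi_tendsto_0] unfolding eventually_sequentially by blast
    show "\<exists>n0. \<forall>n\<ge>n0. vabs (of_Kinf (x n) - of_Kinf (Abs_fls f)) < e"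
      by (rule exI[of _ "N k"]) (use bound[of k] k in \<open>auto intro: le_less_trans\<close>)
  qed
  then show ?thesis using that by blast
qed

text \<open>Finite-dimensional spaces over the complete field \<open>K\<^sub>\<infinity>\<close> are closed, so a vector outside
  the span of the others stays at positive distance from it.\<close>

lemma independent_norm_bound:
  fixes w :: "nat \<Rightarrow> 'c"
  assumes "\<And>b :: nat \<Rightarrow> 'k fls. (\<Sum>i<n. of_Kinf (b i) * w i) = 0 \<Longrightarrow> \<forall>i<n. b i = 0"
  shows "\<exists>c>0. \<forall>b :: nat \<Rightarrow> 'k fls. \<forall>i<n. c * vabs (of_Kinf (b i)) \<le> vabs (\<Sum>i<n. of_Kinf (b i) * w i)"
  using assms
proof (induction n)
  case 0
  then show ?case by (auto intro: exI[of _ 1])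
next
  case (Suc n)
  let ?S = "\<lambda>b :: nat \<Rightarrow> 'k fls. \<Sum>i<n. of_Kinf (b i) * w i"
  have indep: "\<forall>i<n. b i = 0" if "?S b = 0" for b :: "nat \<Rightarrow> 'k fls"
  proof -
    have "?S (b(n := 0)) = 0" using that by simp
    then have "\<forall>i<Suc n. (b(n := 0)) i = 0" by (intro Suc.prems) simp
    then show ?thesis by (metis fun_upd_apply less_SucI less_irrefl)
  qed
  obtain c where c: "c > 0" "\<And>b i. i < n \<Longrightarrow> c * vabs (of_Kinf (b i)) \<le> vabs (?S b)"
    using Suc.IH[OF indep] by blast
  have S_diff: "?S (\<lambda>i. a i - b i) = ?S a - ?S b" for a b :: "nat \<Rightarrow> 'k fls"
    by (simp add: of_Kinf_diff left_diff_distrib sum_subtractf)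
  \<comment> \<open>Otherwise \<open>w n\<close> is a limit of combinations of the other elements.
    The constant \<open>c\<close> makes the coefficients Cauchy, completeness supplies their limits,
    and \<open>w n\<close> would lie in the span.\<close>
  have "\<exists>d>0. \<forall>b :: nat \<Rightarrow> 'k fls. d \<le> vabs (w n - ?S b)"
  proof (rule ccontr)
    assume "\<not> ?thesis"
    then have "\<exists>b :: nat \<Rightarrow> 'k fls. vabs (w n - ?S b) < 1 / real (Suc m)" for m
      by (metis not_le of_nat_0_less_iff zero_less_Suc zero_less_divide_1_iff)
    then obtain b where b: "\<And>m. vabs (w n - ?S (b m)) < 1 / real (Suc m)" by metis
    have "\<exists>y. (\<lambda>m. of_Kinf (b m i)) \<longlonglongrightarrow> of_Kinf y" if i: "i < n" for i
    proof -
      have "\<exists>N. \<forall>m\<ge>N. vabs (of_Kinf (b m i) - of_Kinf (b N i)) < e" if "e > 0" for e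
      proof -
        obtain N where N: "1 / real (Suc N) < c * e"
          using nat_approx_posE[OF mult_pos_pos[OF c(1) \<open>e > 0\<close>]] by blast
        have "vabs (of_Kinf (b m i) - of_Kinf (b N i)) < e" if m: "m \<ge> N" for m
        proof -
          have "c * vabs (of_Kinf (b m i - b N i)) \<le> vabs (?S (b m) - ?S (b N))"
            using c(2)[OF i, of "\<lambda>i. b m i - b N i"] S_diff by simp
          also have "?S (b m) - ?S (b N) = (w n - ?S (b N)) - (w n - ?S (b m))" by simp
          also have "vabs \<dots> \<le> 1 / real (Suc N)"
          proof (rule vabs_diff_le)
            have "1 / real (Suc m) \<le> 1 / real (Suc N)" using m by (simp add: field_simps)
            then show "vabs (w n - ?S (b m)) \<le> 1 / real (Suc N)" using b[of m] by linarith
          qed (use b[of N] in linarith)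
          also have "\<dots> < c * e" by (rule N)
          finally show ?thesis using c(1) by (simp add: of_Kinf_diff)
        qed
        then show ?thesis by blast
      qed
      then show ?thesis using Kinf_complete[of "\<lambda>m. b m i"] by blast
    qed
    then obtain y where y: "\<And>i. i < n \<Longrightarrow> (\<lambda>m. of_Kinf (b m i)) \<longlonglongrightarrow> of_Kinf (y i)" by metis
    have "(\<lambda>m. w n - ?S (b m)) \<longlonglongrightarrow> w n - ?S y"
      by (intro tendsto_diff tendsto_const tendsto_sum tendsto_mult y) auto
    moreover have "(\<lambda>m. w n - ?S (b m)) \<longlonglongrightarrow> 0"
      by (rule tendsto_vabsI[OF LIMSEQ_Suc[OF lim_1_over_n]])
        (use b in \<open>auto intro!: always_eventually less_imp_le\<close>)
    ultimately have "w n - ?S y = 0" using LIMSEQ_unique by blast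
    then have "(\<Sum>i<Suc n. of_Kinf ((y(n := - 1)) i) * w i) = 0"
      by (simp add: of_Kinf_minus)
    then have "(y(n := - 1)) n = 0" using Suc.prems by blast
    then show False by simp
  qed
  then obtain d where d: "d > 0" "\<And>b :: nat \<Rightarrow> 'k fls. d \<le> vabs (w n - ?S b)" by blast
  have last: "d * vabs (of_Kinf (b n)) \<le> vabs (\<Sum>i<Suc n. of_Kinf (b i) * w i)" for b :: "nat \<Rightarrow> 'k fls"
  proof (cases "b n = 0")
    case False
    have "(\<Sum>i<Suc n. of_Kinf (b i) * w i) = of_Kinf (b n) * (w n - ?S (\<lambda>i. - b i / b n))"
      using False by (simp add: of_Kinf_minus of_Kinf_divide sum_negf sum_distrib_left distrib_left)
    then show ?thesis
      using mult_left_mono[OF d(2)[of "\<lambda>i. - b i / b n"], of "vabs (of_Kinf (b n))"]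
      by (simp add: vabs_mult mult.commute)
  qed simp
  \<comment> \<open>The last coefficient is at most \<open>vabs ?T / d\<close>. Subtracting its term
    from the sum \<open>?T\<close> enlarges the bound at most by the factor
    \<open>1 + vabs (w n) / d\<close>, after which the induction hypothesis applies to the
    others.\<close>
  define C where "C = min d (c / (1 + vabs (w n) / d))"
  have pos: "0 < 1 + vabs (w n) / d" using d(1) by (simp add: add_pos_nonneg)
  have "C * vabs (of_Kinf (b i)) \<le> vabs (\<Sum>i<Suc n. of_Kinf (b i) * w i)"
    if i: "i < Suc n" for b :: "nat \<Rightarrow> 'k fls" and i
  proof (cases "i = n")
    case True
    have "C * vabs (of_Kinf (b n)) \<le> d * vabs (of_Kinf (b n))"
      by (intro mult_right_mono) (auto simp: C_def)
    then show ?thesis unfolding True using last[of b] by linarith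
  next
    case False
    let ?T = "\<Sum>i<Suc n. of_Kinf (b i) * w i"
    have bound: "vabs (of_Kinf (b n) * w n) \<le> vabs ?T / d * vabs (w n)"
      unfolding vabs_mult using last[of b] d(1)
      by (intro mult_right_mono) (simp_all add: le_divide_eq mult.commute)
    have eq: "?S b = ?T - of_Kinf (b n) * w n" by simp
    have "vabs (?S b) \<le> max (vabs ?T) (vabs ?T / d * vabs (w n))"
      unfolding eq by (rule order_trans[OF vabs_diff_le_max max.mono[OF order_refl bound]])
    also have "\<dots> \<le> vabs ?T * (1 + vabs (w n) / d)"
      using d(1) by (intro max.boundedI) (simp_all add: distrib_left)
    finally have "c * vabs (of_Kinf (b i)) \<le> vabs ?T * (1 + vabs (w n) / d)"
      using c(2)[of i b] False i by (meson less_SucE order_trans)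
    then have "c / (1 + vabs (w n) / d) * vabs (of_Kinf (b i)) \<le> vabs ?T"
      using pos by (simp add: pos_divide_le_eq)
    moreover have "C * vabs (of_Kinf (b i)) \<le> c / (1 + vabs (w n) / d) * vabs (of_Kinf (b i))"
      by (intro mult_right_mono) (auto simp: C_def)
    ultimately show ?thesis by linarith
  qed
  moreover have "C > 0" using c(1) d(1) pos by (simp add: C_def)
  ultimately show ?case by blast
qed

subsection \<open>The ring \<open>A\<close> and its constants\<close>

definition of_F :: "'k \<Rightarrow> 'c" where
  "of_F c = of_Kinf (fls_const c)"

sublocale F: finite_field_hom of_F
  by unfold_locales (simp_all add: of_F_def of_Kinf_add of_Kinf_mult flip: fls_plus_const fls_const_mult_const)

lemma of_A_add: "of_A (a + b) = of_A a + of_A b"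
  by (simp add: of_A_def poly_to_Kinf_add of_Kinf_add)

lemma of_A_mult: "of_A (a * b) = of_A a * of_A b"
  by (simp add: of_A_def poly_to_Kinf_mult of_Kinf_mult)

lemma of_A_0 [simp]: "of_A 0 = 0" and of_A_1 [simp]: "of_A 1 = 1"
  by (simp_all add: of_A_def)

lemma of_A_minus: "of_A (- a) = - of_A a"
  by (simp add: of_A_def poly_to_Kinf_uminus of_Kinf_minus)

lemma of_A_power: "of_A (a ^ n) = of_A a ^ n"
  by (induction n) (auto simp: of_A_mult)

lemma of_A_sum: "of_A (\<Sum>i\<in>I. f i) = (\<Sum>i\<in>I. of_A (f i))"
  by (induction I rule: infinite_finite_induct) (auto simp: of_A_add)

lemma of_A_const: "of_A [:c:] = of_F c"
  by (simp add: of_A_def of_F_def poly_to_Kinf_const)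

lemma of_A_X: "of_A [:0, 1:] = theta"
  by (simp add: of_A_def theta_def poly_to_Kinf_X)

lemma of_A_monom: "of_A (Polynomial.monom c n) = of_F c * theta ^ n"
  using of_A_mult[of "[:c:]" "[:0, 1:] ^ n"]
  by (simp add: of_A_power of_A_X of_A_const monom_altdef)

lemma of_A_eq_sum: "of_A a = (\<Sum>i\<le>Polynomial.degree a. of_F (poly.coeff a i) * theta ^ i)"
  by (subst poly_as_sum_of_monoms[of a, symmetric]) (simp add: of_A_sum of_A_monom)

lemma vabs_of_F: "c \<noteq> 0 \<Longrightarrow> vabs (of_F c) = 1"
  by (simp add: of_F_def vabs_of_Kinf)

lemma vabs_of_F_le: "vabs (of_F c) \<le> 1"
  by (cases "c = 0") (auto simp: vabs_of_F)

lemma vabs_theta: "vabs theta = real CARD('k)"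
  by (simp add: theta_def vabs_of_Kinf)

lemma theta_nonzero [simp]: "theta \<noteq> 0"
  using vabs_theta q_ge_2 by auto

lemma vabs_of_A:
  assumes "a \<noteq> 0"
  shows "vabs (of_A a) = real CARD('k) ^ Polynomial.degree a"
proof -
  let ?d = "Polynomial.degree a"
  let ?f = "\<lambda>i. of_F (poly.coeff a i) * theta ^ i"
  have lead: "vabs (?f ?d) = real CARD('k) ^ ?d"
    using assms by (simp add: vabs_mult vabs_of_F vabs_power vabs_theta)
  have eq: "of_A a = (\<Sum>i<?d. ?f i) + ?f ?d"
    by (simp add: of_A_eq_sum flip: lessThan_Suc_atMost)
  show ?thesis
  proof (cases "?d = 0")
    case False
    have "vabs (\<Sum>i<?d. ?f i) \<le> real CARD('k) ^ (?d - 1)"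
    proof (rule vabs_sum_le)
      fix i assume i: "i \<in> {..<?d}"
      have "vabs (?f i) \<le> 1 * real CARD('k) ^ i"
        unfolding vabs_mult vabs_power vabs_theta by (intro mult_right_mono vabs_of_F_le) auto
      also have "\<dots> \<le> real CARD('k) ^ (?d - 1)"
        using i real_q_gt_1 by (simp add: power_increasing)
      finally show "vabs (?f i) \<le> real CARD('k) ^ (?d - 1)" .
    qed simp
    also have "\<dots> < real CARD('k) ^ ?d"
      using False real_q_gt_1 by (intro power_strict_increasing) auto
    finally show ?thesis using vabs_add_eq[of "\<Sum>i<?d. ?f i" "?f ?d"] lead eq by simp
  qed (use lead eq in simp)
qed

lemma of_A_eq_0_iff [simp]: "of_A a = 0 \<longleftrightarrow> a = 0"
proof
  assume "of_A a = 0"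
  then have "vabs (of_A a) = 0" by simp
  then show "a = 0" using vabs_of_A[of a] q_ge_2 by (cases "a = 0") auto
qed simp

lemma vabs_of_A_ge_1: "a \<noteq> 0 \<Longrightarrow> 1 \<le> vabs (of_A a)"
  using real_q_gt_1 by (simp add: vabs_of_A)

lemma at_t_nth: "fps_nth (at_t a) n = of_F (poly.coeff a n)"
  by (simp add: at_t_def coeff_map_poly flip: of_F_def)

lemma at_t_add: "at_t (a + b) = at_t a + at_t b"
  by (rule fps_ext) (simp add: at_t_nth F.e_add)

lemma at_t_mult: "at_t (a * b) = at_t a * at_t b"
proof (rule fps_ext)
  fix n
  have *: "of_F (\<Sum>i\<in>I. f i) = (\<Sum>i\<in>I. of_F (f i))" for I and f :: "nat \<Rightarrow> 'k"
    by (induction I rule: infinite_finite_induct) (auto simp: F.e_add)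
  show "fps_nth (at_t (a * b)) n = fps_nth (at_t a * at_t b) n"
    by (simp add: at_t_nth fps_mult_nth coeff_mult * F.e_mult atLeast0AtMost)
qed

lemma at_t_0 [simp]: "at_t 0 = 0" and at_t_1 [simp]: "at_t 1 = 1"
  by (rule fps_ext; simp add: at_t_nth)+

sublocale at_t: comm_ring_hom at_t
  by unfold_locales (simp_all add: at_t_add at_t_mult)

lemma at_t_eq_0_iff [simp]: "at_t a = 0 \<longleftrightarrow> a = 0"
proof
  assume "at_t a = 0"
  then have "fps_nth (at_t a) n = 0" for n by simp
  then show "a = 0" by (intro poly_eqI) (simp add: at_t_nth)
qed simp

lemma tate_at_t [simp]: "at_t a \<in> tate"
  by (rule tate_finite_support[of "Polynomial.degree a"]) (simp add: at_t_nth coeff_eq_0)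

end

section \<open>Eisenstein series\<close>

text \<open>Stated by coefficients and not by the degree so that \<open>polys_below 0\<close> is
  \<open>{0}\<close>; a condition \<open>degree < 0\<close> would give the empty set.\<close>

definition polys_below :: "nat \<Rightarrow> 'k::zero poly set" where
  "polys_below n = {p. \<forall>i\<ge>n. poly.coeff p i = 0}"

lemma polys_below_bij:
  "bij_betw (\<lambda>p. vec n (poly.coeff p)) (polys_below n) (carrier_vec n :: 'k::comm_monoid_add vec set)"
proof (rule bij_betw_byWitness[where f' = "\<lambda>v. \<Sum>i<n. Polynomial.monom (v $ i) i"])
  show "\<forall>p\<in>polys_below n. (\<Sum>i<n. Polynomial.monom (vec n (poly.coeff p) $ i) i) = p"
    by (auto simp: polys_below_def poly_eq_iff Polynomial.coeff_sum if_distrib cong: if_cong)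
  show "\<forall>v\<in>carrier_vec n. vec n (poly.coeff (\<Sum>i<n. Polynomial.monom (v $ i) i)) = v"
    by (auto simp: Polynomial.coeff_sum if_distrib cong: if_cong intro!: eq_vecI)
  show "(\<lambda>v. \<Sum>i<n. Polynomial.monom (v $ i) i) ` carrier_vec n \<subseteq> polys_below n"
    by (auto simp: polys_below_def Polynomial.coeff_sum)
qed auto

lemma finite_polys_below: "finite (polys_below n :: 'k::{comm_monoid_add,finite} poly set)"
  using bij_betw_finite[OF polys_below_bij] finite_carrier_vec by blast

lemma card_polys_below: "card (polys_below n :: 'k::{comm_monoid_add,finite} poly set) = CARD('k) ^ n"
  using bij_betw_same_card[OF polys_below_bij] card_carrier_vec by metis

lemma polys_below_degree: "n > 0 \<Longrightarrow> p \<in> polys_below n \<longleftrightarrow> Polynomial.degree p < n"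
  by (auto simp: polys_below_def coeff_eq_0 intro: degree_lessI)

lemma poly_cutoff_below: "poly_cutoff n p \<in> polys_below n"
  by (simp add: polys_below_def coeff_poly_cutoff)

lemma poly_cutoff_shift: "p = poly_cutoff n p + Polynomial.monom 1 n * poly_shift n p"
  for p :: "'a::comm_semiring_1 poly"
  by (rule poly_eqI) (simp add: coeff_poly_cutoff coeff_poly_shift coeff_monom_mult)

lemma (in discrete_subgroup) lattice_exp_minus: "lattice_exp L (- x) = - lattice_exp L x"
proof -
  have "lattice_exp L x + lattice_exp L (- x) = 0"
    using lattice_exp_add[of x "- x"] by simp
  then show ?thesis by (metis add_eq_0_iff)
qed

lemma has_sum_finite_sum:
  fixes f :: "'i \<Rightarrow> 'a \<Rightarrow> 'b::topological_comm_monoid_add"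
  assumes "\<And>i. i \<in> I \<Longrightarrow> (f i has_sum s i) A"
  shows "((\<lambda>x. \<Sum>i\<in>I. f i x) has_sum (\<Sum>i\<in>I. s i)) A"
  using assms by (induction I rule: infinite_finite_induct) (auto intro: has_sum_add)

context drinfeld_setting
begin

lemma has_sum_frob:
  fixes f :: "'i \<Rightarrow> 'c"
  assumes "(f has_sum s) A"
  shows "((\<lambda>x. f x ^ (CARD('k) ^ j)) has_sum (s ^ (CARD('k) ^ j))) A"
proof -
  have "((\<lambda>S. sum f S ^ (CARD('k) ^ j)) \<longlongrightarrow> s ^ (CARD('k) ^ j)) (finite_subsets_at_top A)"
    using assms unfolding has_sum_def by (rule tendsto_pow_nonarch)
  then show ?thesis by (simp add: has_sum_def F.frob_sum)
qed

section \<open>Linear forms with coefficients in \<open>A\<close> and the lattice of a point\<close>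

definition alin :: "'k poly vec \<Rightarrow> 'c vec \<Rightarrow> 'c" where
  "alin a z = lin_comb (map_vec poly_to_Kinf a) z"

lemma alin_eq: "dim_vec a = dim_vec z \<Longrightarrow> alin a z = (\<Sum>i<dim_vec z. of_A (a $ i) * z $ i)"
  by (simp add: alin_def lin_comb_def of_A_def)

lemma alin_add:
  "dim_vec a = dim_vec z \<Longrightarrow> dim_vec b = dim_vec z \<Longrightarrow> alin (a + b) z = alin a z + alin b z"
  by (simp add: alin_eq of_A_add distrib_right sum.distrib)

lemma alin_minus: "dim_vec a = dim_vec z \<Longrightarrow> alin (- a) z = - alin a z"
  by (simp add: alin_eq of_A_minus sum_negf)

lemma alin_smult: "dim_vec a = dim_vec z \<Longrightarrow> alin (c \<cdot>\<^sub>v a) z = of_A c * alin a z"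
  by (simp add: alin_eq of_A_mult sum_distrib_left mult.assoc)

lemma alin_zero [simp]: "alin (0\<^sub>v (dim_vec z)) z = 0"
  by (simp add: alin_eq)

lemma A_lattice_eq: "A_lattice z = (\<lambda>a. alin a z) ` carrier_vec (dim_vec z)"
  by (auto simp: A_lattice_def alin_def)

lemma Omega_dim: "z \<in> Omega r \<Longrightarrow> dim_vec z = r"
  by (auto simp: Omega_def)

lemma Omega_bound:
  assumes z: "z \<in> Omega r"
  obtains c where "c > 0"
    "\<And>b i. b \<in> carrier_vec r \<Longrightarrow> i < r \<Longrightarrow> c * vabs (of_Kinf (b $ i)) \<le> vabs (lin_comb b z)"
    "\<And>a i. a \<in> carrier_vec r \<Longrightarrow> i < r \<Longrightarrow> c * vabs (of_A (a $ i)) \<le> vabs (alin a z)"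
proof -
  have dim: "dim_vec z = r" by (rule Omega_dim[OF z])
  have lc: "lin_comb b z = (\<Sum>i<r. of_Kinf (b $ i) * z $ i)" for b
    by (simp add: lin_comb_def dim)
  have "\<exists>c>0. \<forall>b :: nat \<Rightarrow> 'k fls. \<forall>i<r. c * vabs (of_Kinf (b i)) \<le> vabs (\<Sum>i<r. of_Kinf (b i) * z $ i)"
  proof (rule independent_norm_bound)
    fix b :: "nat \<Rightarrow> 'k fls" assume "(\<Sum>i<r. of_Kinf (b i) * z $ i) = 0"
    then have "lin_comb (vec r b) z = 0" by (simp add: lc)
    then have "vec r b = 0\<^sub>v r" using z by (auto simp: Omega_def)
    then have "vec r b $ i = 0" if "i < r" for i using that by simp
    then show "\<forall>i<r. b i = 0" by simp
  qed
  then obtain c where c: "c > 0" "\<And>b :: nat \<Rightarrow> 'k fls. \<And>i. i < r \<Longrightarrow>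
      c * vabs (of_Kinf (b i)) \<le> vabs (\<Sum>i<r. of_Kinf (b i) * z $ i)" by blast
  show ?thesis
  proof (rule that[OF c(1)])
    show 1: "c * vabs (of_Kinf (b $ i)) \<le> vabs (lin_comb b z)"
      if "b \<in> carrier_vec r" "i < r" for b i
      using c(2)[OF that(2), of "\<lambda>i. b $ i"] by (simp add: lc)
    show "c * vabs (of_A (a $ i)) \<le> vabs (alin a z)" if "a \<in> carrier_vec r" "i < r" for a i
      using 1[of "map_vec poly_to_Kinf a" i] that by (simp add: alin_def of_A_def)
  qed
qed

lemma alin_eq_0_iff:
  assumes z: "z \<in> Omega r" and a: "a \<in> carrier_vec r"
  shows "alin a z = 0 \<longleftrightarrow> a = 0\<^sub>v r"
proof
  assume *: "alin a z = 0"
  obtain c where c: "c > 0" "\<And>a i. a \<in> carrier_vec r \<Longrightarrow> i < r \<Longrightarrow> c * vabs (of_A (a $ i)) \<le> vabs (alin a z)"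
    using Omega_bound[OF z] by metis
  have "a $ i = 0" if "i < r" for i
  proof -
    have "c * vabs (of_A (a $ i)) \<le> 0" using c(2)[OF a that] * by simp
    then have "vabs (of_A (a $ i)) \<le> 0" using c(1) by (simp add: mult_le_0_iff)
    then show ?thesis using vabs_nonneg[of "of_A (a $ i)"] by (metis antisym vabs_eq_0_iff of_A_eq_0_iff)
  qed
  then show "a = 0\<^sub>v r" using a by (intro eq_vecI) auto
qed (use Omega_dim[OF z] alin_zero[of z] in simp)

lemma alin_inj:
  assumes z: "z \<in> Omega r"
  shows "inj_on (\<lambda>a. alin a z) (carrier_vec r)"
proof (rule inj_onI)
  fix a b :: "'k poly vec"
  assume *: "a \<in> carrier_vec r" "b \<in> carrier_vec r" "alin a z = alin b z"
  have "alin (a + - b) z = 0"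
    using * Omega_dim[OF z] by (subst alin_add) (auto simp: alin_minus)
  then have "a + - b = 0\<^sub>v r" using * by (subst (asm) alin_eq_0_iff[OF z]) auto
  then have "(a + - b) $ i = 0" if "i < r" for i using that by simp
  then show "a = b" using * by (intro eq_vecI) auto
qed

lemma finite_vabs_of_A_le: "finite {p. vabs (of_A p) \<le> M}"
proof -
  obtain n where n: "M < real CARD('k) ^ n" using real_arch_pow[OF real_q_gt_1] by blast
  have "{p. vabs (of_A p) \<le> M} \<subseteq> polys_below (Suc n)"
  proof safe
    fix p assume p: "vabs (of_A p) \<le> M"
    have "Polynomial.degree p < Suc n"
    proof (cases "p = 0")
      case False
      then have "real CARD('k) ^ Polynomial.degree p < real CARD('k) ^ n"
        using p n by (simp add: vabs_of_A)
      then show ?thesis using power_less_imp_less_exp[OF real_q_gt_1] by (simp add: less_SucI)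
    qed simp
    then show "p \<in> polys_below (Suc n)" by (simp add: polys_below_degree)
  qed
  then show ?thesis using finite_polys_below finite_subset by blast
qed

lemma finite_alin_ball:
  assumes z: "z \<in> Omega r"
  shows "finite {a \<in> carrier_vec r. vabs (alin a z) \<le> M}"
proof -
  obtain c where c: "c > 0" "\<And>a i. a \<in> carrier_vec r \<Longrightarrow> i < r \<Longrightarrow> c * vabs (of_A (a $ i)) \<le> vabs (alin a z)"
    using Omega_bound[OF z] by metis
  have "{a \<in> carrier_vec r. vabs (alin a z) \<le> M}
      \<subseteq> {a \<in> carrier_vec r. \<forall>i<r. a $ i \<in> {p. vabs (of_A p) \<le> M / c}}"
  proof safe
    fix a i assume a: "a \<in> carrier_vec r" "vabs (alin a z) \<le> M" "i < r"
    then have "c * vabs (of_A (a $ i)) \<le> M" using c(2)[of a i] by linarith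
    then show "vabs (of_A (a $ i)) \<le> M / c" using c(1) by (simp add: le_divide_eq mult.commute)
  qed
  then show ?thesis using finite_vecs[OF finite_vabs_of_A_le] finite_subset by blast
qed

lemma A_lattice_discrete:
  assumes z: "z \<in> Omega r"
  shows "discrete_subgroup (A_lattice z)"
proof
  have dim: "dim_vec z = r" by (rule Omega_dim[OF z])
  have "alin a z + alin b z \<in> A_lattice z" if "a \<in> carrier_vec r" "b \<in> carrier_vec r" for a b
    using that dim by (auto simp: A_lattice_eq intro!: image_eqI[of _ _ "a + b"] alin_add[symmetric])
  moreover have "- alin a z \<in> A_lattice z" if "a \<in> carrier_vec r" for a
    using that dim by (auto simp: A_lattice_eq intro!: image_eqI[of _ _ "- a"] alin_minus[symmetric])
  moreover have "0 \<in> A_lattice z"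
    by (auto simp: A_lattice_eq intro!: image_eqI[of _ _ "0\<^sub>v (dim_vec z)"])
  ultimately show "add_subgroup (A_lattice z)"
    using dim by (auto simp: add_subgroup_def A_lattice_eq)
  have "{y \<in> A_lattice z. vabs y \<le> M} = (\<lambda>a. alin a z) ` {a \<in> carrier_vec r. vabs (alin a z) \<le> M}" for M
    using dim by (auto simp: A_lattice_eq)
  then show "finite {y \<in> A_lattice z. vabs y \<le> M}" for M
    using finite_alin_ball[OF z] by simp
qed

lemma A_lattice_smult: "y \<in> A_lattice z \<Longrightarrow> of_A c * y \<in> A_lattice z"
  by (auto simp: A_lattice_eq intro!: image_eqI[of _ _ "c \<cdot>\<^sub>v _"] alin_smult[symmetric])

lemma A_lattice_scale_exp:
  assumes z: "z \<in> Omega r"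
  shows "lattice_exp (A_lattice z) (of_F c * x) = of_F c * lattice_exp (A_lattice z) x"
proof (cases "c = 0")
  case True
  then show ?thesis using discrete_subgroup.lattice_exp_zero[OF A_lattice_discrete[OF z]] by simp
next
  case False
  have "inverse (of_F c) = of_F (inverse c)"
    using False by (metis F.e_mult F.e_one inverse_unique right_inverse)
  then show ?thesis
    using False A_lattice_smult[of _ z "[:c:]"] A_lattice_smult[of _ z "[:inverse c:]"]
    by (intro discrete_subgroup.lattice_exp_scale[OF A_lattice_discrete[OF z]])
      (auto simp: of_A_const vabs_of_F)
qed

lemma of_A_below:
  assumes "p \<in> polys_below n"
  shows "of_A p = (\<Sum>i<n. of_F (poly.coeff p i) * theta ^ i)"
proof (cases "n = 0")
  case True
  then have "p = 0" using assms by (intro poly_eqI) (auto simp: polys_below_def)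
  then show ?thesis using True by simp
next
  case False
  then have d: "Polynomial.degree p < n" using assms by (simp add: polys_below_degree)
  show ?thesis
    unfolding of_A_eq_sum
    by (rule sum.mono_neutral_left) (use d in \<open>auto simp: coeff_eq_0\<close>)
qed

text \<open>Translation of the identity \<open>a(\<theta>) = a(t)\<close> modulo \<open>t - \<theta>\<close> into coefficients.\<close>

lemma exp_alin_divide:
  assumes z: "z \<in> Omega r" and a: "a \<in> carrier_vec r"
  shows "lattice_exp (A_lattice z) (alin a z / theta ^ Suc N)
    = (\<Sum>l<r. \<Sum>m\<le>N. of_F (poly.coeff (a $ l) m)
        * lattice_exp (A_lattice z) (z $ l / theta ^ Suc (N - m)))"
proof -
  interpret L: discrete_subgroup "A_lattice z" by (rule A_lattice_discrete[OF z])
  have dim: "dim_vec z = r" by (rule Omega_dim[OF z])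
  let ?e = "lattice_exp (A_lattice z)"
  have zl: "z $ l \<in> A_lattice z" if "l < r" for l
  proof -
    have "alin (unit_vec r l) z = (\<Sum>i<r. if i = l then z $ i else 0)"
      using that by (simp add: alin_eq dim if_distrib[of of_A] if_distrib[of "\<lambda>x. x * _"] cong: if_cong)
    also have "\<dots> = z $ l" using that by simp
    finally show ?thesis using dim that by (auto simp: A_lattice_eq intro!: image_eqI[of _ _ "unit_vec r l"])
  qed
  \<comment> \<open>The part of \<open>p\<close> from degree \<open>N + 1\<close> on contributes an
    element of the lattice, which the exponential kills; a lower monomial only reduces the power of
    \<open>theta\<close> in the denominator.\<close>
  have summand: "?e (of_A p * z $ l / theta ^ Suc N)
      = (\<Sum>m\<le>N. of_F (poly.coeff p m) * ?e (z $ l / theta ^ Suc (N - m)))" if l: "l < r" for p l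
  proof -
    let ?c = "poly_cutoff (Suc N) p" and ?s = "poly_shift (Suc N) p"
    have "of_A p = of_A ?c + theta ^ Suc N * of_A ?s"
      by (subst poly_cutoff_shift[of p "Suc N"]) (simp add: of_A_add of_A_mult of_A_monom del: power_Suc)
    then have "of_A p * z $ l / theta ^ Suc N = of_A ?c * z $ l / theta ^ Suc N + of_A ?s * z $ l"
      by (simp add: field_simps del: power_Suc)
    moreover have "of_A ?s * z $ l \<in> A_lattice z" by (rule A_lattice_smult[OF zl[OF l]])
    ultimately have "?e (of_A p * z $ l / theta ^ Suc N) = ?e (of_A ?c * z $ l / theta ^ Suc N)"
      using L.lattice_exp_add L.lattice_exp_eq_0_iff by simp
    also have "of_A ?c * z $ l / theta ^ Suc N
        = (\<Sum>m\<le>N. of_F (poly.coeff p m) * (z $ l / theta ^ Suc (N - m)))"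
    proof -
      have "of_A ?c = (\<Sum>m\<le>N. of_F (poly.coeff p m) * theta ^ m)"
        by (simp add: of_A_below[OF poly_cutoff_below] coeff_poly_cutoff lessThan_Suc_atMost
            cong: sum.cong_simp)
      then have "of_A ?c * z $ l / theta ^ Suc N
          = (\<Sum>m\<le>N. of_F (poly.coeff p m) * theta ^ m * (z $ l / theta ^ Suc N))"
        by (simp add: sum_distrib_right sum_divide_distrib del: power_Suc)
      also have "\<dots> = (\<Sum>m\<le>N. of_F (poly.coeff p m) * (z $ l / theta ^ Suc (N - m)))"
      proof (rule sum.cong[OF refl])
        fix m assume "m \<in> {..N}"
        then have "theta ^ Suc N = theta ^ m * theta ^ Suc (N - m)"
          by (simp flip: power_add)
        then show "of_F (poly.coeff p m) * theta ^ m * (z $ l / theta ^ Suc N)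
            = of_F (poly.coeff p m) * (z $ l / theta ^ Suc (N - m))"
          by (simp only:) (simp del: power_Suc)
      qed
      finally show ?thesis .
    qed
    finally show ?thesis by (simp only: L.lattice_exp_sum A_lattice_scale_exp[OF z])
  qed
  have "alin a z / theta ^ Suc N = (\<Sum>l<r. of_A (a $ l) * z $ l / theta ^ Suc N)"
    using a dim by (simp add: alin_eq sum_divide_distrib del: power_Suc)
  then show ?thesis by (simp only: L.lattice_exp_sum) (simp add: summand del: power_Suc)
qed

lemma vanishing_alin_power:
  assumes z: "z \<in> Omega r" and m: "m > 0"
  shows "vanishing (\<lambda>a. inverse (alin a z) ^ m) (carrier_vec r)"
  unfolding vanishing_def
proof (intro allI impI)
  fix e :: real assume e: "e > 0"
  have "{a \<in> carrier_vec r. e \<le> vabs (inverse (alin a z) ^ m)}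
      \<subseteq> {a \<in> carrier_vec r. vabs (alin a z) \<le> max 1 (inverse e)}"
  proof safe
    fix a :: "'k poly vec" assume a: "a \<in> carrier_vec r" "e \<le> vabs (inverse (alin a z) ^ m)"
    have "inverse (inverse (vabs (alin a z)) ^ m) \<le> inverse e"
      using a(2) e by (intro le_imp_inverse_le) (auto simp: vabs_power vabs_inverse)
    then have "vabs (alin a z) ^ m \<le> inverse e" by (simp add: power_inverse)
    moreover have "vabs (alin a z) \<le> vabs (alin a z) ^ m" if "1 \<le> vabs (alin a z)"
      using power_increasing[OF _ that, of 1 m] m by simp
    ultimately show "vabs (alin a z) \<le> max 1 (inverse e)" by fastforce
  qed
  then show "finite {a \<in> carrier_vec r. e \<le> vabs (inverse (alin a z) ^ m)}"
    using finite_alin_ball[OF z] finite_subset by blast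
qed

text \<open>The coefficient of \<open>t^n\<close> in
  \<open>a\<^sub>l(t) / (a \<cdot> z)^(q^j)\<close>. At \<open>a = 0\<close> it is 0 by the
  convention for \<open>inverse 0\<close>, so the sums may run over all of
  \<open>A^r\<close>.\<close>

definition eis_term :: "nat \<Rightarrow> nat \<Rightarrow> 'c vec \<Rightarrow> nat \<Rightarrow> 'k poly vec \<Rightarrow> 'c" where
  "eis_term j l z n a = of_F (poly.coeff (a $ l) n) * inverse (alin a z) ^ (CARD('k) ^ j)"

definition eis :: "nat \<Rightarrow> nat \<Rightarrow> 'c vec \<Rightarrow> 'c fps" where
  "eis j l z = Abs_fps (\<lambda>n. infsum (eis_term j l z n) (carrier_vec (dim_vec z)))"

lemma vabs_eis_term_le: "vabs (eis_term j l z n a) \<le> vabs (inverse (alin a z) ^ (CARD('k) ^ j))"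
  using mult_right_mono[OF vabs_of_F_le, of "vabs (inverse (alin a z) ^ (CARD('k) ^ j))"]
  by (simp add: eis_term_def vabs_mult)

lemma vanishing_eis_term:
  assumes z: "z \<in> Omega r"
  shows "vanishing (eis_term j l z n) (carrier_vec r)"
  by (rule vanishing_le[OF vanishing_alin_power[OF z, of "CARD('k) ^ j"], of _ 1])
    (use q_ge_2 vabs_eis_term_le in auto)

lemma eis_has_sum:
  assumes z: "z \<in> Omega r"
  shows "(eis_term j l z n has_sum fps_nth (eis j l z) n) (carrier_vec r)"
  using has_sum_infsum[OF vanishing_imp_summable[OF vanishing_eis_term[OF z]]] Omega_dim[OF z]
  by (simp add: eis_def)

lemma s_fun_nth: "fps_nth (s_fun i z) n = lattice_exp (A_lattice z) (z $ i / theta ^ Suc n)"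
  by (simp add: s_fun_def)

lemma frob_twist_nth: "fps_nth (frob_twist p i g) n = fps_nth g n ^ (p ^ i)"
  by (simp add: frob_twist_def)

text \<open>Raising \<open>exp_alin_divide\<close> to the power \<open>q^i\<close> leaves its
  constants unchanged, so the pairing of the two vectors can be computed inside the sum over
  \<open>a\<close>, one power of \<open>t\<close> at a time.\<close>

lemma eis_s_fun_has_sum:
  assumes z: "z \<in> Omega r"
  shows "((\<lambda>a. lattice_exp (A_lattice z) (alin a z / theta ^ Suc N) ^ (CARD('k) ^ i)
      * inverse (alin a z) ^ (CARD('k) ^ j)) has_sum
      fps_nth (\<Sum>l<r. eis j l z * frob_twist CARD('k) i (s_fun l z)) N) (carrier_vec r)"
proof -
  let ?e = "lattice_exp (A_lattice z)"
  have "((\<lambda>a. \<Sum>l<r. \<Sum>m\<le>N. eis_term j l z m a * ?e (z $ l / theta ^ Suc (N - m)) ^ (CARD('k) ^ i))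
      has_sum (\<Sum>l<r. \<Sum>m\<le>N. fps_nth (eis j l z) m * ?e (z $ l / theta ^ Suc (N - m)) ^ (CARD('k) ^ i)))
      (carrier_vec r)"
    by (intro has_sum_finite_sum has_sum_cmult_left eis_has_sum[OF z])
  moreover have "(\<Sum>l<r. \<Sum>m\<le>N. fps_nth (eis j l z) m * ?e (z $ l / theta ^ Suc (N - m)) ^ (CARD('k) ^ i))
      = fps_nth (\<Sum>l<r. eis j l z * frob_twist CARD('k) i (s_fun l z)) N"
    by (simp add: fps_sum_nth fps_mult_nth frob_twist_nth s_fun_nth atLeast0AtMost)
  moreover have "(\<Sum>l<r. \<Sum>m\<le>N. eis_term j l z m a * ?e (z $ l / theta ^ Suc (N - m)) ^ (CARD('k) ^ i))
      = ?e (alin a z / theta ^ Suc N) ^ (CARD('k) ^ i) * inverse (alin a z) ^ (CARD('k) ^ j)"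
    if a: "a \<in> carrier_vec r" for a
    unfolding exp_alin_divide[OF z a] F.frob_sum power_mult_distrib F.e_power_card sum_distrib_right
    by (intro sum.cong refl) (simp add: eis_term_def mult_ac)
  ultimately show ?thesis
    by (subst has_sum_cong[of "carrier_vec r", symmetric]) auto
qed

section \<open>Residue classes modulo powers of \<open>theta\<close> and torsion points\<close>

definition residues_vec :: "nat \<Rightarrow> nat \<Rightarrow> 'k poly vec set" where
  "residues_vec r n = {\<mu> \<in> carrier_vec r. \<forall>l<r. \<mu> $ l \<in> polys_below n}"

lemma finite_residues_vec: "finite (residues_vec r n)"
  and card_residues_vec: "card (residues_vec r n) = CARD('k) ^ (n * r)"
  unfolding residues_vec_def
  by (simp_all add: finite_vecs finite_polys_below card_vecs card_polys_below power_mult)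

lemma residues_vec_decomp_unique:
  assumes "\<mu> \<in> residues_vec r n" "\<mu>' \<in> residues_vec r n" "b \<in> carrier_vec r" "b' \<in> carrier_vec r"
    and eq: "\<mu> + Polynomial.monom 1 n \<cdot>\<^sub>v b = \<mu>' + Polynomial.monom 1 n \<cdot>\<^sub>v b'"
  shows "\<mu> = \<mu>' \<and> b = b'"
proof -
  have coeff: "poly.coeff ((\<mu> + Polynomial.monom 1 n \<cdot>\<^sub>v b) $ l) i
      = poly.coeff ((\<mu>' + Polynomial.monom 1 n \<cdot>\<^sub>v b') $ l) i" for l i
    by (simp add: eq)
  have *: "poly.coeff (\<mu> $ l) i + (if i < n then 0 else poly.coeff (b $ l) (i - n))
      = poly.coeff (\<mu>' $ l) i + (if i < n then 0 else poly.coeff (b' $ l) (i - n))" if "l < r" for l i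
    using that assms(1-4) coeff[of l i]
    by (simp add: residues_vec_def coeff_monom_mult not_less split: if_splits)
  have "poly.coeff (\<mu> $ l) i = poly.coeff (\<mu>' $ l) i" if "l < r" for l i
    using *[OF that, of i] assms that by (cases "i < n") (auto simp: residues_vec_def polys_below_def)
  moreover have "poly.coeff (b $ l) i = poly.coeff (b' $ l) i" if "l < r" for l i
    using *[OF that, of "i + n"] assms that by (auto simp: residues_vec_def polys_below_def)
  ultimately show ?thesis
    using assms by (auto simp: residues_vec_def intro!: eq_vecI poly_eqI)
qed

lemma residues_vec_Union:
  "(\<Union>\<mu>\<in>residues_vec r n. (\<lambda>b. \<mu> + Polynomial.monom 1 n \<cdot>\<^sub>v b) ` carrier_vec r) = carrier_vec r"
proof (intro equalityI subsetI)
  fix a :: "'k poly vec" assume a: "a \<in> carrier_vec r"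
  let ?\<mu> = "map_vec (poly_cutoff n) a" and ?b = "map_vec (poly_shift n) a"
  have "a = ?\<mu> + Polynomial.monom 1 n \<cdot>\<^sub>v ?b"
    using a by (intro eq_vecI) (auto simp: poly_cutoff_shift[symmetric])
  moreover have "?\<mu> \<in> residues_vec r n"
    using a by (auto simp: residues_vec_def poly_cutoff_below)
  moreover have "?b \<in> carrier_vec r" using a by simp
  ultimately show "a \<in> (\<Union>\<mu>\<in>residues_vec r n. (\<lambda>b. \<mu> + Polynomial.monom 1 n \<cdot>\<^sub>v b) ` carrier_vec r)"
    by blast
qed (auto simp: residues_vec_def)

text \<open>The \<open>theta ^ n\<close>-torsion of the Drinfeld module attached to the lattice of
  \<open>z\<close>. The parametrization by residues is injective, whence the group has
  \<open>q^(n r)\<close> elements.\<close>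

definition torsion :: "'c vec \<Rightarrow> nat \<Rightarrow> 'c set" where
  "torsion z n = (\<lambda>\<mu>. lattice_exp (A_lattice z) (alin \<mu> z / theta ^ n)) ` residues_vec (dim_vec z) n"

lemma alin_divide_in_lattice:
  assumes z: "z \<in> Omega r" and \<mu>: "\<mu> \<in> residues_vec r n" and "alin \<mu> z / theta ^ n \<in> A_lattice z"
  shows "\<mu> = 0\<^sub>v r"
proof -
  have dim: "dim_vec z = r" by (rule Omega_dim[OF z])
  obtain b where b: "b \<in> carrier_vec r" "alin \<mu> z / theta ^ n = alin b z"
    using assms(3) dim by (auto simp: A_lattice_eq)
  have \<mu>c: "\<mu> \<in> carrier_vec r" using \<mu> by (simp add: residues_vec_def)
  have "alin \<mu> z = alin (Polynomial.monom 1 n \<cdot>\<^sub>v b) z"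
    using b dim by (simp add: alin_smult of_A_monom field_simps)
  then have "\<mu> = Polynomial.monom 1 n \<cdot>\<^sub>v b"
    using inj_onD[OF alin_inj[OF z]] \<mu>c b(1) by auto
  then have "\<mu> + Polynomial.monom 1 n \<cdot>\<^sub>v 0\<^sub>v r = 0\<^sub>v r + Polynomial.monom 1 n \<cdot>\<^sub>v b"
    using \<mu>c b(1) by auto
  moreover have "0\<^sub>v r \<in> residues_vec r n" by (auto simp: residues_vec_def polys_below_def)
  ultimately show ?thesis
    using residues_vec_decomp_unique[OF \<mu>, of "0\<^sub>v r" "0\<^sub>v r" b] b(1) by auto
qed

lemma torsion_inj:
  assumes z: "z \<in> Omega r"
  shows "inj_on (\<lambda>\<mu>. lattice_exp (A_lattice z) (alin \<mu> z / theta ^ n)) (residues_vec r n)"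
proof (rule inj_onI)
  interpret L: discrete_subgroup "A_lattice z" by (rule A_lattice_discrete[OF z])
  have dim: "dim_vec z = r" by (rule Omega_dim[OF z])
  fix \<mu> \<nu> assume *: "\<mu> \<in> residues_vec r n" "\<nu> \<in> residues_vec r n"
    "lattice_exp (A_lattice z) (alin \<mu> z / theta ^ n) = lattice_exp (A_lattice z) (alin \<nu> z / theta ^ n)"
  have car: "\<mu> \<in> carrier_vec r" "\<nu> \<in> carrier_vec r" using * by (auto simp: residues_vec_def)
  have "alin \<mu> z / theta ^ n = alin (\<mu> + - \<nu>) z / theta ^ n + alin \<nu> z / theta ^ n"
    using car dim by (simp add: alin_add alin_minus flip: add_divide_distrib)
  then have "lattice_exp (A_lattice z) (alin (\<mu> + - \<nu>) z / theta ^ n) = 0"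
    using L.lattice_exp_add *(3) by (metis add_right_cancel add_0)
  then have "alin (\<mu> + - \<nu>) z / theta ^ n \<in> A_lattice z"
    using L.lattice_exp_eq_0_iff by simp
  then have "\<mu> + - \<nu> = 0\<^sub>v r"
    using * by (intro alin_divide_in_lattice[OF z]) (auto simp: residues_vec_def polys_below_def)
  then have "(\<mu> + - \<nu>) $ i = 0" if "i < r" for i using that by simp
  then show "\<mu> = \<nu>" using car by (intro eq_vecI) auto
qed

lemma torsion_subgroup:
  assumes z: "z \<in> Omega r"
  shows "add_subgroup (torsion z n)"
proof -
  interpret L: discrete_subgroup "A_lattice z" by (rule A_lattice_discrete[OF z])
  have dim: "dim_vec z = r" by (rule Omega_dim[OF z])
  let ?f = "\<lambda>\<mu>. lattice_exp (A_lattice z) (alin \<mu> z / theta ^ n)"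
  have add: "?f \<mu> + ?f \<nu> = ?f (\<mu> + \<nu>)" if "\<mu> \<in> carrier_vec r" "\<nu> \<in> carrier_vec r" for \<mu> \<nu>
    using that dim by (simp add: alin_add add_divide_distrib L.lattice_exp_add)
  have minus: "- ?f \<mu> = ?f (- \<mu>)" if "\<mu> \<in> carrier_vec r" for \<mu>
    using that dim by (simp add: alin_minus L.lattice_exp_minus)
  have zero: "0 = ?f (0\<^sub>v r)" using alin_zero[of z] dim by simp
  have mem: "?f \<mu> \<in> torsion z n" if "\<mu> \<in> residues_vec r n" for \<mu>
    using that dim by (simp add: torsion_def)
  show ?thesis
    unfolding add_subgroup_def
  proof (intro conjI ballI)
    show "0 \<in> torsion z n" using mem[of "0\<^sub>v r"] zero by (simp add: residues_vec_def polys_below_def)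
    fix x assume "x \<in> torsion z n"
    then obtain \<mu> where \<mu>: "\<mu> \<in> residues_vec r n" "x = ?f \<mu>" using dim by (auto simp: torsion_def)
    have "- \<mu> \<in> residues_vec r n" using \<mu>(1) by (auto simp: residues_vec_def polys_below_def)
    then show "- x \<in> torsion z n" using \<mu> mem minus by (auto simp: residues_vec_def)
    fix y assume "y \<in> torsion z n"
    then obtain \<nu> where \<nu>: "\<nu> \<in> residues_vec r n" "y = ?f \<nu>" using dim by (auto simp: torsion_def)
    have "\<mu> + \<nu> \<in> residues_vec r n" using \<mu>(1) \<nu>(1) by (auto simp: residues_vec_def polys_below_def)
    then show "x + y \<in> torsion z n" using \<mu> \<nu> mem add by (auto simp: residues_vec_def)
  qed
qed

lemma card_torsion:
  assumes z: "z \<in> Omega r"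
  shows "card (torsion z n) = CARD('k) ^ (n * r)"
  unfolding torsion_def Omega_dim[OF z] card_image[OF torsion_inj[OF z]] by (rule card_residues_vec)

lemma finite_torsion: "finite (torsion z n)"
  by (simp add: torsion_def finite_residues_vec)

text \<open>Grouping the lattice vectors by their class modulo \<open>\<theta>\<^bsup>N+1\<^esup>\<close> turns the series into a power
  sum over the torsion points, since \<open>\<Sum> 1/(x + \<lambda>) = 1/exp(x)\<close>.\<close>

lemma eis_s_fun_nth:
  assumes z: "z \<in> Omega r"
  shows "fps_nth (\<Sum>l<r. eis j l z * frob_twist CARD('k) i (s_fun l z)) N
    = inverse (theta ^ Suc N) ^ (CARD('k) ^ j)
      * (\<Sum>v\<in>torsion z (Suc N). v ^ (CARD('k) ^ i) * inverse v ^ (CARD('k) ^ j))"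
proof -
  interpret L: discrete_subgroup "A_lattice z" by (rule A_lattice_discrete[OF z])
  have dim: "dim_vec z = r" by (rule Omega_dim[OF z])
  let ?e = "lattice_exp (A_lattice z)" and ?n = "Suc N"
  let ?f = "\<lambda>a. ?e (alin a z / theta ^ ?n) ^ (CARD('k) ^ i) * inverse (alin a z) ^ (CARD('k) ^ j)"
  let ?g = "\<lambda>\<mu> b. \<mu> + Polynomial.monom 1 ?n \<cdot>\<^sub>v b"
  let ?x = "\<lambda>\<mu>. alin \<mu> z / theta ^ ?n"
  define S where "S \<mu> = inverse (theta ^ ?n) ^ (CARD('k) ^ j)
      * (?e (?x \<mu>) ^ (CARD('k) ^ i) * inverse (?e (?x \<mu>)) ^ (CARD('k) ^ j))" for \<mu>
  have inj: "inj_on (?g \<mu>) (carrier_vec r)" if "\<mu> \<in> residues_vec r ?n" for \<mu>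
    using residues_vec_decomp_unique[OF that that] by (intro inj_onI) blast
  have "(?f has_sum S \<mu>) (?g \<mu> ` carrier_vec r)" if \<mu>: "\<mu> \<in> residues_vec r ?n" for \<mu>
  proof -
    have \<mu>c: "\<mu> \<in> carrier_vec r" using \<mu> by (simp add: residues_vec_def)
    have alin: "alin (?g \<mu> b) z = theta ^ ?n * (?x \<mu> + alin b z)" if "b \<in> carrier_vec r" for b
      using that \<mu>c dim by (simp add: alin_add alin_smult of_A_monom distrib_left del: power_Suc)
    have e: "?e (alin (?g \<mu> b) z / theta ^ ?n) = ?e (?x \<mu>)" if b: "b \<in> carrier_vec r" for b
    proof -
      have "alin b z \<in> A_lattice z" using b dim by (auto simp: A_lattice_eq)
      then show ?thesis
        unfolding alin[OF b] by (intro L.lattice_exp_cong) (simp del: power_Suc)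
    qed
    have "((\<lambda>b. inverse (theta ^ ?n) ^ (CARD('k) ^ j)
        * (?e (?x \<mu>) ^ (CARD('k) ^ i) * inverse (?x \<mu> + alin b z) ^ (CARD('k) ^ j))) has_sum S \<mu>) (carrier_vec r)"
    \<comment> \<open>In the first case the exponential at \<open>?x \<mu>\<close> is 0, and its
      positive power occurs in every summand and in \<open>S \<mu>\<close>.\<close>
    proof (cases "?x \<mu> \<in> A_lattice z")
      case True
      then have "?e (?x \<mu>) = 0" using L.lattice_exp_eq_0_iff by blast
      then show ?thesis using q_ge_2 by (simp add: S_def power_0_left has_sum_0)
    next
      case False
      have "((\<lambda>y. inverse (?x \<mu> + y)) has_sum inverse (?e (?x \<mu>))) ((\<lambda>b. alin b z) ` carrier_vec r)"
        using L.has_sum_inverse_lattice[OF False] dim by (simp add: A_lattice_eq)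
      then have "((\<lambda>b. inverse (?x \<mu> + alin b z)) has_sum inverse (?e (?x \<mu>))) (carrier_vec r)"
        by (simp only: has_sum_reindex[OF alin_inj[OF z]] o_def)
      from has_sum_frob[OF this, of j] show ?thesis
        unfolding S_def by (intro has_sum_cmult_right)
    qed
    then have "((?f \<circ> ?g \<mu>) has_sum S \<mu>) (carrier_vec r)"
      by (rule has_sum_cong[THEN iffD1, rotated])
        (simp only: o_def e, simp add: alin power_mult_distrib mult_ac del: power_Suc)
    then show ?thesis by (simp add: has_sum_reindex[OF inj[OF \<mu>]])
  qed
  then have "(?f has_sum (\<Sum>\<mu>\<in>residues_vec r ?n. S \<mu>)) (\<Union>\<mu>\<in>residues_vec r ?n. ?g \<mu> ` carrier_vec r)"
    by (rule sum_has_sum[OF finite_residues_vec])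
      (auto dest: residues_vec_decomp_unique)
  then have "(?f has_sum (\<Sum>\<mu>\<in>residues_vec r ?n. S \<mu>)) (carrier_vec r)"
    by (simp only: residues_vec_Union)
  then have "fps_nth (\<Sum>l<r. eis j l z * frob_twist CARD('k) i (s_fun l z)) N
      = (\<Sum>\<mu>\<in>residues_vec r ?n. S \<mu>)"
    using eis_s_fun_has_sum[OF z] has_sum_unique by blast
  also have "\<dots> = inverse (theta ^ ?n) ^ (CARD('k) ^ j)
      * (\<Sum>v\<in>torsion z ?n. v ^ (CARD('k) ^ i) * inverse v ^ (CARD('k) ^ j))"
    unfolding torsion_def dim sum.reindex[OF torsion_inj[OF z]] S_def sum_distrib_left o_def ..
  finally show ?thesis .
qed

text \<open>The expansion of \<open>1 / (t - \<theta>\<^bsup>q\<^sup>j\<^esup>)\<close>.\<close>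

definition pole_series :: "nat \<Rightarrow> 'c fps" where
  "pole_series j = Abs_fps (\<lambda>N. - (inverse (theta ^ Suc N) ^ (CARD('k) ^ j)))"

lemma pole_series_mult: "pole_series j * (fps_X - fps_const (theta ^ (CARD('k) ^ j))) = 1"
proof (rule fps_ext)
  fix n
  let ?Q = "CARD('k) ^ j"
  have inv: "inverse (theta ^ Suc m) ^ ?Q * theta ^ ?Q = inverse (theta ^ m) ^ ?Q" for m
    by (simp add: power_inverse power_mult_distrib)
  have "fps_nth (pole_series j * (fps_X - fps_const (theta ^ ?Q))) n
      = (if n = 0 then 0 else fps_nth (pole_series j) (n - 1)) - fps_nth (pole_series j) n * theta ^ ?Q"
    by (simp add: right_diff_distrib)
  also have "\<dots> = fps_nth 1 n"
    using inv[of 0] by (cases n) (simp_all add: pole_series_def inv del: power_Suc)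
  finally show "fps_nth (pole_series j * (fps_X - fps_const (theta ^ ?Q))) n = fps_nth 1 n" .
qed

text \<open>The power sums vanish as soon as \<open>q^(i - j)\<close> is below the number
  \<open>q^(r (N + 1))\<close> of torsion points; \<open>i - j < r\<close> ensures this already for
  \<open>N = 0\<close>.\<close>

lemma eis_s_fun_eq_0:
  assumes z: "z \<in> Omega r" and "j < i" "i - j < r"
  shows "(\<Sum>l<r. eis j l z * frob_twist CARD('k) i (s_fun l z)) = 0"
proof (rule fps_ext)
  fix N
  have "CARD('k) ^ (i - j) < card (torsion z (Suc N))"
    unfolding card_torsion[OF z] using assms(3) q_ge_2 by (intro power_strict_increasing) auto
  then have "(\<Sum>v\<in>torsion z (Suc N). v ^ (CARD('k) ^ i) * inverse v ^ (CARD('k) ^ j)) = 0"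
    by (rule F.frob_power_sum_eq_0[OF torsion_subgroup[OF z] finite_torsion assms(2)])
  then show "fps_nth (\<Sum>l<r. eis j l z * frob_twist CARD('k) i (s_fun l z)) N = fps_nth 0 N"
    by (subst eis_s_fun_nth[OF z]) simp
qed

text \<open>Each nonzero torsion point contributes 1, and in characteristic \<open>p\<close> their
  number is \<open>-1\<close>.\<close>

lemma eis_s_fun_diag:
  assumes z: "z \<in> Omega r" and r: "r > 0"
  shows "(\<Sum>l<r. eis j l z * frob_twist CARD('k) j (s_fun l z)) = pole_series j"
proof (rule fps_ext)
  fix N
  let ?V = "torsion z (Suc N)"
  have z0: "0 \<in> ?V" using torsion_subgroup[OF z] by (rule add_subgroupD(1))
  have "v ^ (CARD('k) ^ j) * inverse v ^ (CARD('k) ^ j) = (if v = 0 then 0 else 1)" for v :: 'c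
    using q_ge_2 by (simp add: power_0_left power_inverse)
  then have "(\<Sum>v\<in>?V. v ^ (CARD('k) ^ j) * inverse v ^ (CARD('k) ^ j)) = (\<Sum>v\<in>?V. if v = 0 then 0 else 1)"
    by simp
  also have "\<dots> = (\<Sum>v\<in>?V - {0}. 1)"
    by (rule sum.mono_neutral_cong_right) (auto simp: finite_torsion)
  also have "\<dots> = of_nat (card ?V - 1)" using z0 finite_torsion by (simp add: card_Diff_singleton)
  also have "\<dots> = of_nat (card ?V) - 1"
    using z0 finite_torsion[of z "Suc N"] by (cases "card ?V") auto
  also have "of_nat (card ?V) = (0::'c)"
    unfolding card_torsion[OF z] using r F.of_nat_card_eq_0 by (simp add: power_0_left)
  finally have *: "(\<Sum>v\<in>?V. v ^ (CARD('k) ^ j) * inverse v ^ (CARD('k) ^ j)) = - 1" by simp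
  show "fps_nth (\<Sum>l<r. eis j l z * frob_twist CARD('k) j (s_fun l z)) N = fps_nth (pole_series j) N"
    by (simp only: eis_s_fun_nth[OF z] *) (simp add: pole_series_def)
qed

text \<open>With exponent difference \<open>r\<close> the vanishing criterion misses exactly the
  case \<open>N = 0\<close>, where \<open>q^r\<close> equals the number of torsion points. So only
  the constant term can survive.\<close>

lemma eis_s_fun_corner:
  assumes z: "z \<in> Omega r" and r: "r > 0"
  obtains b where "(\<Sum>l<r. eis 0 l z * frob_twist CARD('k) r (s_fun l z)) = fps_const b"
proof -
  let ?f = "\<Sum>l<r. eis 0 l z * frob_twist CARD('k) r (s_fun l z)"
  have "fps_nth ?f N = 0" if "N > 0" for N
  proof -
    have "CARD('k) ^ (r - 0) < card (torsion z (Suc N))"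
      unfolding card_torsion[OF z] using r q_ge_2 that by (intro power_strict_increasing) auto
    then have "(\<Sum>v\<in>torsion z (Suc N). v ^ (CARD('k) ^ r) * inverse v ^ (CARD('k) ^ 0)) = 0"
      by (intro F.frob_power_sum_eq_0[OF torsion_subgroup[OF z] finite_torsion]) (use r in auto)
    then show ?thesis by (subst eis_s_fun_nth[OF z]) simp
  qed
  then have "?f = fps_const (fps_nth ?f 0)" by (intro fps_ext) auto
  then show ?thesis using that by blast
qed

end

section \<open>The Moore determinant of \<open>s\<close> and the form \<open>G_form\<close>\<close>

lemma tate_complete:
  assumes P: "\<And>N. P N \<in> tate" and step: "\<And>N. coeffs_le (P (Suc N) - P N) (e N)"
    and e: "decseq e" "e \<longlonglongrightarrow> 0"
  obtains W where "W \<in> tate" "\<And>N. coeffs_le (P N - W) (e N)" "\<And>n. (\<lambda>N. fps_nth (P N) n) \<longlonglongrightarrow> fps_nth W n"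
proof -
  have e0: "0 \<le> e N" for N using coeffs_le_nonneg[OF step] .
  have le: "coeffs_le (P (N + k) - P N) (e N)" for N k
  proof (induction k)
    case (Suc k)
    have "coeffs_le (P (Suc (N + k)) - P (N + k)) (e N)"
      by (rule coeffs_le_trans[OF step decseqD[OF e(1)]]) simp
    from coeffs_le_add[OF this Suc] show ?case by simp
  qed (simp add: coeffs_le_zero e0)
  have ge: "coeffs_le (P m - P N) (e N)" if "m \<ge> N" for m N
    using le[of N "m - N"] that by simp
  have "\<exists>w. (\<lambda>N. fps_nth (P N) n) \<longlonglongrightarrow> w" for n
  proof -
    have "convergent (\<lambda>N. fps_nth (P N) n)"
    proof (rule Cauchy_vabsI)
      fix d :: real assume "d > 0"
      then obtain N where N: "e N < d"
        using order_tendstoD(2)[OF e(2)] unfolding eventually_sequentially by blast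
      have "vabs (fps_nth (P m) n - fps_nth (P N) n) < d" if "m \<ge> N" for m
        using ge[OF that] N by (auto simp: coeffs_le_def intro: le_less_trans)
      then show "\<exists>N. \<forall>m\<ge>N. vabs (fps_nth (P m) n - fps_nth (P N) n) < d" by blast
    qed
    then show ?thesis by (simp add: convergent_def)
  qed
  then obtain w where w: "\<And>n. (\<lambda>N. fps_nth (P N) n) \<longlonglongrightarrow> w n" by metis
  have close: "coeffs_le (P N - Abs_fps w) (e N)" for N
    unfolding coeffs_le_def
  proof
    fix n
    have "vabs (w n - fps_nth (P N) n) \<le> e N"
    proof (rule tendsto_vabs_le)
      show "(\<lambda>m. fps_nth (P m) n - fps_nth (P N) n) \<longlonglongrightarrow> w n - fps_nth (P N) n"
        by (intro tendsto_diff w tendsto_const)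
      show "\<forall>\<^sub>F m in sequentially. vabs (fps_nth (P m) n - fps_nth (P N) n) \<le> e N"
        using eventually_ge_at_top[of N] by eventually_elim (use ge in \<open>auto simp: coeffs_le_def\<close>)
    qed simp
    then show "vabs (fps_nth (P N - Abs_fps w) n) \<le> e N" by (simp add: vabs_minus_commute)
  qed
  have "Abs_fps w \<in> tate"
  proof (rule tateI)
    fix d :: real assume d: "d > 0"
    then obtain N where N: "e N < d"
      using order_tendstoD(2)[OF e(2)] unfolding eventually_sequentially by blast
    obtain M where M: "\<And>n. n \<ge> M \<Longrightarrow> vabs (fps_nth (P N) n) < d" using tateE[OF P d] by blast
    have "vabs (w n) \<le> d" if "n \<ge> M" for n
    proof -
      have "vabs (fps_nth (P N) n - w n) \<le> d"
        using close[of N] N by (auto simp: coeffs_le_def intro: order_trans[OF _ less_imp_le])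
      from vabs_diff_le[OF less_imp_le[OF M[OF that]] this] show ?thesis by simp
    qed
    then show "\<exists>M. \<forall>n\<ge>M. vabs (fps_nth (Abs_fps w) n) \<le> d" by auto
  qed
  then show ?thesis using that[of "Abs_fps w"] close w by simp
qed

lemma coeffs_le_one_minus_X: "vabs c \<le> 1 \<Longrightarrow> coeffs_le (1 - fps_const c * fps_X) 1"
  using coeffs_le_diff[OF coeffs_le_const[of 1] coeffs_le_trans[OF coeffs_le_mult[OF coeffs_le_const[of c], of fps_X 1]]]
  by (simp add: coeffs_le_def fps_X_def)

lemma inverse_one_minus_X: "inverse (1 - fps_const c * fps_X) = Abs_fps (\<lambda>n. c ^ n)"
  for c :: "'a::field"
proof (rule fps_inverse_unique)
  show "(1 - fps_const c * fps_X) * Abs_fps (\<lambda>n. c ^ n) = 1"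
  proof (rule fps_ext)
    fix n
    show "fps_nth ((1 - fps_const c * fps_X) * Abs_fps (\<lambda>n. c ^ n)) n = fps_nth 1 n"
      by (cases n) (simp_all add: left_diff_distrib mult.assoc)
  qed
qed

lemma inverse_one_minus_X_tate:
  assumes "vabs c < 1"
  shows "inverse (1 - fps_const c * fps_X) \<in> tate"
  unfolding inverse_one_minus_X tate_def using assms
  by (simp add: vabs_power LIMSEQ_realpow_zero)

lemma coeffs_le_inverse_one_minus_X:
  assumes "vabs c \<le> 1"
  shows "coeffs_le (inverse (1 - fps_const c * fps_X)) 1"
  unfolding inverse_one_minus_X coeffs_le_def using assms by (simp add: vabs_power power_le_one)

lemma det_lower_triangular_prod:
  assumes "A \<in> carrier_mat n n" "\<And>i j. i < j \<Longrightarrow> j < n \<Longrightarrow> A $$ (i, j) = 0"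
  shows "det A = (\<Prod>i<n. A $$ (i, i))"
  using det_lower_triangular[OF assms(2,1)] assms(1)
  by (simp add: prod_list_diag_prod atLeast0LessThan)

context drinfeld_setting
begin

lemma twist_add: "frob_twist CARD('k) i (f + g) = frob_twist CARD('k) i f + frob_twist CARD('k) i g"
  for f g :: "'c fps"
  by (rule fps_ext) (simp add: frob_twist_nth F.frob_add)

lemma twist_mult: "frob_twist CARD('k) i (f * g) = frob_twist CARD('k) i f * frob_twist CARD('k) i g"
  for f g :: "'c fps"
  by (rule fps_ext) (simp add: frob_twist_nth fps_mult_nth F.frob_sum power_mult_distrib)

lemma twist_0: "frob_twist CARD('k) i 0 = (0 :: 'c fps)" and twist_1: "frob_twist CARD('k) i 1 = (1 :: 'c fps)"
  by (rule fps_ext; simp add: frob_twist_nth power_0_left)+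

sublocale twist: comm_ring_hom "frob_twist CARD('k) i :: 'c fps \<Rightarrow> 'c fps" for i
  by unfold_locales (simp_all add: twist_add twist_mult twist_0 twist_1)

lemma twist_const: "frob_twist CARD('k) i (fps_const c) = fps_const (c ^ (CARD('k) ^ i))"
  by (rule fps_ext) (simp add: frob_twist_nth)

lemma twist_X: "frob_twist CARD('k) i fps_X = fps_X"
  by (rule fps_ext) (simp add: frob_twist_nth fps_X_def)

lemma twist_twist: "frob_twist CARD('k) i (frob_twist CARD('k) j f) = frob_twist CARD('k) (i + j) f"
  by (rule fps_ext) (simp add: frob_twist_nth power_add mult.commute flip: power_mult)

lemma kappa_nonzero [simp]: "\<kappa> \<noteq> 0"
proof
  assume "\<kappa> = 0"
  then have "theta = 0"
    using kappa_root q_ge_2 by (simp add: theta_def of_Kinf_def power_0_left)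
  then show False by simp
qed

text \<open>\<open>W\<close> is the infinite product in \<open>omega\<close> and \<open>V\<close>
  the product of the inverse factors. Twisting shifts the index of the factors by one, so that
  \<open>V\<close> and its twist differ by the factor of index 0.\<close>

lemma omega_factorization:
  obtains W V where "omega = fps_const \<kappa> * W" "W \<in> tate" "V \<in> tate" "W * V = 1"
    "fps_nth W 0 = 1" "V = frob_twist CARD('k) 1 V * (1 - fps_const (inverse theta) * fps_X)"
proof -
  define c where "c i = inverse (theta ^ (CARD('k) ^ i))" for i
  have vc: "vabs (c i) = inverse (real CARD('k)) ^ (CARD('k) ^ i)" for i
    by (simp add: c_def vabs_inverse vabs_power vabs_theta power_inverse)
  have iq: "inverse (real CARD('k)) < 1" "0 < inverse (real CARD('k))"
    using real_q_gt_1 by (auto simp: inverse_less_1_iff)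
  have c1: "vabs (c i) < 1" for i
    unfolding vc using iq q_ge_2 by (simp add: power_less_one_iff)
  \<comment> \<open>The true size of \<open>c N\<close> is \<open>q^(-q^N)\<close>; the weaker
    \<open>q^(-N)\<close> is a decreasing null sequence and suffices.\<close>
  define e where "e N = inverse (real CARD('k)) ^ N" for N
  have ce: "vabs (c N) \<le> e N" for N
    unfolding vc e_def using iq q_ge_2 less_exp[of N] power_mono[OF q_ge_2, of N]
    by (intro power_decreasing) auto
  have e: "decseq e" "e \<longlonglongrightarrow> 0"
    unfolding e_def using iq by (auto intro!: decseq_SucI LIMSEQ_realpow_zero mult_left_le_one_le)
  let ?f = "\<lambda>i. 1 - fps_const (c i) * fps_X"
  define P where "P N = (\<Prod>i<N. inverse (?f i))" for N
  define Q where "Q N = (\<Prod>i<N. ?f i)" for N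
  have f0: "fps_nth (?f i) 0 \<noteq> 0" for i by simp
  have ft: "?f i \<in> tate" "coeffs_le (?f i) 1" for i
    using c1[of i] by (auto intro!: tate_diff tate_mult coeffs_le_one_minus_X)
  have it: "inverse (?f i) \<in> tate" "coeffs_le (inverse (?f i)) 1" for i
    using c1[of i] by (auto intro!: inverse_one_minus_X_tate coeffs_le_inverse_one_minus_X)
  have Pt: "P N \<in> tate" "coeffs_le (P N) 1" and Qt: "Q N \<in> tate" "coeffs_le (Q N) 1" for N
    using coeffs_le_prod[of "{..<N}" "\<lambda>i. inverse (?f i)" "\<lambda>_. 1"]
      coeffs_le_prod[of "{..<N}" ?f "\<lambda>_. 1"] it ft
    by (auto simp: P_def Q_def intro!: tate_prod)
  have cX: "coeffs_le (fps_const (c N) * fps_X) (e N)" for N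
    using ce[of N] by (auto simp: coeffs_le_def e_def iq)
  have PN: "P (Suc N) * ?f N = P N" for N
    unfolding P_def using inverse_mult_eq_1[OF f0[of N]] by (simp add: mult.assoc)
  have Pdiff: "P (Suc N) - P N = P (Suc N) * (fps_const (c N) * fps_X)" for N
    by (subst PN[symmetric]) (simp add: right_diff_distrib)
  have stepP: "coeffs_le (P (Suc N) - P N) (e N)" for N
    unfolding Pdiff using coeffs_le_mult[OF Pt(2) cX] by simp
  obtain W where W: "W \<in> tate"
    "\<And>N. coeffs_le (P N - W) (e N)" "\<And>n. (\<lambda>N. fps_nth (P N) n) \<longlonglongrightarrow> fps_nth W n"
    by (rule tate_complete[of P e, OF Pt(1) stepP e]) (rule that)
  have Qdiff: "Q (Suc N) - Q N = - (Q N * (fps_const (c N) * fps_X))" for N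
    by (simp add: Q_def algebra_simps)
  have stepQ: "coeffs_le (Q (Suc N) - Q N) (e N)" for N
    unfolding Qdiff using coeffs_le_minus[OF coeffs_le_mult[OF Qt(2) cX]] by simp
  obtain V where V: "V \<in> tate" "\<And>n. (\<lambda>N. fps_nth (Q N) n) \<longlonglongrightarrow> fps_nth V n"
    by (rule tate_complete[of Q e, OF Qt(1) stepQ e]) (rule that)
  have PQ: "P N * Q N = 1" for N
    unfolding P_def Q_def prod.distrib[symmetric]
    using inverse_mult_eq_1[OF f0] by (intro prod.neutral) auto
  have WV: "W * V = 1"
  proof (rule fps_ext)
    fix n
    have "(\<lambda>N. fps_nth (P N * Q N) n) \<longlonglongrightarrow> fps_nth (W * V) n"
      unfolding fps_mult_nth by (intro tendsto_sum tendsto_mult W V)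
    then show "fps_nth (W * V) n = fps_nth 1 n"
      unfolding PQ by (simp add: LIMSEQ_const_iff)
  qed
  have "omega = fps_const \<kappa> * W"
    unfolding omega_def c_def[symmetric] P_def[symmetric]
    by (rule arg_cong[OF tate_lim_eqI[OF Pt(1) W(1) W(2) e(2)]])
  moreover have "fps_nth W 0 = 1"
  proof -
    have "fps_nth (P N) 0 = 1" for N
      unfolding P_def by (induction N) simp_all
    then show ?thesis using W(3)[of 0] by (simp add: LIMSEQ_const_iff)
  qed
  moreover have "V = frob_twist CARD('k) 1 V * ?f 0"
  proof (rule fps_ext)
    fix n
    have tw: "frob_twist CARD('k) 1 (?f i) = ?f (Suc i)" for i
      by (simp add: twist.hom_minus twist.hom_mult twist_const twist_X c_def power_inverse mult.commute
          flip: power_mult)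
    have Q: "Q (Suc N) = frob_twist CARD('k) 1 (Q N) * ?f 0" for N
      unfolding Q_def prod.lessThan_Suc_shift twist.hom_prod tw by (simp add: mult.commute)
    have "(\<lambda>N. fps_nth (frob_twist CARD('k) 1 (Q N) * ?f 0) n)
        \<longlonglongrightarrow> fps_nth (frob_twist CARD('k) 1 V * ?f 0) n"
      unfolding fps_mult_nth frob_twist_nth
      by (intro tendsto_sum tendsto_mult tendsto_pow_nonarch tendsto_const V)
    then show "fps_nth V n = fps_nth (frob_twist CARD('k) 1 V * ?f 0) n"
      unfolding Q[symmetric] using LIMSEQ_unique LIMSEQ_Suc[OF V(2)] by blast
  qed
  ultimately show ?thesis using that[OF _ W(1) V(1) WV] by (simp add: c_def)
qed

text \<open>Iterates the relation that the first twist of \<open>omega\<close> is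
  \<open>(t - \<theta>) omega\<close>. The twist of the infinite product supplies
  \<open>1 - t / \<theta>\<close>, and \<open>\<kappa> ^ (q - 1) = -\<theta>\<close> turns this into
  \<open>t - \<theta>\<close>.\<close>

lemma twist_omega: "frob_twist CARD('k) i omega = (\<Prod>j<i. fps_X - fps_const (theta ^ (CARD('k) ^ j))) * omega"
proof -
  obtain W V where WV: "omega = fps_const \<kappa> * W" "W * V = 1"
    "V = frob_twist CARD('k) 1 V * (1 - fps_const (inverse theta) * fps_X)" by (rule omega_factorization)
  let ?t = "frob_twist CARD('k) 1"
  have tWV: "?t W * ?t V = 1" by (simp only: WV(2) twist_mult[symmetric] twist_1)
  have "?t W = (1 - fps_const (inverse theta) * fps_X) * W"
  proof -
    have "?t W = ?t W * (W * V)" by (simp add: WV(2))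
    also have "\<dots> = ?t W * (W * (?t V * (1 - fps_const (inverse theta) * fps_X)))"
      by (simp only: WV(3)[symmetric])
    also have "\<dots> = (?t W * ?t V) * ((1 - fps_const (inverse theta) * fps_X) * W)"
      by (simp only: mult_ac)
    finally show ?thesis by (simp only: tWV mult_1_left)
  qed
  then have "?t omega = fps_const (\<kappa> ^ CARD('k)) * (1 - fps_const (inverse theta) * fps_X) * W"
    by (simp add: WV(1) twist.hom_mult twist_const mult.assoc)
  also have "\<kappa> ^ CARD('k) = \<kappa> ^ (CARD('k) - 1) * \<kappa>"
    using q_ge_2 by (metis power_minus_mult zero_less_card_finite)
  also have "\<kappa> ^ (CARD('k) - 1) = - theta"
    using kappa_root by (simp add: theta_def of_Kinf_def)
  also have "fps_const (- theta * \<kappa>) * (1 - fps_const (inverse theta) * fps_X) * W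
      = (fps_X - fps_const theta) * (fps_const \<kappa> * W)"
  proof -
    have "fps_const (- theta * \<kappa>) * (1 - fps_const (inverse theta) * fps_X)
        = (fps_X - fps_const theta) * fps_const \<kappa>"
      by (rule fps_ext) (auto simp: algebra_simps fps_X_def)
    then show ?thesis by (simp add: mult.assoc)
  qed
  finally have one: "?t omega = (fps_X - fps_const theta) * omega" by (simp add: WV(1))
  show ?thesis
  proof (induction i)
    case (Suc i)
    have "frob_twist CARD('k) (Suc i) omega = frob_twist CARD('k) i (?t omega)"
      by (simp add: twist_twist)
    also have "\<dots> = (fps_X - fps_const (theta ^ (CARD('k) ^ i))) * frob_twist CARD('k) i omega"
      by (simp only: one twist.hom_mult twist.hom_minus twist_const twist_X)
    finally show ?case by (simp add: Suc mult_ac)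
  qed (rule fps_ext, simp add: frob_twist_nth)
qed

subsection \<open>Duality between Eisenstein series and \<open>s\<close>\<close>

definition eis_mat :: "nat \<Rightarrow> 'c vec \<Rightarrow> 'c fps mat" where
  "eis_mat r z = mat r r (\<lambda>(j, l). eis j l z)"

definition psi_mat :: "nat \<Rightarrow> nat \<Rightarrow> 'c vec \<Rightarrow> 'c fps mat" where
  "psi_mat m r z = mat r r (\<lambda>(l, i). frob_twist CARD('k) (i + m) (s_fun l z))"

definition wedge_mat :: "nat \<Rightarrow> (nat \<Rightarrow> 'c fps) \<Rightarrow> 'c vec \<Rightarrow> 'c fps mat" where
  "wedge_mat r y z = mat r r (\<lambda>(j, l). if j < r - 1 then eis j l z else y l)"

text \<open>The vector product of the first \<open>r - 1\<close> vectors of Eisenstein series.\<close>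

definition eis_wedge :: "nat \<Rightarrow> nat \<Rightarrow> 'c vec \<Rightarrow> 'c fps" where
  "eis_wedge r i z = det (wedge_mat r (\<lambda>l. if l = i then 1 else 0) z)"

lemma mat_carriers [simp]:
  "eis_mat r z \<in> carrier_mat r r" "psi_mat m r z \<in> carrier_mat r r" "wedge_mat r y z \<in> carrier_mat r r"
  by (simp_all add: eis_mat_def psi_mat_def wedge_mat_def)

lemma eis_psi_index:
  assumes "j < r" "i < r"
  shows "(eis_mat r z * psi_mat m r z) $$ (j, i)
    = (\<Sum>l<r. eis j l z * frob_twist CARD('k) (i + m) (s_fun l z))"
  using assms by (simp add: eis_mat_def psi_mat_def scalar_prod_def atLeast0LessThan)

lemma wedge_psi_index:
  assumes "j < r" "i < r"
  shows "(wedge_mat r y z * psi_mat m r z) $$ (j, i)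
    = (\<Sum>l<r. (if j < r - 1 then eis j l z else y l) * frob_twist CARD('k) (i + m) (s_fun l z))"
  using assms by (simp add: wedge_mat_def psi_mat_def scalar_prod_def atLeast0LessThan)

text \<open>The duality relations make the product matrix lower triangular with the pole series on
  the diagonal.\<close>

lemma det_eis_psi:
  assumes z: "z \<in> Omega r"
  shows "det (eis_mat r z) * det (psi_mat 0 r z) = (\<Prod>j<r. pole_series j)"
proof -
  have "det (eis_mat r z) * det (psi_mat 0 r z) = det (eis_mat r z * psi_mat 0 r z)"
    by (simp add: det_mult[of _ r])
  also have "\<dots> = (\<Prod>j<r. (eis_mat r z * psi_mat 0 r z) $$ (j, j))"
    by (rule det_lower_triangular_prod[OF mult_carrier_mat[of _ r r]])
      (auto simp: eis_psi_index eis_s_fun_eq_0[OF z] simp del: index_mult_mat)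
  also have "\<dots> = (\<Prod>j<r. pole_series j)"
    by (intro prod.cong) (auto simp: eis_psi_index eis_s_fun_diag[OF z] simp del: index_mult_mat)
  finally show ?thesis .
qed

text \<open>Replacing the last Eisenstein row by the \<open>i\<close>-th unit vector keeps the
  product with the matrix of \<open>s\<close> lower triangular; only the last diagonal entry
  changes, to the twist of \<open>s_fun i z\<close>.\<close>

lemma det_wedge_psi:
  assumes z: "z \<in> Omega r" and r: "r > 0" and i: "i < r"
  shows "eis_wedge r i z * det (psi_mat 0 r z)
    = (\<Prod>j<r - 1. pole_series j) * frob_twist CARD('k) (r - 1) (s_fun i z)"
proof -
  let ?w = "wedge_mat r (\<lambda>l. if l = i then 1 else 0) z"
  obtain m where m: "r = Suc m" using r by (cases r) auto
  have "eis_wedge r i z * det (psi_mat 0 r z) = det (?w * psi_mat 0 r z)"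
    by (simp add: eis_wedge_def det_mult[of _ r])
  also have "\<dots> = (\<Prod>j<r. (?w * psi_mat 0 r z) $$ (j, j))"
  proof (rule det_lower_triangular_prod[OF mult_carrier_mat[of _ r r]])
    fix j k assume jk: "j < k" "k < r"
    then have "j < r - 1" by simp
    with jk have "(?w * psi_mat 0 r z) $$ (j, k) = (\<Sum>l<r. eis j l z * frob_twist CARD('k) k (s_fun l z))"
      by (subst wedge_psi_index) simp_all
    also have "\<dots> = 0" by (rule eis_s_fun_eq_0[OF z]) (use jk in auto)
    finally show "(?w * psi_mat 0 r z) $$ (j, k) = 0" .
  qed simp_all
  also have "\<dots> = (\<Prod>j<m. (?w * psi_mat 0 r z) $$ (j, j)) * (?w * psi_mat 0 r z) $$ (m, m)"
    by (simp add: m)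
  also have "(\<Prod>j<m. (?w * psi_mat 0 r z) $$ (j, j)) = (\<Prod>j<m. pole_series j)"
  proof (rule prod.cong[OF refl])
    fix j assume "j \<in> {..<m}"
    then have "(?w * psi_mat 0 r z) $$ (j, j) = (\<Sum>l<r. eis j l z * frob_twist CARD('k) j (s_fun l z))"
      using m by (subst wedge_psi_index) simp_all
    then show "(?w * psi_mat 0 r z) $$ (j, j) = pole_series j" by (simp only: eis_s_fun_diag[OF z r])
  qed
  also have "(?w * psi_mat 0 r z) $$ (m, m) = frob_twist CARD('k) m (s_fun i z)"
    using m i by (simp add: wedge_psi_index if_distrib[of "\<lambda>x. x * _"] del: index_mult_mat cong: if_cong)
  finally show ?thesis by (simp add: m)
qed

text \<open>Against the twisted matrix of \<open>s\<close>, row \<open>j\<close> and column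
  \<open>i\<close> pair with exponent difference \<open>i + 1 - j\<close>. The top row then has at
  most its last entry, a constant, and deleting this row and column leaves a lower triangular matrix
  with diagonal \<open>pole_series (j + 1)\<close>. Compared with \<open>det_eis_psi\<close> only
  \<open>pole_series 0\<close> is missing, the inverse of \<open>t - \<theta>\<close>.\<close>

lemma det_psi_twist:
  assumes z: "z \<in> Omega r" and r: "r > 0"
  obtains b where "frob_twist CARD('k) 1 (det (psi_mat 0 r z))
    = fps_const b * (fps_X - fps_const theta) * det (psi_mat 0 r z)"
proof -
  obtain m where m: "r = Suc m" using r by (cases r) auto
  obtain b where b: "(\<Sum>l<r. eis 0 l z * frob_twist CARD('k) r (s_fun l z)) = fps_const b"
    using eis_s_fun_corner[OF z r] by blast
  let ?A = "eis_mat r z * psi_mat 1 r z"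
  have A: "?A \<in> carrier_mat r r" by (intro mult_carrier_mat[of _ r r]) simp_all
  have zero: "?A $$ (j, i) = 0" if "j \<le> i" "i < r" "j > 0 \<or> i < m" for i j
  proof -
    have "?A $$ (j, i) = (\<Sum>l<r. eis j l z * frob_twist CARD('k) (i + 1) (s_fun l z))"
      by (rule eis_psi_index) (use that in auto)
    also have "\<dots> = 0" by (rule eis_s_fun_eq_0[OF z]) (use that m in auto)
    finally show ?thesis .
  qed
  have corner: "?A $$ (0, m) = fps_const b"
    using m b by (subst eis_psi_index) auto
  have "det ?A = (\<Sum>i<r. ?A $$ (0, i) * cofactor ?A 0 i)"
    by (rule laplace_expansion_row[OF A]) (use r in simp)
  also have "\<dots> = ?A $$ (0, m) * cofactor ?A 0 m"
    by (simp add: m, intro sum.neutral) (use zero[of 0] m in auto)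
  also have "cofactor ?A 0 m = (- 1) ^ m * (\<Prod>j<m. pole_series (Suc j))"
  proof -
    let ?B = "mat_delete ?A 0 m"
    have B: "?B \<in> carrier_mat m m" using mat_delete_carrier[OF A] m by simp
    have "mat_delete M 0 m $$ (j, i) = M $$ (Suc j, i)"
      if "M \<in> carrier_mat r r" "j < m" "i < m" for M :: "'c fps mat" and i j
      using that m by (auto simp: mat_delete_def)
    note ind = this[OF A]
    have "det ?B = (\<Prod>j<m. ?B $$ (j, j))"
    proof (rule det_lower_triangular_prod[OF B])
      fix j i assume ji: "j < i" "i < m"
      have "?B $$ (j, i) = ?A $$ (Suc j, i)" by (rule ind) (use ji in auto)
      also have "\<dots> = 0" by (rule zero) (use ji m in auto)
      finally show "?B $$ (j, i) = 0" .
    qed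
    also have "\<dots> = (\<Prod>j<m. pole_series (Suc j))"
    proof (rule prod.cong[OF refl])
      fix j assume "j \<in> {..<m}"
      then have "?B $$ (j, j) = (\<Sum>l<r. eis (Suc j) l z * frob_twist CARD('k) (Suc j) (s_fun l z))"
        using m by (subst ind) (simp_all add: eis_psi_index del: index_mult_mat)
      then show "?B $$ (j, j) = pole_series (Suc j)" by (simp only: eis_s_fun_diag[OF z r])
    qed
    finally show ?thesis by (simp add: cofactor_def)
  qed
  also have "(- 1) ^ m = fps_const ((- 1) ^ m :: 'c)"
    by (simp flip: fps_const_power fps_const_neg)
  finally have dA: "det ?A = fps_const (b * (- 1) ^ m) * (\<Prod>j<m. pole_series (Suc j))"
    by (simp only: corner fps_const_mult mult.assoc[symmetric])
  have tw: "det (psi_mat 1 r z) = frob_twist CARD('k) 1 (det (psi_mat 0 r z))"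
    unfolding twist.hom_det[symmetric]
    by (rule arg_cong[of _ _ det], rule eq_matI) (auto simp: psi_mat_def twist_twist add.commute)
  let ?D = "det (psi_mat 0 r z)" and ?E = "det (eis_mat r z)" and ?c = "fps_const (b * (- 1) ^ m)"
  have ED: "?E * ?D = pole_series 0 * (\<Prod>j<m. pole_series (Suc j))"
    unfolding det_eis_psi[OF z] by (simp only: m prod.lessThan_Suc_shift o_def)
  have ED1: "?E * frob_twist CARD('k) 1 ?D = ?c * (\<Prod>j<m. pole_series (Suc j))"
    using dA by (simp only: det_mult[OF mat_carriers(1) mat_carriers(2)] tw)
  have pole: "pole_series j \<noteq> 0" for j using pole_series_mult[of j] by auto
  then have E0: "?E \<noteq> 0" using ED by auto
  let ?X = "fps_X - fps_const theta"
  have pX: "pole_series 0 * ?X = 1" using pole_series_mult[of 0] by simp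
  have "?E * (frob_twist CARD('k) 1 ?D * pole_series 0) = (?E * frob_twist CARD('k) 1 ?D) * pole_series 0"
    by (simp only: mult_ac)
  also have "\<dots> = ?c * (?E * ?D)" by (simp only: ED1 ED mult_ac)
  also have "\<dots> = ?E * (?c * ?D)" by (simp only: mult_ac)
  finally have "frob_twist CARD('k) 1 ?D * pole_series 0 = ?c * ?D" using E0 mult_left_cancel by blast
  then have "(frob_twist CARD('k) 1 ?D * pole_series 0) * ?X = ?c * ?D * ?X" by (simp only:)
  then have "frob_twist CARD('k) 1 ?D * (pole_series 0 * ?X) = ?c * ?X * ?D" by (simp only: mult_ac)
  then have "frob_twist CARD('k) 1 ?D = ?c * (fps_X - fps_const theta) * ?D"
    by (simp only: pX mult_1_right)
  then show ?thesis by (rule that)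
qed

section \<open>Membership in the Tate algebra and rigidity under the twist\<close>

lemma tate_eis:
  assumes z: "z \<in> Omega r"
  shows "l < r \<Longrightarrow> eis j l z \<in> tate"
proof (rule tateI)
  fix e :: real assume l: "l < r" and e: "e > 0"
  let ?I = "{a \<in> carrier_vec r. e \<le> vabs (inverse (alin a z) ^ (CARD('k) ^ j))}"
  have fin: "finite ?I"
    by (rule vanishingD[OF vanishing_alin_power[OF z]]) (use e q_ge_2 in auto)
  \<comment> \<open>Only the finitely many vectors in \<open>?I\<close> have large terms, and beyond
    the degrees of their entries these have no coefficient left; the sum of the degrees bounds each
    of them.\<close>
  define N where "N = Suc (\<Sum>a\<in>?I. Polynomial.degree (a $ l))"
  have "vabs (fps_nth (eis j l z) n) \<le> e" if n: "n \<ge> N" for n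
  proof (rule vabs_has_sum_le[OF eis_has_sum[OF z]])
    fix a :: "'k poly vec" assume a: "a \<in> carrier_vec r"
    show "vabs (eis_term j l z n a) \<le> e"
    proof (cases "a \<in> ?I")
      case True
      then have "Polynomial.degree (a $ l) \<le> (\<Sum>a\<in>?I. Polynomial.degree (a $ l))"
        by (intro member_le_sum fin) auto
      then have "poly.coeff (a $ l) n = 0" using n by (intro coeff_eq_0) (simp add: N_def)
      then show ?thesis using e by (simp add: eis_term_def)
    next
      case False
      then show ?thesis using a vabs_eis_term_le[of j l z n a] by (auto intro: order_trans)
    qed
  qed (use e in simp)
  then show "\<exists>N. \<forall>n\<ge>N. vabs (fps_nth (eis j l z) n) \<le> e" by blast
qed

lemma tate_s_fun:
  assumes z: "z \<in> Omega r"
  shows "s_fun l z \<in> tate"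
proof -
  interpret L: discrete_subgroup "A_lattice z" by (rule A_lattice_discrete[OF z])
  have lim: "(\<lambda>n. vabs (z $ l) * real CARD('k) powi (- int (Suc n))) \<longlonglongrightarrow> 0"
    using tendsto_mult_left[OF LIMSEQ_Suc[OF q_powi_tendsto_0], of "vabs (z $ l)"] by simp
  have v: "vabs (z $ l / theta ^ Suc n) = vabs (z $ l) * real CARD('k) powi (- int (Suc n))" for n
    by (simp only: vabs_mult vabs_inverse vabs_power vabs_theta power_int_minus power_int_of_nat divide_inverse)
  have "finite ({y \<in> A_lattice z. vabs y \<le> 1} - {0})" using L.finite_ball by simp
  then obtain m where m: "m > 0" "m \<le> 1" "\<And>y. y \<in> A_lattice z \<Longrightarrow> y \<noteq> 0 \<Longrightarrow> m \<le> vabs y"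
  proof -
    \<comment> \<open>The element 1 keeps the set nonempty and makes the minimum a lower bound also
      for lattice points outside the unit ball.\<close>
    let ?S = "insert 1 (vabs ` ({y \<in> A_lattice z. vabs y \<le> 1} - {0}))"
    assume fin: "finite ({y \<in> A_lattice z. vabs y \<le> 1} - {0})"
    have "m \<le> vabs y" if "y \<in> A_lattice z" "y \<noteq> 0" "m = Min ?S" for y m
    proof (cases "vabs y \<le> 1")
      case True
      then show ?thesis unfolding that(3) using fin that by (intro Min_le) auto
    next
      case False
      moreover have "Min ?S \<le> 1" using fin by (intro Min_le) auto
      ultimately show ?thesis using that(3) by linarith
    qed
    moreover have "0 < Min ?S" using fin by (subst Min_gr_iff) auto
    moreover have "Min ?S \<le> 1" using fin by (intro Min_le) auto
    ultimately show thesis by (intro that[of "Min ?S"]) blast+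
  qed
  obtain N where N: "\<And>n. n \<ge> N \<Longrightarrow> vabs (z $ l / theta ^ Suc n) < m"
    using order_tendstoD(2)[OF lim m(1)] unfolding eventually_sequentially v by blast
  have "vabs (fps_nth (s_fun l z) n) = vabs (z $ l / theta ^ Suc n)" if "n \<ge> N" for n
    unfolding s_fun_nth
    by (rule L.vabs_lattice_exp_small) (use N[OF that] m(3) in \<open>auto intro: less_le_trans\<close>)
  then have "\<forall>\<^sub>F n in sequentially. vabs (z $ l) * real CARD('k) powi (- int (Suc n)) = vabs (fps_nth (s_fun l z) n)"
    unfolding v eventually_sequentially by (intro exI[of _ N]) simp
  then show ?thesis unfolding tate_def using Lim_transform_eventually[OF lim] by simp
qed

lemma tate_twist: "f \<in> tate \<Longrightarrow> frob_twist CARD('k) i f \<in> tate"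
proof -
  assume "f \<in> tate"
  then have "(\<lambda>n. fps_nth f n ^ (CARD('k) ^ i)) \<longlonglongrightarrow> 0 ^ (CARD('k) ^ i)"
    by (intro tendsto_pow_nonarch) (simp add: tate_iff)
  moreover have "fps_nth (frob_twist CARD('k) i f) = (\<lambda>n. fps_nth f n ^ (CARD('k) ^ i))"
    by (simp add: fun_eq_iff frob_twist_nth)
  ultimately show ?thesis by (simp add: tate_iff power_0_left)
qed

text \<open>After division by the constant term the coefficients satisfy \<open>x^q = x\<close>, so
  they are 0 or of absolute value 1; in the Tate algebra only finitely many can be nonzero. The same
  holds for the inverse \<open>h\<close>. Thus both are polynomials up to constants, with product 1,
  and such polynomials are constant.\<close>

lemma twist_eigen_unit_const:
  fixes g h :: "'c fps"
  assumes g: "g \<in> tate" and h: "h \<in> tate" and gh: "g * h = 1"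
    and tw: "frob_twist CARD('k) 1 g = fps_const c * g"
  shows "g = fps_const (fps_nth g 0)"
proof -
  have poly: "\<exists>p. fps_const (inverse (fps_nth f 0)) * f = fps_of_poly p"
    if f: "f \<in> tate" "fps_nth f 0 \<noteq> 0" and tf: "frob_twist CARD('k) 1 f = fps_const d * f" for f :: "'c fps" and d
  proof -
    define y where "y = fps_const (inverse (fps_nth f 0)) * f"
    have coeff: "fps_nth f n ^ CARD('k) = d * fps_nth f n" for n
      using arg_cong[OF tf, of "\<lambda>f. fps_nth f n"] by (simp add: frob_twist_nth)
    have d: "d \<noteq> 0" using coeff[of 0] f(2) by auto
    have "fps_nth y n ^ CARD('k) = fps_nth y n" for n
      using d f(2) by (simp add: y_def power_mult_distrib power_inverse coeff field_simps)
    then have "vabs (fps_nth y n) ^ CARD('k) = vabs (fps_nth y n)" for n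
      by (metis vabs_power)
    then have small: "fps_nth y n = 0" if "vabs (fps_nth y n) < 1" for n
      using that q_ge_2 power_strict_decreasing[of 1 "CARD('k)" "vabs (fps_nth y n)"]
      by (cases "fps_nth y n = 0") (auto simp: less_le)
    have "y \<in> tate" unfolding y_def by (intro tate_mult f tate_const)
    then obtain N where "\<And>n. n \<ge> N \<Longrightarrow> vabs (fps_nth y n) < 1" by (rule tateE[of y 1]) auto
    then have "y = fps_of_poly (\<Sum>i<N. Polynomial.monom (fps_nth y i) i)"
      using small by (intro fps_ext) (auto simp: Polynomial.coeff_sum not_less)
    then show ?thesis unfolding y_def by blast
  qed
  have gh0: "fps_nth g 0 * fps_nth h 0 = 1"
    using arg_cong[OF gh, of "\<lambda>f. fps_nth f 0"] by simp
  then have g0: "fps_nth g 0 \<noteq> 0" and h0: "fps_nth h 0 \<noteq> 0" by auto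
  have c0: "c \<noteq> 0"
    using arg_cong[OF tw, of "\<lambda>f. fps_nth f 0"] g0 by (auto simp: frob_twist_nth)
  have "frob_twist CARD('k) 1 g * frob_twist CARD('k) 1 h = 1"
    by (simp only: gh twist_mult[symmetric] twist_1)
  then have "fps_const c * (g * frob_twist CARD('k) 1 h) = 1" by (simp only: tw mult.assoc)
  then have "h * (fps_const c * (g * frob_twist CARD('k) 1 h)) = h" by simp
  then have "(g * h) * (fps_const c * frob_twist CARD('k) 1 h) = h" by (simp only: mult_ac)
  then have ch: "fps_const c * frob_twist CARD('k) 1 h = h" by (simp only: gh mult_1_left)
  have "fps_const (inverse c) * (fps_const c * frob_twist CARD('k) 1 h) = frob_twist CARD('k) 1 h"
    using c0 by (simp flip: mult.assoc)
  then have "frob_twist CARD('k) 1 h = fps_const (inverse c) * h" by (simp only: ch)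
  then obtain p p' where p: "fps_const (inverse (fps_nth g 0)) * g = fps_of_poly p"
    "fps_const (inverse (fps_nth h 0)) * h = fps_of_poly p'"
    using poly[OF g g0 tw] poly[OF h h0] by blast
  have "fps_of_poly (p * p') = fps_const (inverse (fps_nth g 0 * fps_nth h 0)) * (g * h)"
    unfolding fps_of_poly_mult p[symmetric] by (simp add: mult_ac flip: fps_const_mult)
  then have "fps_of_poly (p * p') = fps_of_poly 1" by (simp add: gh gh0)
  then have "p * p' = 1" by (simp only: fps_of_poly_eq_iff)
  then have "p dvd 1" by (metis dvd_triv_left)
  then have "Polynomial.degree p = 0" by (simp add: poly_dvd_1)
  then obtain a where "p = [:a:]" by (metis degree_eq_zeroE)
  then have "fps_const (inverse (fps_nth g 0)) * g = fps_const a" using p(1) by (simp add: fps_of_poly_const)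
  then have coeff: "inverse (fps_nth g 0) * fps_nth g n = fps_nth (fps_const a) n" for n
    by (metis fps_mult_left_const_nth)
  have "fps_nth g n = 0" if "n \<noteq> 0" for n
    using coeff[of n] g0 that by simp
  then show ?thesis by (intro fps_ext) auto
qed

end

lemma fps_nth_0_hom: "comm_ring_hom (\<lambda>f :: 'a::comm_ring_1 fps. fps_nth f 0)"
  by unfold_locales auto

context drinfeld_setting
begin

text \<open>The factor \<open>t - \<theta>\<close> in the twist of the determinant is, up to a
  constant, the factor in the functional equation of \<open>V\<close>. Hence the product with
  \<open>V\<close> is an eigenvector of the twist, and it is a unit.\<close>

lemma det_psi_eq:
  assumes z: "z \<in> Omega r" and r: "r > 0"
  obtains W V where "omega = fps_const \<kappa> * W" "W * V = 1"
    "det (psi_mat 0 r z) = fps_const (fps_nth (det (psi_mat 0 r z)) 0) * W"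
    "fps_nth (det (psi_mat 0 r z)) 0 \<noteq> 0"
proof -
  let ?D = "det (psi_mat 0 r z)"
  obtain W V where WV: "omega = fps_const \<kappa> * W" "W \<in> tate" "V \<in> tate" "W * V = 1"
    "fps_nth W 0 = 1" "V = frob_twist CARD('k) 1 V * (1 - fps_const (inverse theta) * fps_X)"
    by (rule omega_factorization)
  obtain b where b: "frob_twist CARD('k) 1 ?D = fps_const b * (fps_X - fps_const theta) * ?D"
    using det_psi_twist[OF z r] by blast
  \<comment> \<open>The inverse of the determinant: the linear factors cancel the pole series in
    \<open>det_eis_psi\<close>.\<close>
  define U where "U = det (eis_mat r z) * (\<Prod>j<r. fps_X - fps_const (theta ^ (CARD('k) ^ j)))"
  have Dt: "?D \<in> tate"
    by (rule tate_det[of _ r]) (auto simp: psi_mat_def intro!: tate_twist tate_s_fun[OF z])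
  have "det (eis_mat r z) \<in> tate"
    by (rule tate_det[of _ r]) (auto simp: eis_mat_def intro!: tate_eis[OF z])
  then have Ut: "U \<in> tate"
    unfolding U_def by (intro tate_mult tate_prod tate_diff) simp_all
  have "?D * U = (det (eis_mat r z) * ?D) * (\<Prod>j<r. fps_X - fps_const (theta ^ (CARD('k) ^ j)))"
    by (simp add: U_def mult_ac)
  also have "\<dots> = 1"
    unfolding det_eis_psi[OF z] prod.distrib[symmetric] by (simp add: pole_series_mult)
  finally have DU: "?D * U = 1" .
  have "(?D * V) * (U * W) = (?D * U) * (W * V)" by (simp only: mult_ac)
  then have unit: "(?D * V) * (U * W) = 1" by (simp only: DU WV(4) mult_1_left)
  have X: "fps_X - fps_const theta = fps_const (- theta) * (1 - fps_const (inverse theta) * fps_X)"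
    by (rule fps_ext) (auto simp: fps_X_def algebra_simps)
  have "frob_twist CARD('k) 1 (?D * V) = fps_const b * (fps_X - fps_const theta) * ?D * frob_twist CARD('k) 1 V"
    by (simp only: twist_mult b)
  also have "\<dots> = fps_const b * fps_const (- theta) * ?D
      * (frob_twist CARD('k) 1 V * (1 - fps_const (inverse theta) * fps_X))"
    unfolding X by (simp only: mult_ac)
  also have "\<dots> = fps_const (b * - theta) * (?D * V)"
    unfolding WV(6)[symmetric] by (simp only: fps_const_mult mult.assoc)
  finally have tw: "frob_twist CARD('k) 1 (?D * V) = fps_const (b * - theta) * (?D * V)" .
  have c: "?D * V = fps_const (fps_nth (?D * V) 0)"
    by (rule twist_eigen_unit_const[OF tate_mult[OF Dt WV(3)] tate_mult[OF Ut WV(2)] unit tw])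
  have V0: "fps_nth V 0 = 1"
    using arg_cong[OF WV(4), of "\<lambda>f. fps_nth f 0"] WV(5) by simp
  have "?D = (?D * V) * W" using WV(4) by (simp add: mult_ac)
  also have "?D * V = fps_const (fps_nth ?D 0)" using c V0 by simp
  finally have "?D = fps_const (fps_nth ?D 0) * W" .
  moreover have "fps_nth ?D 0 \<noteq> 0"
    using arg_cong[OF DU, of "\<lambda>f. fps_nth f 0"] by auto
  ultimately show ?thesis using that[OF WV(1,4)] by blast
qed

definition tors_pt :: "'c vec \<Rightarrow> nat \<Rightarrow> 'c" where
  "tors_pt z i = lattice_exp (A_lattice z) (z $ i / theta)"

lemma det_psi_nth_0: "fps_nth (det (psi_mat 0 r z)) 0 = det (F.moore r (tors_pt z))"
proof -
  interpret h: comm_ring_hom "\<lambda>f :: 'c fps. fps_nth f 0" by (rule fps_nth_0_hom)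
  show ?thesis
    unfolding h.hom_det[symmetric]
    by (rule arg_cong[of _ _ det], rule eq_matI)
      (auto simp: psi_mat_def F.moore_def frob_twist_nth s_fun_nth tors_pt_def)
qed

lemma flin_tors_pt:
  assumes z: "z \<in> Omega r" and \<nu>: "\<nu> \<in> carrier_vec r"
  shows "F.flin r (tors_pt z) \<nu> = lattice_exp (A_lattice z) (alin (map_vec (\<lambda>c. [:c:]) \<nu>) z / theta)"
proof -
  interpret L: discrete_subgroup "A_lattice z" by (rule A_lattice_discrete[OF z])
  have "alin (map_vec (\<lambda>c. [:c:]) \<nu>) z / theta = (\<Sum>i<r. of_F (\<nu> $ i) * (z $ i / theta))"
    using \<nu> Omega_dim[OF z] by (simp add: alin_eq of_A_const sum_divide_distrib)
  then show ?thesis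
    by (simp only: F.flin_def tors_pt_def L.lattice_exp_sum A_lattice_scale_exp[OF z])
qed

lemma constant_vec_not_in_lattice:
  assumes z: "z \<in> Omega r" and \<nu>: "\<nu> \<in> carrier_vec r"
    and "alin (map_vec (\<lambda>c. [:c:]) \<nu>) z / theta \<in> A_lattice z"
  shows "\<nu> = 0\<^sub>v r"
proof -
  have "map_vec (\<lambda>c. [:c:]) \<nu> = 0\<^sub>v r"
    by (rule alin_divide_in_lattice[OF z, of _ 1])
      (use assms in \<open>auto simp: residues_vec_def polys_below_def coeff_pCons split: nat.split\<close>)
  then have "map_vec (\<lambda>c. [:c:]) \<nu> $ i = 0" if "i < r" for i using that by simp
  then show ?thesis using \<nu> by (intro eq_vecI) auto
qed

text \<open>The index vectors are \<open>\<nu> / \<theta> + b\<close> with \<open>b\<close> in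
  \<open>A^r\<close>, so the series is the sum of \<open>1 / (x + y)\<close> over the lattice at
  \<open>x = \<nu> \<cdot> z / \<theta>\<close>, the reciprocal of the exponential at
  \<open>x\<close>.\<close>

lemma Eis_eq:
  assumes z: "z \<in> Omega r" and \<nu>: "\<nu> \<in> carrier_vec r" "\<nu> \<noteq> 0\<^sub>v r"
  shows "Eis \<nu> z = inverse (F.flin r (tors_pt z) \<nu>)"
proof -
  interpret L: discrete_subgroup "A_lattice z" by (rule A_lattice_discrete[OF z])
  have dim: "dim_vec z = r" by (rule Omega_dim[OF z])
  let ?x = "alin (map_vec (\<lambda>c. [:c:]) \<nu>) z / theta"
  let ?S = "{a \<in> carrier_vec r. \<forall>i<r. a $ i \<in> K_set \<and>
        a $ i - fls_const (\<nu> $ i) / fls_X_inv \<in> range poly_to_Kinf}"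
  let ?g = "\<lambda>b. vec r (\<lambda>i. fls_const (\<nu> $ i) / fls_X_inv + poly_to_Kinf (b $ i))"
  have K: "fls_const c / fls_X_inv + poly_to_Kinf p \<in> K_set" for c and p :: "'k poly"
  proof -
    have "fls_const c / fls_X_inv + poly_to_Kinf p = poly_to_Kinf ([:c:] + [:0, 1:] * p) / poly_to_Kinf [:0, 1:]"
      by (simp only: poly_to_Kinf_add poly_to_Kinf_mult poly_to_Kinf_const poly_to_Kinf_X)
        (simp only: add_divide_distrib nonzero_mult_div_cancel_left[OF fls_X_inv_nonzero])
    moreover have "[:0, 1:] \<noteq> (0 :: 'k poly)" by simp
    ultimately show ?thesis unfolding K_set_def by blast
  qed
  have img: "?g ` carrier_vec r = ?S"
  proof (intro equalityI subsetI)
    fix a assume a: "a \<in> ?S"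
    then have "\<forall>i<r. \<exists>p. a $ i - fls_const (\<nu> $ i) / fls_X_inv = poly_to_Kinf p" by blast
    then obtain p where p: "\<And>i. i < r \<Longrightarrow> a $ i - fls_const (\<nu> $ i) / fls_X_inv = poly_to_Kinf (p i)"
      by metis
    have "a = ?g (vec r p)" using a by (intro eq_vecI) (auto simp: p[symmetric])
    then show "a \<in> ?g ` carrier_vec r" by auto
  qed (use K in auto)
  have lin: "lin_comb (?g b) z = ?x + alin b z" if "b \<in> carrier_vec r" for b
  proof -
    have "lin_comb (?g b) z = (\<Sum>i<r. (of_F (\<nu> $ i) / theta + of_A (b $ i)) * z $ i)"
      unfolding lin_comb_def dim
      by (intro sum.cong refl)
        (simp only: lessThan_iff index_vec of_Kinf_add of_Kinf_divide of_A_def of_F_def theta_def)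
    also have "\<dots> = (\<Sum>i<r. of_F (\<nu> $ i) * z $ i) / theta + (\<Sum>i<r. of_A (b $ i) * z $ i)"
      by (simp add: sum.distrib distrib_right sum_divide_distrib)
    also have "\<dots> = ?x + alin b z" using that \<nu>(1) dim by (simp add: alin_eq of_A_const)
    finally show ?thesis .
  qed
  have inj: "inj_on ?g (carrier_vec r)"
  proof (rule inj_onI)
    fix b b' :: "'k poly vec" assume b: "b \<in> carrier_vec r" "b' \<in> carrier_vec r" "?g b = ?g b'"
    have "?x + alin b z = ?x + alin b' z"
      by (simp only: lin[OF b(1), symmetric] lin[OF b(2), symmetric] b(3))
    then have "alin b z = alin b' z" by simp
    then show "b = b'" using inj_onD[OF alin_inj[OF z]] b by blast
  qed
  have x: "?x \<notin> A_lattice z" using constant_vec_not_in_lattice[OF z \<nu>(1)] \<nu>(2) by blast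
  have "((\<lambda>y. inverse (?x + y)) has_sum inverse (lattice_exp (A_lattice z) ?x)) ((\<lambda>b. alin b z) ` carrier_vec r)"
    using L.has_sum_inverse_lattice[OF x] dim by (simp add: A_lattice_eq)
  then have "((\<lambda>b. inverse (?x + alin b z)) has_sum inverse (lattice_exp (A_lattice z) ?x)) (carrier_vec r)"
    by (simp only: has_sum_reindex[OF alin_inj[OF z]] o_def)
  then have "((\<lambda>a. inverse (lin_comb a z)) \<circ> ?g has_sum inverse (lattice_exp (A_lattice z) ?x)) (carrier_vec r)"
    by (rule has_sum_cong[THEN iffD1, rotated]) (simp only: lin o_def)
  then have "((\<lambda>a. inverse (lin_comb a z)) has_sum inverse (lattice_exp (A_lattice z) ?x)) ?S"
    unfolding img[symmetric] has_sum_reindex[OF inj] .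
  then show ?thesis
    unfolding Eis_def dim flin_tors_pt[OF z \<nu>(1)] by (rule infsumI)
qed

text \<open>Lets the powers of the period in \<open>G_form\<close> and in \<open>h_fun\<close>
  cancel.\<close>

lemma carlitz_period_nonzero: "carlitz_period \<noteq> 0"
proof -
  let ?f = "\<lambda>i. inverse (theta ^ (CARD('k) ^ i - 1))"
  have vf: "vabs (?f i) = inverse (real CARD('k)) ^ (CARD('k) ^ i - 1)" for i
    by (simp add: vabs_inverse vabs_power vabs_theta power_inverse)
  have iq: "inverse (real CARD('k)) < 1" "0 < inverse (real CARD('k))"
    using real_q_gt_1 by (auto simp: inverse_less_1_iff)
  have exp_ge: "i \<le> CARD('k) ^ i - 1" for i
    using less_exp[of i] power_mono[OF q_ge_2, of i] by linarith
  have vle: "vabs (?f i) \<le> inverse (real CARD('k)) ^ i" for i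
    unfolding vf using iq by (intro power_decreasing exp_ge) auto
  have "vanishing ?f {1..}"
    unfolding vanishing_def
  proof (intro allI impI)
    fix e :: real assume e: "e > 0"
    obtain n where n: "inverse (real CARD('k)) ^ n < e" using real_arch_pow_inv[OF e iq(1)] by blast
    have lt: "i < n" if "e \<le> vabs (?f i)" for i
    proof (rule ccontr)
      assume "\<not> i < n"
      then have "inverse (real CARD('k)) ^ i \<le> inverse (real CARD('k)) ^ n"
        using iq by (intro power_decreasing) auto
      then show False using that vle[of i] n by linarith
    qed
    show "finite {i \<in> {1..}. e \<le> vabs (?f i)}"
      by (rule finite_subset[OF _ finite_lessThan[of n]]) (use lt in blast)
  qed
  from nonarch_product_converges[OF this] obtain P
    where P: "((\<lambda>F. \<Prod>i\<in>F. 1 - ?f i) \<longlongrightarrow> P) (finite_subsets_at_top {1..})"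
    and nz: "(\<And>i. i \<in> {1..} \<Longrightarrow> ?f i \<noteq> 1) \<Longrightarrow> P \<noteq> 0" by blast
  have "P \<noteq> 0"
  proof (rule nz)
    fix i :: nat assume "i \<in> {1..}"
    then have "vabs (?f i) < 1" using vle[of i] iq power_Suc_less_one[of "inverse (real CARD('k))" "i - 1"] by simp
    then show "?f i \<noteq> 1" by (metis less_irrefl vabs_one)
  qed
  have "filterlim (\<lambda>N. {1..N}) (finite_subsets_at_top {1::nat..}) sequentially"
    by (rule filterlim_finite_exhaustion) (auto simp: mono_def)
  from filterlim_compose[OF P this] have "(\<lambda>N. \<Prod>i=1..N. 1 - ?f i) \<longlonglongrightarrow> P" .
  from tendsto_inverse_nonarch[OF this \<open>P \<noteq> 0\<close>]
  have "(\<lambda>N. \<Prod>i=1..N. inverse (1 - ?f i)) \<longlonglongrightarrow> inverse P"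
    by (simp only: prod_inversef[symmetric] o_def)
  then have "lim (\<lambda>N. \<Prod>i=1..N. inverse (1 - ?f i)) = inverse P" by (rule limI)
  then show ?thesis using \<open>P \<noteq> 0\<close> by (simp add: carlitz_period_def)
qed

text \<open>All the functions of \<open>t\<close> in the definition of the form cancel.\<close>

theorem G_form_eq_eis_wedge:
  assumes z: "z \<in> Omega r" and r: "r > 0"
  shows "G_form r z = vec r (\<lambda>i. eis_wedge r i z)"
proof (rule eq_vecI)
  fix i assume "i < dim_vec (vec r (\<lambda>i. eis_wedge r i z))"
  then have i: "i < r" by simp
  let ?D = "det (psi_mat 0 r z)"
  define d where "d = fps_nth ?D 0"
  obtain W V where WV: "omega = fps_const \<kappa> * W" "W * V = 1" "?D = fps_const d * W" "d \<noteq> 0"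
    unfolding d_def using det_psi_eq[OF z r] by metis
  define p where "p = (\<Prod>j<r - 1. pole_series j)"
  let ?s = "frob_twist CARD('k) (r - 1) (s_fun i z)"
  let ?L = "\<Prod>j<r - 1. fps_X - fps_const (theta ^ (CARD('k) ^ j))"
  have pL: "p * ?L = 1"
    unfolding p_def prod.distrib[symmetric] by (simp add: pole_series_mult)
  have "F.flin r (tors_pt z) \<nu> \<noteq> 0" if "\<nu> \<in> carrier_vec r" "\<nu> \<noteq> 0\<^sub>v r" for \<nu>
    unfolding flin_tors_pt[OF z that(1)]
    using constant_vec_not_in_lattice[OF z that(1)] that(2)
      discrete_subgroup.lattice_exp_eq_0_iff[OF A_lattice_discrete[OF z]] by blast
  then have "det (F.moore r (tors_pt z)) = (\<Prod>\<nu>\<in>F.monics r. F.flin r (tors_pt z) \<nu>)"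
    by (intro F.moore_det) blast
  moreover have mon: "monic_vecs r = F.monics r"
    by (auto simp: monic_vecs_def F.monics_def)
  have nz: "\<nu> \<in> carrier_vec r \<and> \<nu> \<noteq> 0\<^sub>v r" if "\<nu> \<in> F.monics r" for \<nu>
    using that by (auto simp: F.monics_def)
  have "(\<Prod>\<nu>\<in>monic_vecs r. Eis \<nu> z) = (\<Prod>\<nu>\<in>F.monics r. inverse (F.flin r (tors_pt z) \<nu>))"
    unfolding mon by (intro prod.cong refl Eis_eq[OF z]) (use nz in auto)
  ultimately have Eis: "(\<Prod>\<nu>\<in>monic_vecs r. Eis \<nu> z) = inverse d"
    by (simp only: d_def det_psi_nth_0 prod_inversef[symmetric] o_def)
  have h: "carlitz_period ^ ((CARD('k) ^ r - 1) div (CARD('k) - 1)) * h_fun r z = \<kappa> * inverse d"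
    by (simp add: h_fun_def Eis carlitz_period_nonzero power_inverse flip: mult.assoc)
  have "(?L * (fps_const \<kappa> * W)) * (fps_const (inverse \<kappa>) * (p * V))
      = (p * ?L) * (W * V) * (fps_const \<kappa> * fps_const (inverse \<kappa>))" by (simp only: mult_ac)
  also have "\<dots> = 1" by (simp only: pL WV(2)) simp
  \<comment> \<open>Up to a constant the twisted \<open>omega\<close> is the product of linear
    factors times \<open>W\<close>; the former are inverted by the pole series and the latter by
    \<open>V\<close>.\<close>
  finally have inv: "inverse (frob_twist CARD('k) (r - 1) omega) = fps_const (inverse \<kappa>) * (p * V)"
    unfolding twist_omega by (simp only: WV(1) fps_inverse_unique)
  have "G_form r z $ i = fps_const (\<kappa> * inverse d) * (fps_const (inverse \<kappa>) * (p * V)) * ?s"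
    unfolding G_form_def index_vec[OF i] h inv ..
  also have "\<dots> = (fps_const (\<kappa> * inverse d) * fps_const (inverse \<kappa>)) * (V * (p * ?s))"
    by (simp only: mult_ac)
  also have "p * ?s = eis_wedge r i z * (fps_const d * W)"
    using det_wedge_psi[OF z r i] by (simp only: WV(3) p_def)
  also have "fps_const (\<kappa> * inverse d) * fps_const (inverse \<kappa>) = fps_const (inverse d)" by simp
  also have "fps_const (inverse d) * (V * (eis_wedge r i z * (fps_const d * W)))
      = (fps_const (inverse d) * fps_const d) * (W * V) * eis_wedge r i z" by (simp only: mult_ac)
  also have "\<dots> = eis_wedge r i z" using WV(4) by (simp only: WV(2)) simp
  finally show "G_form r z $ i = vec r (\<lambda>i. eis_wedge r i z) $ i" using i by simp
qed (simp add: G_form_def)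

text \<open>If the first entry vanished, so would \<open>s_fun 0 z\<close> at \<open>t = 0\<close>,
  the exponential at \<open>z\<^sub>1 / \<theta>\<close>. But that point is not in the
  lattice.\<close>

lemma G_form_nonzero:
  assumes z: "z \<in> Omega r" and r: "r > 0"
  shows "G_form r z \<noteq> 0\<^sub>v r"
proof
  assume G: "G_form r z = 0\<^sub>v r"
  interpret L: discrete_subgroup "A_lattice z" by (rule A_lattice_discrete[OF z])
  have "vec r (\<lambda>i. eis_wedge r i z) $ 0 = 0"
    using r unfolding G_form_eq_eis_wedge[OF z r, symmetric] G by simp
  then have "(\<Prod>j<r - 1. pole_series j) * frob_twist CARD('k) (r - 1) (s_fun 0 z) = 0"
    using det_wedge_psi[OF z r r] r by simp
  moreover have "pole_series j \<noteq> 0" for j using pole_series_mult[of j] by auto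
  ultimately have "frob_twist CARD('k) (r - 1) (s_fun 0 z) = 0" by simp
  then have "fps_nth (frob_twist CARD('k) (r - 1) (s_fun 0 z)) 0 = 0" by simp
  then have "tors_pt z 0 = 0" using q_ge_2 by (simp add: frob_twist_nth s_fun_nth tors_pt_def)
  then have "F.flin r (tors_pt z) (unit_vec r 0) = 0"
    using r by (auto simp: F.flin_def unit_vec_def intro!: sum.neutral)
  then have "alin (map_vec (\<lambda>c. [:c:]) (unit_vec r 0)) z / theta \<in> A_lattice z"
    by (simp add: flin_tors_pt[OF z] L.lattice_exp_eq_0_iff)
  then have "unit_vec r 0 = (0\<^sub>v r :: 'k vec)"
    using constant_vec_not_in_lattice[OF z] by simp
  then have "unit_vec r 0 $ 0 = (0\<^sub>v r :: 'k vec) $ 0" by simp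
  then show False using r by simp
qed

end

section \<open>Transformation behaviour\<close>

interpretation poly_to_Kinf_hom: comm_ring_hom "poly_to_Kinf :: 'k::field poly \<Rightarrow> 'k fls"
  by unfold_locales (simp_all add: poly_to_Kinf_add poly_to_Kinf_mult)

text \<open>The matrix whose last row is \<open>y\<close> and whose other rows are given by \<open>e\<close>; its determinant is
  the scalar product of \<open>y\<close> with the vector product of the rows of \<open>e\<close>.\<close>

definition rows_mat :: "nat \<Rightarrow> (nat \<Rightarrow> nat \<Rightarrow> 'a) \<Rightarrow> (nat \<Rightarrow> 'a) \<Rightarrow> 'a mat" where
  "rows_mat r e y = mat r r (\<lambda>(j, l). if j < r - 1 then e j l else y l)"

definition vprod :: "nat \<Rightarrow> (nat \<Rightarrow> nat \<Rightarrow> 'a::comm_ring_1) \<Rightarrow> nat \<Rightarrow> 'a" where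
  "vprod r e i = det (rows_mat r e (\<lambda>l. if l = i then 1 else 0))"

lemma rows_mat_carrier [simp]: "rows_mat r e y \<in> carrier_mat r r"
  by (simp add: rows_mat_def)

text \<open>Expansion along the last row, whose cofactors depend on \<open>e\<close> alone.\<close>

lemma det_rows_mat:
  assumes r: "r > 0"
  shows "det (rows_mat r e y) = (\<Sum>i<r. y i * vprod r e i)"
proof -
  define c where "c l = cofactor (rows_mat r e y) (r - 1) l" for l
  have c: "cofactor (rows_mat r e y') (r - 1) l = c l" for y' l
    unfolding c_def cofactor_def
    by (intro arg_cong2[of _ _ _ _ times] refl arg_cong[of _ _ det] eq_matI)
      (auto simp: mat_delete_def rows_mat_def)
  have det: "det (rows_mat r e y') = (\<Sum>l<r. y' l * c l)" for y'
  proof -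
    have "det (rows_mat r e y') = (\<Sum>l<r. rows_mat r e y' $$ (r - 1, l) * c l)"
      using laplace_expansion_row[OF rows_mat_carrier, of "r - 1" r e y'] r by (simp only: c)
    then show ?thesis using r by (simp add: rows_mat_def)
  qed
  have "vprod r e i = c i" if "i < r" for i
    unfolding vprod_def det using that by (simp add: if_distrib[of "\<lambda>x. x * _"] cong: if_cong)
  then show ?thesis by (simp add: det)
qed

lemma det_rows_mat_scale:
  assumes r: "r > 0"
  shows "det (rows_mat r (\<lambda>j l. c j * e j l) y) = (\<Prod>j<r - 1. c j) * det (rows_mat r e y)"
proof -
  obtain m where m: "r = Suc m" using r by (cases r) auto
  let ?D = "mat r r (\<lambda>(i, j). if i = j then (if i < m then c i else 1) else 0)"
  have "rows_mat r (\<lambda>j l. c j * e j l) y = ?D * rows_mat r e y"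
  proof (rule eq_matI)
    fix i j assume ij: "i < dim_row (?D * rows_mat r e y)" "j < dim_col (?D * rows_mat r e y)"
    then have "(?D * rows_mat r e y) $$ (i, j)
        = (\<Sum>l<r. (if i = l then if i < m then c i else 1 else 0) * rows_mat r e y $$ (l, j))"
      by (simp add: scalar_prod_def atLeast0LessThan rows_mat_def)
    also have "\<dots> = (if i < m then c i else 1) * rows_mat r e y $$ (i, j)"
      using ij by (simp add: if_distrib[of "\<lambda>x. x * _"] cong: if_cong)
    finally show "rows_mat r (\<lambda>j l. c j * e j l) y $$ (i, j) = (?D * rows_mat r e y) $$ (i, j)"
      using ij by (simp add: rows_mat_def m)
  qed (simp_all add: rows_mat_def)
  moreover have "det ?D = (\<Prod>i<r. ?D $$ (i, i))"
    by (rule det_lower_triangular_prod) auto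
  moreover have "(\<Prod>i<r. ?D $$ (i, i)) = (\<Prod>j<m. c j)"
    by (simp add: m)
  ultimately show ?thesis
    by (simp add: det_mult[of _ r] m)
qed

context drinfeld_setting
begin

lemma det_map_poly_to_Kinf: "det (map_mat poly_to_Kinf (\<gamma> :: 'k poly mat)) = poly_to_Kinf (det \<gamma>)"
  by (rule poly_to_Kinf_hom.hom_det)

lemma poly_to_Kinf_eq_0_iff [simp]: "poly_to_Kinf a = 0 \<longleftrightarrow> a = (0 :: 'k poly)"
  using of_A_eq_0_iff[of a] by (simp add: of_A_def)

lemma det_bar: "det (bar \<gamma>) = at_t (det \<gamma>)"
  unfolding bar_def by (rule at_t.hom_det)

section \<open>The action of matrices with nonzero determinant on points and linear forms\<close>

context
  fixes r :: nat and \<gamma> :: "'k poly mat" and z :: "'c vec"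
  assumes \<gamma>: "\<gamma> \<in> carrier_mat r r" "det \<gamma> \<noteq> 0" and z: "z \<in> Omega r" and r: "r > 0"
begin

private abbreviation (input) "\<Gamma> \<equiv> map_mat poly_to_Kinf \<gamma>"
private abbreviation (input) "J \<equiv> jfac (map_mat poly_to_Kinf \<gamma>) z"

private lemma dim: "dim_vec z = r" by (rule Omega_dim[OF z])

lemma transpose_mult_nonzero:
  assumes "b \<in> carrier_vec r" "transpose_mat \<Gamma> *\<^sub>v b = 0\<^sub>v r"
  shows "b = 0\<^sub>v r"
proof -
  have "det (transpose_mat \<Gamma>) \<noteq> 0"
    using \<gamma> by (simp add: det_transpose[of _ r] det_map_poly_to_Kinf)
  then show ?thesis
    using det_0_iff_vec_prod_zero[of "transpose_mat \<Gamma>" r] \<gamma>(1) assms by auto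
qed

lemma transpose_mult_inj: "inj_on (\<lambda>a. transpose_mat \<gamma> *\<^sub>v a) (carrier_vec r)"
proof (rule inj_onI)
  fix a b :: "'k poly vec"
  assume ab: "a \<in> carrier_vec r" "b \<in> carrier_vec r" "transpose_mat \<gamma> *\<^sub>v a = transpose_mat \<gamma> *\<^sub>v b"
  have d: "det (transpose_mat \<gamma>) \<noteq> 0" using \<gamma> by (simp add: det_transpose[of _ r])
  have "transpose_mat \<gamma> *\<^sub>v (a - b) = 0\<^sub>v r"
    using ab \<gamma>(1) by (subst mult_minus_distrib_mat_vec[of _ r r]) auto
  moreover have "a - b \<in> carrier_vec r" using ab by simp
  ultimately have "a - b = 0\<^sub>v r"
    using det_0_iff_vec_prod_zero[of "transpose_mat \<gamma>" r] \<gamma>(1) d by (metis transpose_carrier_mat)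
  then have "(a - b) $ i = 0" if "i < r" for i using that by simp
  then show "a = b" using ab by (intro eq_vecI) auto
qed

lemma jfac_eq: "J = alin (row \<gamma> (r - 1)) z"
proof -
  have "row \<Gamma> (r - 1) = map_vec poly_to_Kinf (row \<gamma> (r - 1))"
    using \<gamma>(1) r by (intro eq_vecI) auto
  then show ?thesis using \<gamma>(1) by (simp add: jfac_def alin_def)
qed

lemma act_index: "i < r \<Longrightarrow> act \<Gamma> z $ i = inverse J * alin (row \<gamma> i) z"
  using \<gamma>(1) dim by (simp add: act_def alin_eq scalar_prod_def atLeast0LessThan of_A_def)

lemma lin_comb_act:
  assumes "b \<in> carrier_vec r"
  shows "lin_comb b (act \<Gamma> z) = inverse J * lin_comb (transpose_mat \<Gamma> *\<^sub>v b) z"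
proof -
  have "lin_comb b (act \<Gamma> z) = (\<Sum>i<r. of_Kinf (b $ i) * (inverse J * (\<Sum>l<r. of_A (\<gamma> $$ (i, l)) * z $ l)))"
  proof -
    have "dim_vec (act \<Gamma> z) = r" using \<gamma>(1) by (simp add: act_def)
    then show ?thesis using \<gamma>(1) dim by (simp add: lin_comb_def act_index alin_eq)
  qed
  also have "\<dots> = inverse J * (\<Sum>l<r. (\<Sum>i<r. of_A (\<gamma> $$ (i, l)) * of_Kinf (b $ i)) * z $ l)"
    unfolding sum_distrib_left sum_distrib_right by (subst sum.swap) (simp add: mult_ac)
  also have "(\<Sum>l<r. (\<Sum>i<r. of_A (\<gamma> $$ (i, l)) * of_Kinf (b $ i)) * z $ l) = lin_comb (transpose_mat \<Gamma> *\<^sub>v b) z"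
    using \<gamma>(1) dim assms
    by (simp add: lin_comb_def scalar_prod_def atLeast0LessThan of_Kinf_sum of_Kinf_mult of_A_def)
  finally show ?thesis .
qed

lemma alin_act:
  assumes "a \<in> carrier_vec r"
  shows "alin a (act \<Gamma> z) = inverse J * alin (transpose_mat \<gamma> *\<^sub>v a) z"
proof -
  have "transpose_mat \<Gamma> *\<^sub>v map_vec poly_to_Kinf a = map_vec poly_to_Kinf (transpose_mat \<gamma> *\<^sub>v a)"
    using \<gamma>(1) assms
    by (intro eq_vecI) (auto simp: scalar_prod_def poly_to_Kinf_sum poly_to_Kinf_mult)
  then show ?thesis using assms by (simp add: alin_def lin_comb_act)
qed

lemma jfac_nonzero: "J \<noteq> 0"
proof
  assume "J = 0"
  then have "row \<gamma> (r - 1) = 0\<^sub>v r"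
    using alin_eq_0_iff[OF z, of "row \<gamma> (r - 1)"] \<gamma>(1) r by (auto simp: jfac_eq)
  moreover have "transpose_mat \<gamma> *\<^sub>v unit_vec r (r - 1) = row \<gamma> (r - 1)"
    using \<gamma>(1) r by (intro eq_vecI) (auto simp: scalar_prod_right_unit)
  moreover have "transpose_mat \<gamma> *\<^sub>v 0\<^sub>v r = 0\<^sub>v r" using \<gamma>(1) by (intro eq_vecI) auto
  ultimately have "unit_vec r (r - 1) = (0\<^sub>v r :: 'k poly vec)"
    using inj_onD[OF transpose_mult_inj, of "unit_vec r (r - 1)" "0\<^sub>v r"] by simp
  then have "unit_vec r (r - 1) $ (r - 1) = (0\<^sub>v r :: 'k poly vec) $ (r - 1)" by simp
  then show False using r by simp
qed

lemma act_Omega: "act \<Gamma> z \<in> Omega r"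
  unfolding Omega_def
proof (intro CollectI conjI ballI impI)
  show "act \<Gamma> z \<in> carrier_vec r" using \<gamma>(1) by (simp add: act_def carrier_vecI)
  have "act \<Gamma> z $ (r - 1) = inverse J * alin (row \<gamma> (r - 1)) z"
    by (rule act_index) (use r in simp)
  also have "alin (row \<gamma> (r - 1)) z = J" by (rule jfac_eq[symmetric])
  finally show "act \<Gamma> z $ (r - 1) = 1" using jfac_nonzero by simp
  fix b :: "'k fls vec" assume b: "b \<in> carrier_vec r" "lin_comb b (act \<Gamma> z) = 0"
  then have "lin_comb (transpose_mat \<Gamma> *\<^sub>v b) z = 0" using jfac_nonzero by (simp add: lin_comb_act)
  then have "transpose_mat \<Gamma> *\<^sub>v b = 0\<^sub>v r" using z b(1) \<gamma>(1) by (auto simp: Omega_def)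
  then show "b = 0\<^sub>v r" using transpose_mult_nonzero b(1) by blast
qed

end

definition eis_on :: "'k poly vec set \<Rightarrow> nat \<Rightarrow> nat \<Rightarrow> 'c vec \<Rightarrow> 'c fps" where
  "eis_on S j l z = Abs_fps (\<lambda>n. infsum (eis_term j l z n) S)"

lemma eis_on_has_sum:
  assumes "z \<in> Omega r" "S \<subseteq> carrier_vec r"
  shows "(eis_term j l z n has_sum fps_nth (eis_on S j l z) n) S"
  using has_sum_infsum[OF vanishing_imp_summable[OF vanishing_subset[OF vanishing_eis_term[OF assms(1)] assms(2)]]]
  by (simp add: eis_on_def)

lemma eis_eq_eis_on: "dim_vec z = r \<Longrightarrow> eis j l z = eis_on (carrier_vec r) j l z"
  by (simp add: eis_def eis_on_def)

lemma eis_wedge_eq: "eis_wedge r i z = vprod r (\<lambda>j l. eis j l z) i"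
  by (simp add: eis_wedge_def vprod_def wedge_mat_def rows_mat_def)

text \<open>The substitution \<open>a \<mapsto> transpose_mat \<gamma> *\<^sub>v a\<close>
  transforms the numerators \<open>a(t)\<close> by \<open>bar \<gamma>\<close> and the denominators
  by \<open>jfac\<close>. It is injective, so the sum becomes one over the image lattice.\<close>

lemma eis_act:
  assumes \<gamma>: "\<gamma> \<in> carrier_mat r r" "det \<gamma> \<noteq> 0" and z: "z \<in> Omega r" and r: "r > 0" and m: "m < r"
  shows "(\<Sum>l<r. eis j l (act (map_mat poly_to_Kinf \<gamma>) z) * at_t (\<gamma> $$ (l, m)))
    = fps_const (jfac (map_mat poly_to_Kinf \<gamma>) z ^ (CARD('k) ^ j))
      * eis_on ((\<lambda>a. transpose_mat \<gamma> *\<^sub>v a) ` carrier_vec r) j m z"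
proof (rule fps_ext)
  fix n
  let ?z = "act (map_mat poly_to_Kinf \<gamma>) z" and ?J = "jfac (map_mat poly_to_Kinf \<gamma>) z"
  let ?T = "\<lambda>a. transpose_mat \<gamma> *\<^sub>v a" and ?Q = "CARD('k) ^ j"
  let ?s = "fps_nth (\<Sum>l<r. eis j l ?z * at_t (\<gamma> $$ (l, m))) n"
  have T: "?T a \<in> carrier_vec r" for a using \<gamma>(1) by (simp add: carrier_vecI)
  have z': "?z \<in> Omega r" by (rule act_Omega[OF \<gamma> z r])
  have J: "?J \<noteq> 0" by (rule jfac_nonzero[OF \<gamma> z r])
  have "((\<lambda>a. \<Sum>l<r. \<Sum>i=0..n. eis_term j l ?z i a * fps_nth (at_t (\<gamma> $$ (l, m))) (n - i)) has_sum ?s) (carrier_vec r)"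
    unfolding fps_sum_nth fps_mult_nth by (intro has_sum_finite_sum has_sum_cmult_left eis_has_sum[OF z'])
  then have "((\<lambda>a. ?J ^ ?Q * (eis_term j m z n \<circ> ?T) a) has_sum ?s) (carrier_vec r)"
  proof (rule has_sum_cong[THEN iffD1, rotated])
    fix a :: "'k poly vec" assume a: "a \<in> carrier_vec r"
    have "?T a $ m = (\<Sum>l<r. a $ l * \<gamma> $$ (l, m))"
      using a \<gamma>(1) m by (simp add: scalar_prod_def atLeast0LessThan mult.commute)
    then have "fps_nth (at_t (?T a $ m)) n = (\<Sum>l<r. fps_nth (at_t (a $ l) * at_t (\<gamma> $$ (l, m))) n)"
      by (simp add: at_t.hom_sum at_t_mult fps_sum_nth)
    then have "of_F (poly.coeff (?T a $ m) n)
        = (\<Sum>l<r. \<Sum>i=0..n. of_F (poly.coeff (a $ l) i) * of_F (poly.coeff (\<gamma> $$ (l, m)) (n - i)))"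
      by (simp only: fps_mult_nth at_t_nth)
    moreover have "inverse (alin a ?z) ^ ?Q = ?J ^ ?Q * inverse (alin (?T a) z) ^ ?Q"
      by (simp add: alin_act[OF \<gamma> z r a] power_mult_distrib power_inverse)
    ultimately show "(\<Sum>l<r. \<Sum>i=0..n. eis_term j l ?z i a * fps_nth (at_t (\<gamma> $$ (l, m))) (n - i))
        = ?J ^ ?Q * (eis_term j m z n \<circ> ?T) a"
      by (simp add: eis_term_def at_t_nth sum_distrib_left sum_distrib_right mult_ac)
  qed
  moreover have "((\<lambda>a. ?J ^ ?Q * (eis_term j m z n \<circ> ?T) a) has_sum
      ?J ^ ?Q * fps_nth (eis_on (?T ` carrier_vec r) j m z) n) (carrier_vec r)"
    by (intro has_sum_cmult_right has_sum_reindex[OF transpose_mult_inj[OF \<gamma> z r], THEN iffD1]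
        eis_on_has_sum[OF z]) (use T in blast)
  ultimately have "?s = ?J ^ ?Q * fps_nth (eis_on (?T ` carrier_vec r) j m z) n"
    by (rule has_sum_unique)
  then show "?s = fps_nth (fps_const (?J ^ ?Q) * eis_on (?T ` carrier_vec r) j m z) n" by simp
qed

definition wedge_on :: "'k poly vec set \<Rightarrow> nat \<Rightarrow> nat \<Rightarrow> 'c vec \<Rightarrow> 'c fps" where
  "wedge_on S r i z = vprod r (\<lambda>j l. eis_on S j l z) i"

text \<open>Multiply the matrix with last row \<open>y\<close> on the right by
  \<open>bar \<gamma>\<close>: the Eisenstein rows change by \<open>eis_act\<close>, the last row
  becomes \<open>y\<close> times \<open>bar \<gamma>\<close>. Leaving \<open>y\<close> free serves
  two purposes: a unit vector gives modularity, a row of the adjugate the Hecke summand.\<close>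

lemma wedge_act:
  fixes y :: "nat \<Rightarrow> 'c fps"
  assumes \<gamma>: "\<gamma> \<in> carrier_mat r r" "det \<gamma> \<noteq> 0" and z: "z \<in> Omega r" and r: "r > 0"
  shows "(\<Sum>i<r. y i * eis_wedge r i (act (map_mat poly_to_Kinf \<gamma>) z)) * det (bar \<gamma>)
    = fps_const (jfac (map_mat poly_to_Kinf \<gamma>) z ^ (\<Sum>j<r - 1. CARD('k) ^ j))
      * (\<Sum>m<r. (\<Sum>i<r. y i * bar \<gamma> $$ (i, m)) * wedge_on ((\<lambda>a. transpose_mat \<gamma> *\<^sub>v a) ` carrier_vec r) r m z)"
proof -
  let ?z = "act (map_mat poly_to_Kinf \<gamma>) z" and ?J = "jfac (map_mat poly_to_Kinf \<gamma>) z"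
  let ?S = "(\<lambda>a. transpose_mat \<gamma> *\<^sub>v a) ` carrier_vec r"
  let ?y = "\<lambda>m. \<Sum>i<r. y i * bar \<gamma> $$ (i, m)"
  have bar: "bar \<gamma> \<in> carrier_mat r r" using \<gamma>(1) by (simp add: bar_def)
  have "(\<Sum>i<r. y i * eis_wedge r i ?z) * det (bar \<gamma>) = det (rows_mat r (\<lambda>j l. eis j l ?z) y * bar \<gamma>)"
    by (simp add: det_mult[OF rows_mat_carrier bar] det_rows_mat[OF r] eis_wedge_eq)
  also have "rows_mat r (\<lambda>j l. eis j l ?z) y * bar \<gamma>
      = rows_mat r (\<lambda>j l. fps_const (?J ^ (CARD('k) ^ j)) * eis_on ?S j l z) ?y"
  proof (rule eq_matI)
    fix j m assume "j < dim_row (rows_mat r (\<lambda>j l. fps_const (?J ^ (CARD('k) ^ j)) * eis_on ?S j l z) ?y)"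
      "m < dim_col (rows_mat r (\<lambda>j l. fps_const (?J ^ (CARD('k) ^ j)) * eis_on ?S j l z) ?y)"
    then have jm: "j < r" "m < r" by (simp_all add: rows_mat_def)
    have "(rows_mat r (\<lambda>j l. eis j l ?z) y * bar \<gamma>) $$ (j, m)
        = (\<Sum>l<r. (if j < r - 1 then eis j l ?z else y l) * bar \<gamma> $$ (l, m))"
      using jm bar by (simp add: rows_mat_def scalar_prod_def atLeast0LessThan)
    moreover have "bar \<gamma> $$ (l, m) = at_t (\<gamma> $$ (l, m))" if "l < r" for l
      using that jm \<gamma>(1) by (simp add: bar_def)
    ultimately show "(rows_mat r (\<lambda>j l. eis j l ?z) y * bar \<gamma>) $$ (j, m)
        = rows_mat r (\<lambda>j l. fps_const (?J ^ (CARD('k) ^ j)) * eis_on ?S j l z) ?y $$ (j, m)"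
      using jm by (cases "j < r - 1") (simp_all add: eis_act[OF \<gamma> z r jm(2)] rows_mat_def)
  qed (use bar in \<open>simp_all add: rows_mat_def\<close>)
  also have "det \<dots> = (\<Prod>j<r - 1. fps_const (?J ^ (CARD('k) ^ j))) * (\<Sum>m<r. ?y m * wedge_on ?S r m z)"
    unfolding det_rows_mat_scale[OF r] det_rows_mat[OF r] wedge_on_def ..
  also have "(\<Prod>j<r - 1. fps_const (?J ^ (CARD('k) ^ j))) = fps_const (?J ^ (\<Sum>j<r - 1. CARD('k) ^ j))"
  proof -
    have "(\<Prod>j<m. fps_const (?J ^ (CARD('k) ^ j))) = fps_const (?J ^ (\<Sum>j<m. CARD('k) ^ j))" for m
      by (induction m) (simp_all add: power_add)
    then show ?thesis .
  qed
  finally show ?thesis .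
qed

lemma transpose_GL_surj:
  assumes "\<gamma> \<in> GL_A r"
  shows "(\<lambda>a. transpose_mat \<gamma> *\<^sub>v a) ` carrier_vec r = (carrier_vec r :: 'k poly vec set)"
    and "\<gamma> \<in> carrier_mat r r" and "is_unit (det \<gamma>)"
proof -
  from assms obtain B where \<gamma>: "\<gamma> \<in> carrier_mat r r" and inv: "inverts_mat \<gamma> B" "inverts_mat B \<gamma>"
    by (auto simp: GL_A_def invertible_mat_def)
  have B: "B \<in> carrier_mat r r"
    using inv \<gamma> unfolding inverts_mat_def
    by (metis carrier_matD(1,2) carrier_matI index_mult_mat(2,3) index_one_mat(2,3))
  have BA: "B * \<gamma> = 1\<^sub>m r" and AB: "\<gamma> * B = 1\<^sub>m r" using inv \<gamma> B by (simp_all add: inverts_mat_def)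
  show "\<gamma> \<in> carrier_mat r r" by (rule \<gamma>)
  have "det \<gamma> * det B = 1" using det_mult[OF \<gamma> B] by (simp add: AB)
  then show "is_unit (det \<gamma>)" by (metis dvd_triv_left)
  show "(\<lambda>a. transpose_mat \<gamma> *\<^sub>v a) ` carrier_vec r = carrier_vec r"
  proof (intro equalityI subsetI)
    fix a :: "'k poly vec" assume a: "a \<in> carrier_vec r"
    have "transpose_mat \<gamma> *\<^sub>v (transpose_mat B *\<^sub>v a) = transpose_mat (B * \<gamma>) *\<^sub>v a"
      using \<gamma> B a by (simp add: transpose_mult[OF B \<gamma>] assoc_mult_mat_vec[of _ r r _ r])
    then have eq: "a = transpose_mat \<gamma> *\<^sub>v (transpose_mat B *\<^sub>v a)" using a by (simp add: BA)
    show "a \<in> (\<lambda>a. transpose_mat \<gamma> *\<^sub>v a) ` carrier_vec r"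
    proof (rule image_eqI)
      show "transpose_mat B *\<^sub>v a \<in> carrier_vec r" using B by (simp add: carrier_vecI)
    qed (rule eq)
  qed (use \<gamma> in auto)
qed

text \<open>Here the image lattice is all of \<open>A^r\<close>, and
  \<open>det (bar \<gamma>)\<close> is invertible, so \<open>wedge_act\<close> can be divided by
  it.\<close>

lemma eis_wedge_modular:
  assumes \<gamma>: "\<gamma> \<in> GL_A r" and z: "z \<in> Omega r" and r: "r > 0" and i: "i < r"
  shows "eis_wedge r i (act (map_mat poly_to_Kinf \<gamma>) z)
    = fps_const (jfac (map_mat poly_to_Kinf \<gamma>) z ^ (\<Sum>j<r - 1. CARD('k) ^ j))
      * (rho \<gamma> *\<^sub>v vec r (\<lambda>i. eis_wedge r i z)) $ i"
proof -
  let ?z = "act (map_mat poly_to_Kinf \<gamma>) z" and ?J = "jfac (map_mat poly_to_Kinf \<gamma>) z"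
  let ?c = "fps_const (?J ^ (\<Sum>j<r - 1. CARD('k) ^ j))"
  note GL = transpose_GL_surj[OF \<gamma>]
  have d: "det \<gamma> \<noteq> 0" using GL(3) by auto
  have bar: "bar \<gamma> \<in> carrier_mat r r" using GL(2) by (simp add: bar_def)
  obtain B where "det \<gamma> * B = 1" using GL(3) by (metis dvdE)
  then have "det (bar \<gamma>) * at_t B = 1" by (metis det_bar at_t_mult at_t_1)
  then have d0: "fps_nth (det (bar \<gamma>)) 0 \<noteq> 0"
    by (metis fps_mult_nth_0 fps_one_nth mult_zero_left zero_neq_one)
  have on: "wedge_on (carrier_vec r) r m z = eis_wedge r m z" for m
    unfolding wedge_on_def eis_wedge_eq eis_eq_eis_on[OF Omega_dim[OF z]] ..
  have "eis_wedge r i ?z * det (bar \<gamma>) = ?c * (\<Sum>m<r. bar \<gamma> $$ (i, m) * eis_wedge r m z)"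
    using wedge_act[OF GL(2) d z r, of "\<lambda>l. if l = i then 1 else 0"] i
    by (simp add: GL(1) on if_distrib[of "\<lambda>x. x * _"] cong: if_cong)
  then have "eis_wedge r i ?z * (det (bar \<gamma>) * inverse (det (bar \<gamma>)))
      = ?c * (inverse (det (bar \<gamma>)) * (\<Sum>m<r. bar \<gamma> $$ (i, m) * eis_wedge r m z))"
    by (simp add: mult_ac)
  also have "det (bar \<gamma>) * inverse (det (bar \<gamma>)) = 1"
    using inverse_mult_eq_1[OF d0] by (simp add: mult.commute)
  also have "inverse (det (bar \<gamma>)) * (\<Sum>m<r. bar \<gamma> $$ (i, m) * eis_wedge r m z)
      = (rho \<gamma> *\<^sub>v vec r (\<lambda>i. eis_wedge r i z)) $ i"
    using bar i by (simp add: rho_def scalar_prod_def atLeast0LessThan sum_distrib_left mult.assoc)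
  finally show ?thesis by simp
qed

text \<open>For \<open>y\<close> the \<open>i\<close>-th row of the adjugate, \<open>y\<close> times
  \<open>bar \<gamma>\<close> is \<open>det (bar \<gamma>)\<close> times the \<open>i\<close>-th
  unit vector. The determinant then occurs on both sides of \<open>wedge_act\<close> and cancels in
  the integral domain of power series, without having to be a unit.\<close>

lemma adj_wedge_act:
  assumes \<gamma>: "\<gamma> \<in> carrier_mat r r" "det \<gamma> \<noteq> 0" and z: "z \<in> Omega r" and r: "r > 0" and i: "i < r"
  shows "(adj_mat (bar \<gamma>) *\<^sub>v vec r (\<lambda>i. eis_wedge r i (act (map_mat poly_to_Kinf \<gamma>) z))) $ i
    = fps_const (jfac (map_mat poly_to_Kinf \<gamma>) z ^ (\<Sum>j<r - 1. CARD('k) ^ j))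
      * wedge_on ((\<lambda>a. transpose_mat \<gamma> *\<^sub>v a) ` carrier_vec r) r i z"
proof -
  let ?x = "vec r (\<lambda>i. eis_wedge r i (act (map_mat poly_to_Kinf \<gamma>) z))"
  let ?c = "fps_const (jfac (map_mat poly_to_Kinf \<gamma>) z ^ (\<Sum>j<r - 1. CARD('k) ^ j))"
  let ?S = "(\<lambda>a. transpose_mat \<gamma> *\<^sub>v a) ` carrier_vec r"
  have bar: "bar \<gamma> \<in> carrier_mat r r" using \<gamma>(1) by (simp add: bar_def)
  note adj = adj_mat[OF bar]
  define y where "y l = adj_mat (bar \<gamma>) $$ (i, l)" for l
  have y: "(adj_mat (bar \<gamma>) *\<^sub>v ?x) $ i = (\<Sum>l<r. y l * eis_wedge r l (act (map_mat poly_to_Kinf \<gamma>) z))"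
    using adj(1) i by (simp add: scalar_prod_def atLeast0LessThan y_def)
  have yb: "(\<Sum>l<r. y l * bar \<gamma> $$ (l, m)) = (if i = m then det (bar \<gamma>) else 0)" if m: "m < r" for m
  proof -
    have "(\<Sum>l<r. y l * bar \<gamma> $$ (l, m)) = (adj_mat (bar \<gamma>) * bar \<gamma>) $$ (i, m)"
      using adj(1) bar i m by (simp add: scalar_prod_def atLeast0LessThan y_def)
    then show ?thesis unfolding adj(3) using i m by simp
  qed
  have "(adj_mat (bar \<gamma>) *\<^sub>v ?x) $ i * det (bar \<gamma>)
      = ?c * (\<Sum>m<r. (if i = m then det (bar \<gamma>) else 0) * wedge_on ?S r m z)"
    unfolding y wedge_act[OF \<gamma> z r] by (simp add: yb)
  also have "\<dots> = (?c * wedge_on ?S r i z) * det (bar \<gamma>)"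
    using i by (simp add: if_distrib[of "\<lambda>x. x * _"] mult_ac cong: if_cong)
  finally show ?thesis using \<gamma>(2) by (simp add: det_bar)
qed

end

section \<open>Counting sublattices\<close>

text \<open>The sublattices of the Hecke correspondence are the kernels of the linear functionals \<open>f\<close> over
  \<open>A/\<pp>\<close> that are normalized to have last nonzero coordinate 1, at position \<open>l\<close>. The functionals
  killing \<open>r - 1\<close> given vectors are counted modulo \<open>q\<close>.\<close>

definition functionals :: "'k::field poly \<Rightarrow> nat \<Rightarrow> nat \<Rightarrow> 'k poly vec set" where
  "functionals p r l = {f \<in> carrier_vec r. (\<forall>i<r. f $ i \<in> polys_below (Polynomial.degree p)) \<and>
     f $ l = 1 \<and> (\<forall>i. l < i \<and> i < r \<longrightarrow> f $ i = 0)}"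

definition pairing :: "nat \<Rightarrow> 'a::comm_ring_1 vec \<Rightarrow> 'a vec \<Rightarrow> 'a" where
  "pairing r f a = (\<Sum>i<r. f $ i * a $ i)"

definition annihilators :: "'k::field poly \<Rightarrow> nat \<Rightarrow> nat \<Rightarrow> (nat \<Rightarrow> 'k poly vec) \<Rightarrow> 'k poly vec set" where
  "annihilators p r m a = {f \<in> carrier_vec r. (\<forall>i<r. f $ i \<in> polys_below (Polynomial.degree p)) \<and>
     (\<forall>j<m. p dvd pairing r f (a j))}"

lemma pairing_add: "f \<in> carrier_vec r \<Longrightarrow> g \<in> carrier_vec r \<Longrightarrow> pairing r (f + g) a = pairing r f a + pairing r g a"
  by (simp add: pairing_def distrib_right sum.distrib)

lemma pairing_diff: "f \<in> carrier_vec r \<Longrightarrow> g \<in> carrier_vec r \<Longrightarrow> pairing r (f - g) a = pairing r f a - pairing r g a"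
  by (simp add: pairing_def left_diff_distrib sum_subtractf)

lemma pairing_smult: "f \<in> carrier_vec r \<Longrightarrow> pairing r (c \<cdot>\<^sub>v f) a = c * pairing r f a"
  by (simp add: pairing_def sum_distrib_left mult.assoc)

lemma polys_below_add: "f \<in> polys_below n \<Longrightarrow> g \<in> polys_below n \<Longrightarrow> f + g \<in> polys_below n"
  and polys_below_diff: "f' \<in> polys_below n \<Longrightarrow> g' \<in> polys_below n \<Longrightarrow> f' - g' \<in> polys_below n"
  for f g :: "'a::comm_monoid_add poly" and f' g' :: "'b::ab_group_add poly"
  by (simp_all add: polys_below_def)

lemma polys_below_mod:
  fixes p :: "'k::field poly"
  assumes "Polynomial.degree p > 0"
  shows "u mod p \<in> polys_below (Polynomial.degree p)"
proof -
  have "p \<noteq> 0" using assms by auto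
  then show ?thesis
    using assms degree_mod_less'[of p u] by (cases "u mod p = 0") (auto simp: polys_below_degree)
qed

text \<open>Pigeonhole: \<open>m < r\<close> pairings modulo \<open>p\<close> cannot separate all
  vectors of \<open>r\<close> residues, and the difference of two that agree is an
  annihilator.\<close>

lemma annihilator_nontrivial:
  fixes p :: "'k::{field,finite} poly"
  assumes p: "Polynomial.degree p > 0" and m: "m < r"
  obtains h where "h \<in> annihilators p r m a" "h \<noteq> 0\<^sub>v r"
proof -
  let ?B = "polys_below (Polynomial.degree p) :: 'k poly set"
  let ?V = "{f \<in> carrier_vec r. \<forall>i<r. f $ i \<in> ?B}" and ?W = "{f \<in> carrier_vec m. \<forall>i<m. f $ i \<in> ?B}"
  let ?\<phi> = "\<lambda>f. vec m (\<lambda>j. pairing r f (a j) mod p)"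
  have "\<not> inj_on ?\<phi> ?V"
  proof
    assume inj: "inj_on ?\<phi> ?V"
    have "?\<phi> ` ?V \<subseteq> ?W" using polys_below_mod[OF p] by auto
    then have "card ?V \<le> card ?W"
      unfolding card_image[OF inj, symmetric] by (rule card_mono[OF finite_vecs[OF finite_polys_below]])
    moreover have "1 < CARD('k)" using card_finite_field_ge_2[where 'k = 'k] by linarith
    then have "card ?B ^ m < card ?B ^ r"
      unfolding card_polys_below using p m by (intro power_strict_increasing one_less_power)
    ultimately show False by (simp add: card_vecs)
  qed
  then obtain f g where fg: "f \<in> ?V" "g \<in> ?V" "f \<noteq> g" "?\<phi> f = ?\<phi> g" by (auto simp: inj_on_def)
  have "p dvd pairing r (f - g) (a j)" if "j < m" for j
  proof -
    have "?\<phi> f $ j = ?\<phi> g $ j" by (simp only: fg(4))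
    then have "pairing r f (a j) mod p = pairing r g (a j) mod p" using that by simp
    then show ?thesis using fg by (simp add: pairing_diff mod_eq_dvd_iff)
  qed
  then have "f - g \<in> annihilators p r m a"
    using fg by (auto simp: annihilators_def polys_below_diff)
  moreover have "f - g \<noteq> 0\<^sub>v r"
  proof
    assume 0: "f - g = 0\<^sub>v r"
    have "dim_vec f = r" "dim_vec g = r" using fg by auto
    then have "f $ i = g $ i" if "i < r" for i
      using arg_cong[OF 0, of "\<lambda>v. v $ i"] that by simp
    then show False using fg by (auto intro: eq_vecI)
  qed
  ultimately show ?thesis using that by blast
qed

text \<open>Let \<open>l\<close> be the last position with a nonzero entry. Multiplication by this
  entry is injective on the finite set of residues modulo the prime \<open>p\<close>, hence
  surjective, and an inverse \<open>u\<close> rescales the vector. That \<open>h $ l\<close> is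
  nonzero is recorded to locate \<open>l\<close> in the count.\<close>

lemma annihilator_normalize:
  fixes p :: "'k::{field,finite} poly"
  assumes p: "Factorial_Ring.irreducible p" "Polynomial.degree p > 0"
    and h: "h \<in> annihilators p r m a" "h \<noteq> 0\<^sub>v r"
  obtains l f where "l < r" "h $ l \<noteq> 0" "f \<in> annihilators p r m a" "f \<in> functionals p r l"
proof -
  let ?I = "{i. i < r \<and> h $ i \<noteq> 0}"
  have hc: "h \<in> carrier_vec r" using h(1) by (simp add: annihilators_def)
  have ne: "?I \<noteq> {}"
  proof
    assume "?I = {}"
    then have "h = 0\<^sub>v r" using hc by (intro eq_vecI) auto
    then show False using h(2) by simp
  qed
  define l where "l = Max ?I"
  have fin: "finite ?I" by simp
  have l: "l < r" "h $ l \<noteq> 0" using Max_in[OF fin ne] by (auto simp: l_def)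
  have above: "h $ i = 0" if "l < i" "i < r" for i
  proof (rule ccontr)
    assume "h $ i \<noteq> 0"
    then have "i \<le> l" unfolding l_def using that(2) by (intro Max_ge[OF fin]) simp
    then show False using that(1) by simp
  qed
  have "Polynomial.degree (h $ l) < Polynomial.degree p"
    using h(1) l p(2) by (auto simp: annihilators_def polys_below_degree)
  then have ndvd: "\<not> p dvd h $ l" using l(2) by (meson dvd_imp_degree_le not_less)
  let ?B = "polys_below (Polynomial.degree p) :: 'k poly set"
  have "inj_on (\<lambda>u. (u * h $ l) mod p) ?B"
  proof (rule inj_onI)
    fix u v assume uv: "u \<in> ?B" "v \<in> ?B" "(u * h $ l) mod p = (v * h $ l) mod p"
    then have "p dvd (u - v) * h $ l" by (simp add: mod_eq_dvd_iff left_diff_distrib)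
    then have "p dvd u - v"
      using field_poly_irreducible_imp_prime[OF p(1)] ndvd by (simp add: prime_elem_dvd_mult_iff)
    moreover have "Polynomial.degree (u - v) < Polynomial.degree p"
      using polys_below_diff[OF uv(1,2)] p(2) by (simp add: polys_below_degree)
    ultimately have "u - v = 0" by (meson dvd_imp_degree_le not_less)
    then show "u = v" by simp
  qed
  then have "(\<lambda>u. (u * h $ l) mod p) ` ?B = ?B"
    by (intro endo_inj_surj finite_polys_below) (use polys_below_mod[OF p(2)] in auto)
  moreover have "1 \<in> ?B" using p(2) by (simp add: polys_below_degree)
  ultimately obtain u where u: "(u * h $ l) mod p = 1" by (metis (no_types, lifting) imageE)
  let ?f = "vec r (\<lambda>i. (u * h $ i) mod p)"
  have "p dvd pairing r ?f (a j)" if "j < m" for j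
  proof -
    have "pairing r ?f (a j) mod p = (\<Sum>i<r. ((u * h $ i) mod p * a j $ i) mod p) mod p"
      by (simp add: pairing_def mod_sum_eq)
    also have "\<dots> = (u * pairing r h (a j)) mod p"
      by (simp add: pairing_def mod_mult_left_eq sum_distrib_left mult.assoc mod_sum_eq)
    also have "\<dots> = 0" using h(1) that by (simp add: annihilators_def)
    finally show ?thesis by (simp add: dvd_eq_mod_eq_0)
  qed
  then have "?f \<in> annihilators p r m a"
    using polys_below_mod[OF p(2)] by (simp add: annihilators_def)
  moreover have "?f \<in> functionals p r l"
    using polys_below_mod[OF p(2)] l above u by (simp add: functionals_def)
  ultimately show ?thesis using that[of l ?f] l by blast
qed

lemma finite_functionals: "finite (functionals p r l :: 'k::{field,finite} poly vec set)"
  by (rule finite_subset[OF _ finite_vecs[OF finite_polys_below]]) (auto simp: functionals_def)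

text \<open>Let \<open>l0\<close> be the least position that carries a normalized annihilator
  \<open>f0\<close>. There it is unique: the difference of two would normalize to a smaller
  position. For \<open>l > l0\<close>, adding constant multiples of \<open>f0\<close> acts freely on
  the annihilators at \<open>l\<close>, so their number is divisible by \<open>q\<close>.\<close>

lemma count_functionals:
  fixes p :: "'k::{field,finite} poly"
  assumes p: "Factorial_Ring.irreducible p" "Polynomial.degree p > 0" and m: "m < r"
  obtains N where "(\<Sum>l<r. card (functionals p r l \<inter> annihilators p r m a)) = 1 + CARD('k) * N"
proof -
  let ?M = "\<lambda>l. functionals p r l \<inter> annihilators p r m a"
  obtain h where "h \<in> annihilators p r m a" "h \<noteq> 0\<^sub>v r" by (rule annihilator_nontrivial[OF p(2) m])
  from annihilator_normalize[OF p this] have ex: "\<exists>l. l < r \<and> ?M l \<noteq> {}" by blast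
  define l0 where "l0 = (LEAST l. l < r \<and> ?M l \<noteq> {})"
  have l0: "l0 < r" "?M l0 \<noteq> {}" using LeastI_ex[OF ex] by (auto simp: l0_def)
  have below: "?M l = {}" if "l < l0" for l
    using not_less_Least[of l "\<lambda>l. l < r \<and> ?M l \<noteq> {}"] that l0(1) by (auto simp: l0_def)
  obtain f0 where f0: "f0 \<in> ?M l0" using l0(2) by blast
  have f0c: "f0 \<in> carrier_vec r" using f0 by (simp add: functionals_def)
  have "g = f0" if g: "g \<in> ?M l0" for g
  proof (rule ccontr)
    assume "g \<noteq> f0"
    have gc: "g \<in> carrier_vec r" using g by (simp add: functionals_def)
    have "g - f0 \<noteq> 0\<^sub>v r"
    proof
      assume 0: "g - f0 = 0\<^sub>v r"
      have "g $ i = f0 $ i" if "i < r" for i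
        using arg_cong[OF 0, of "\<lambda>v. v $ i"] gc f0c that by simp
      then show False using \<open>g \<noteq> f0\<close> gc f0c by (auto intro: eq_vecI)
    qed
    moreover have "g - f0 \<in> annihilators p r m a"
      using g f0 by (auto simp: annihilators_def pairing_diff polys_below_diff)
    ultimately obtain l f where l: "l < r" "(g - f0) $ l \<noteq> 0" "f \<in> annihilators p r m a" "f \<in> functionals p r l"
      using annihilator_normalize[OF p] by blast
    have "(g - f0) $ i = 0" if "i \<ge> l0" "i < r" for i
      using that g f0 gc f0c by (cases "i = l0") (auto simp: functionals_def)
    then have "l < l0" using l(1,2) by (meson not_less)
    then show False using below[of l] l(3,4) by blast
  qed
  then have "?M l0 = {f0}" using f0 by blast
  then have at: "card (?M l0) = 1" by simp
  have above: "\<exists>N. card (?M l) = CARD('k) * N" if l: "l0 < l" "l < r" for l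
  proof -
    \<comment> \<open>Since \<open>f0 $ l0 = 1\<close>, adding \<open>c\<close> times
      \<open>f0\<close> shifts this constant coefficient by \<open>c\<close>; its zero set meets
      each orbit exactly once.\<close>
    let ?\<kappa> = "\<lambda>f. poly.coeff (f $ l0) 0" and ?X0 = "{f \<in> ?M l. poly.coeff (f $ l0) 0 = 0}"
    let ?g = "\<lambda>(f, c). f + [:c:] \<cdot>\<^sub>v f0"
    have mem: "f + [:c:] \<cdot>\<^sub>v f0 \<in> ?M l" if f: "f \<in> ?M l" for f c
    proof -
      have "f0 $ i = 0" if "l \<le> i" "i < r" for i using f0 l that by (auto simp: functionals_def)
      moreover have "[:c:] * f0 $ i \<in> polys_below (Polynomial.degree p)" if "i < r" for i
        using f0 that by (auto simp: functionals_def polys_below_def)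
      ultimately show ?thesis
        using f f0 l f0c
        by (auto simp: functionals_def annihilators_def pairing_add pairing_smult
            intro!: polys_below_add dvd_add dvd_mult dvd_smult)
    qed
    have \<kappa>: "?\<kappa> (f + [:c:] \<cdot>\<^sub>v f0) = ?\<kappa> f + c" if "f \<in> ?M l" for f c
      using that f0 l0(1) f0c by (auto simp: functionals_def)
    have "bij_betw ?g (?X0 \<times> UNIV) (?M l)"
    proof (rule bij_betw_byWitness[where f' = "\<lambda>f. (f + [:- ?\<kappa> f:] \<cdot>\<^sub>v f0, ?\<kappa> f)"])
      have cancel: "f + [:c:] \<cdot>\<^sub>v f0 + [:- c:] \<cdot>\<^sub>v f0 = f" if "f \<in> ?M l" for f c
        using that f0c by (intro eq_vecI) (auto simp: functionals_def)
      have cancel': "f + [:- c:] \<cdot>\<^sub>v f0 + [:c:] \<cdot>\<^sub>v f0 = f" if "f \<in> ?M l" for f c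
        using that f0c by (intro eq_vecI) (auto simp: functionals_def)
      show "\<forall>x\<in>?X0 \<times> UNIV. (?g x + [:- ?\<kappa> (?g x):] \<cdot>\<^sub>v f0, ?\<kappa> (?g x)) = x"
        using \<kappa> cancel by auto
      show "\<forall>f\<in>?M l. ?g (f + [:- ?\<kappa> f:] \<cdot>\<^sub>v f0, ?\<kappa> f) = f"
        using cancel' by auto
      show "?g ` (?X0 \<times> UNIV) \<subseteq> ?M l" using mem by auto
      show "(\<lambda>f. (f + [:- ?\<kappa> f:] \<cdot>\<^sub>v f0, ?\<kappa> f)) ` ?M l \<subseteq> ?X0 \<times> UNIV"
        using mem \<kappa> by auto
    qed
    then have "card (?X0 \<times> (UNIV :: 'k set)) = card (?M l)" by (rule bij_betw_same_card)
    then show ?thesis by (intro exI[of _ "card ?X0"]) (simp add: card_cartesian_product mult.commute)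
  qed
  have "\<exists>N. card (?M l) = (if l = l0 then 1 else 0) + CARD('k) * N" if "l < r" for l
    using at below[of l] above[of l] that by (cases l l0 rule: linorder_cases) (auto intro: exI[of _ 0])
  then obtain N where "\<And>l. l < r \<Longrightarrow> card (?M l) = (if l = l0 then 1 else 0) + CARD('k) * N l" by metis
  then have "(\<Sum>l<r. card (?M l)) = 1 + CARD('k) * (\<Sum>l<r. N l)"
    using l0(1) by (simp add: sum.distrib sum_distrib_left)
  then show ?thesis using that by blast
qed

text \<open>The minus sign makes the row lattice of the matrix the kernel of \<open>f\<close> modulo
  \<open>p\<close>.\<close>

definition functional_mat :: "'k::field poly \<Rightarrow> nat \<Rightarrow> nat \<Rightarrow> 'k poly vec \<Rightarrow> 'k poly mat" where
  "functional_mat p r l f = mat r r (\<lambda>(i, j). if j \<noteq> l then (if i = j then 1 else 0)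
      else if i < l then - (f $ i) else if i = l then p else 0)"

lemma functional_mat_bij:
  assumes "l < r" "Polynomial.degree p > 0"
  shows "bij_betw (functional_mat p r l) (functionals p r l) (hecke_B p r l)"
proof (rule bij_betw_imageI)
  show "inj_on (functional_mat p r l) (functionals p r l)"
  proof (rule inj_onI)
    fix f g assume fg: "f \<in> functionals p r l" "g \<in> functionals p r l" "functional_mat p r l f = functional_mat p r l g"
    have "f $ i = g $ i" if i: "i < r" for i
    proof (cases i l rule: linorder_cases)
      case less
      have "functional_mat p r l f $$ (i, l) = functional_mat p r l g $$ (i, l)" by (simp only: fg(3))
      then show ?thesis using less i assms by (simp add: functional_mat_def)
    qed (use fg i in \<open>auto simp: functionals_def\<close>)
    then show "f = g" using fg by (intro eq_vecI) (auto simp: functionals_def)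
  qed
  show "functional_mat p r l ` functionals p r l = hecke_B p r l"
  proof (intro equalityI subsetI)
    fix \<gamma> assume "\<gamma> \<in> functional_mat p r l ` functionals p r l"
    then obtain f where f: "f \<in> functionals p r l" "\<gamma> = functional_mat p r l f" by blast
    then have "\<forall>i<l. Polynomial.degree (- (f $ i)) < Polynomial.degree p"
      using assms by (simp add: functionals_def polys_below_degree)
    then show "\<gamma> \<in> hecke_B p r l"
      unfolding f(2) functional_mat_def hecke_B_def mem_Collect_eq
      by (intro exI[of _ "\<lambda>i. - (f $ i)"] conjI refl)
  next
    fix \<gamma> assume "\<gamma> \<in> hecke_B p r l"
    then obtain b where b: "\<forall>i<l. Polynomial.degree (b i) < Polynomial.degree p"
      and \<gamma>: "\<gamma> = mat r r (\<lambda>(i, j). if j \<noteq> l then (if i = j then 1 else 0)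
                         else if i < l then b i else if i = l then p else 0)"
      by (auto simp: hecke_B_def)
    let ?f = "vec r (\<lambda>i. if i < l then - b i else if i = l then 1 else 0)"
    have "?f \<in> functionals p r l"
      using b assms by (auto simp: functionals_def polys_below_degree)
    moreover have "\<gamma> = functional_mat p r l ?f"
      unfolding \<gamma> functional_mat_def using assms(1) by (intro eq_matI) auto
    ultimately show "\<gamma> \<in> functional_mat p r l ` functionals p r l" by blast
  qed
qed

lemma functional_mat_det:
  assumes "l < r"
  shows "functional_mat p r l f \<in> carrier_mat r r" "det (functional_mat p r l f) = p"
proof -
  show c: "functional_mat p r l f \<in> carrier_mat r r" by (simp add: functional_mat_def)
  have "det (functional_mat p r l f) = prod_list (diag_mat (functional_mat p r l f))"
    by (rule det_upper_triangular[OF _ c]) (auto simp: functional_mat_def upper_triangular_def)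
  also have "\<dots> = (\<Prod>i<r. functional_mat p r l f $$ (i, i))"
    using c by (simp add: prod_list_diag_prod atLeast0LessThan)
  also have "\<dots> = (\<Prod>i<r. if i = l then p else 1)"
    by (intro prod.cong refl) (auto simp: functional_mat_def)
  also have "\<dots> = p" using assms by simp
  finally show "det (functional_mat p r l f) = p" .
qed

text \<open>The transpose fixes all coordinates except the \<open>l\<close>-th, which becomes
  \<open>p * a $ l\<close> minus the earlier part of the pairing. So \<open>f\<close> pairs with the
  image to \<open>p * a $ l\<close>; conversely the quotient of the pairing by \<open>p\<close> is
  the missing coordinate of the preimage.\<close>

lemma functional_mat_lattice:
  assumes l: "l < r" and f: "f \<in> functionals p r l"
  shows "(\<lambda>a. transpose_mat (functional_mat p r l f) *\<^sub>v a) ` carrier_vec r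
    = {a \<in> carrier_vec r. p dvd pairing r f a}"
proof -
  let ?T = "\<lambda>a. transpose_mat (functional_mat p r l f) *\<^sub>v a"
  have c: "functional_mat p r l f \<in> carrier_mat r r" by (rule functional_mat_det[OF l])
  have split: "(\<Sum>i<r. g i) = (\<Sum>i<l. g i) + g l" if "\<And>i. l < i \<Longrightarrow> i < r \<Longrightarrow> g i = 0" for g :: "nat \<Rightarrow> 'a poly"
  proof -
    have "(\<Sum>i<r. g i) = (\<Sum>i<Suc l. g i)"
      by (rule sum.mono_neutral_right) (use l that in auto)
    then show ?thesis by simp
  qed
  have other: "?T a $ j = a $ j" if "a \<in> carrier_vec r" "j < r" "j \<noteq> l" for a j
  proof -
    have "?T a $ j = (\<Sum>i<r. (if i = j then 1 else 0) * a $ i)"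
      using that c by (simp add: scalar_prod_def atLeast0LessThan functional_mat_def)
    then show ?thesis using that by (simp add: if_distrib[of "\<lambda>x. x * _"] cong: if_cong)
  qed
  have pivot: "?T a $ l = (\<Sum>i<l. - (f $ i) * a $ i) + p * a $ l" if "a \<in> carrier_vec r" for a
  proof -
    have "?T a $ l = (\<Sum>i<r. (if i < l then - (f $ i) else if i = l then p else 0) * a $ i)"
      using that c l by (simp add: scalar_prod_def atLeast0LessThan functional_mat_def)
    also have "\<dots> = (\<Sum>i<l. - (f $ i) * a $ i) + p * a $ l"
      by (subst split) auto
    finally show ?thesis .
  qed
  have pair: "pairing r f a = (\<Sum>i<l. f $ i * a $ i) + a $ l" for a
    unfolding pairing_def using f by (subst split) (auto simp: functionals_def)
  show ?thesis
  proof (intro equalityI subsetI)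
    fix a' assume "a' \<in> ?T ` carrier_vec r"
    then obtain a where a: "a \<in> carrier_vec r" "a' = ?T a" by blast
    have "pairing r f a' = p * a $ l"
      unfolding pair a(2) pivot[OF a(1)] using l
      by (simp add: other[OF a(1)] sum_negf del: index_mult_mat_vec)
    then have "p dvd pairing r f a'" by simp
    moreover have "a' \<in> carrier_vec r" unfolding a(2) using c by (simp add: carrier_vecI)
    ultimately show "a' \<in> {a \<in> carrier_vec r. p dvd pairing r f a}" by simp
  next
    fix a' assume a': "a' \<in> {a \<in> carrier_vec r. p dvd pairing r f a}"
    then have "p dvd pairing r f a'" by simp
    then obtain c' where c': "pairing r f a' = p * c'" by (rule dvdE)
    let ?a = "vec r (\<lambda>i. if i = l then c' else a' $ i)"
    have "?T ?a = a'"
    proof (rule eq_vecI)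
      fix j assume "j < dim_vec a'"
      then have j: "j < r" using a' by auto
      show "?T ?a $ j = a' $ j"
      proof (cases "j = l")
        case True
        have "?T ?a $ l = (\<Sum>i<l. - (f $ i) * a' $ i) + p * c'"
          using l by (subst pivot) auto
        also have "\<dots> = a' $ l" unfolding c'[symmetric] pair by (simp add: sum_negf)
        finally show ?thesis using True by simp
      qed (use j in \<open>simp add: other del: index_mult_mat_vec\<close>)
    qed (use a' c in auto)
    then show "a' \<in> ?T ` carrier_vec r" by (intro image_eqI[of _ _ ?a]) auto
  qed
qed

context drinfeld_setting
begin

lemma eis_on_finite:
  assumes "finite T"
  shows "eis_on T j l z = (\<Sum>a\<in>T. fps_const (inverse (alin a z) ^ (CARD('k) ^ j)) * at_t (a $ l))"
  by (rule fps_ext)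
    (simp add: eis_on_def infsum_finite[OF assms] fps_sum_nth eis_term_def at_t_nth mult.commute)

text \<open>The determinant of the matrix with rows
  \<open>g\<^sub>j(t) / (g\<^sub>j \<cdot> z)^(q^j)\<close> and the \<open>i\<close>-th unit vector
  as last row, in Leibniz form.\<close>

definition tuple_term :: "nat \<Rightarrow> nat \<Rightarrow> 'c vec \<Rightarrow> (nat \<Rightarrow> 'k poly vec) \<Rightarrow> 'c fps" where
  "tuple_term m i z g = (\<Sum>\<pi>\<in>{\<pi>. \<pi> permutes {0..<Suc m}}. signof \<pi>
      * ((\<Prod>j<m. fps_const (inverse (alin (g j) z) ^ (CARD('k) ^ j)) * at_t (g j $ \<pi> j))
        * (if \<pi> m = i then 1 else 0)))"

lemma wedge_on_finite:
  assumes T: "finite T"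
  shows "wedge_on T (Suc m) i z = (\<Sum>g\<in>{..<m} \<rightarrow>\<^sub>E T. tuple_term m i z g)"
proof -
  let ?t = "\<lambda>\<pi> j a. fps_const (inverse (alin a z) ^ (CARD('k) ^ j)) * at_t (a $ \<pi> j)"
  have "wedge_on T (Suc m) i z = (\<Sum>\<pi>\<in>{\<pi>. \<pi> permutes {0..<Suc m}}. signof \<pi>
      * ((\<Prod>j<m. eis_on T j (\<pi> j) z) * (if \<pi> m = i then 1 else 0)))"
    unfolding wedge_on_def vprod_def det_def'[OF rows_mat_carrier]
  proof (rule sum.cong[OF refl])
    fix \<pi> assume "\<pi> \<in> {\<pi>. \<pi> permutes {0..<Suc m}}"
    then have "\<pi> j < Suc m" if "j < Suc m" for j
      using that permutes_in_image[of \<pi> "{0..<Suc m}" j] by simp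
    then show "signof \<pi> * (\<Prod>j = 0..<Suc m. rows_mat (Suc m) (\<lambda>j l. eis_on T j l z) (\<lambda>l. if l = i then 1 else 0) $$ (j, \<pi> j))
        = signof \<pi> * ((\<Prod>j<m. eis_on T j (\<pi> j) z) * (if \<pi> m = i then 1 else 0))"
      by (simp add: rows_mat_def atLeast0LessThan)
  qed
  also have "\<dots> = (\<Sum>\<pi>\<in>{\<pi>. \<pi> permutes {0..<Suc m}}. \<Sum>g\<in>{..<m} \<rightarrow>\<^sub>E T.
      signof \<pi> * ((\<Prod>j<m. ?t \<pi> j (g j)) * (if \<pi> m = i then 1 else 0)))"
    unfolding eis_on_finite[OF T]
    by (subst prod_sum_PiE) (simp_all add: T sum_distrib_left sum_distrib_right)
  also have "\<dots> = (\<Sum>g\<in>{..<m} \<rightarrow>\<^sub>E T. tuple_term m i z g)"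
    unfolding tuple_term_def by (rule sum.swap)
  finally show ?thesis .
qed

text \<open>A tuple lies in the kernel of \<open>f\<close> exactly if \<open>f\<close> annihilates
  all its members. After exchanging the sums each tuple is weighted by the number from
  \<open>count_functionals\<close>, which is 1 in the field.\<close>

lemma sum_wedge_on_finite:
  assumes p: "Factorial_Ring.irreducible \<pp>" "Polynomial.degree \<pp> > 0"
    and T: "finite T" "T \<subseteq> carrier_vec (Suc m)"
  shows "(\<Sum>l<Suc m. \<Sum>f\<in>functionals \<pp> (Suc m) l.
      wedge_on ({a \<in> carrier_vec (Suc m). \<pp> dvd pairing (Suc m) f a} \<inter> T) (Suc m) i z)
    = wedge_on T (Suc m) i z"
proof -
  let ?r = "Suc m" and ?G = "{..<m} \<rightarrow>\<^sub>E T"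
  have fG: "finite ?G" using T(1) by (intro finite_PiE) auto
  have one: "wedge_on ({a \<in> carrier_vec ?r. \<pp> dvd pairing ?r f a} \<inter> T) ?r i z
      = (\<Sum>g\<in>?G. if f \<in> annihilators \<pp> ?r m g then tuple_term m i z g else 0)"
    if f: "f \<in> functionals \<pp> ?r l" for f l
  proof -
    let ?S = "{a \<in> carrier_vec ?r. \<pp> dvd pairing ?r f a} \<inter> T"
    have "{..<m} \<rightarrow>\<^sub>E ?S = {g \<in> ?G. f \<in> annihilators \<pp> ?r m g}"
    proof (intro equalityI subsetI)
      fix g assume g: "g \<in> {g \<in> ?G. f \<in> annihilators \<pp> ?r m g}"
      then show "g \<in> {..<m} \<rightarrow>\<^sub>E ?S" using T(2) by (auto simp: annihilators_def PiE_iff)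
    qed (use f in \<open>auto simp: annihilators_def functionals_def PiE_iff\<close>)
    moreover have "finite ?S" using T(1) by simp
    note wedge_on_finite[OF this, of m i z]
    ultimately have "wedge_on ?S ?r i z = (\<Sum>g\<in>{g \<in> ?G. f \<in> annihilators \<pp> ?r m g}. tuple_term m i z g)"
      by (simp only:)
    then show ?thesis using fG by (simp add: sum.inter_filter)
  qed
  have "(\<Sum>l<?r. \<Sum>f\<in>functionals \<pp> ?r l. wedge_on ({a \<in> carrier_vec ?r. \<pp> dvd pairing ?r f a} \<inter> T) ?r i z)
      = (\<Sum>l<?r. \<Sum>f\<in>functionals \<pp> ?r l. \<Sum>g\<in>?G. if f \<in> annihilators \<pp> ?r m g then tuple_term m i z g else 0)"
    by (intro sum.cong refl one)
  also have "\<dots> = (\<Sum>g\<in>?G. \<Sum>l<?r. \<Sum>f\<in>functionals \<pp> ?r l. if f \<in> annihilators \<pp> ?r m g then tuple_term m i z g else 0)"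
    by (subst sum.swap[of _ ?G], subst (2) sum.swap) (rule refl)
  also have "\<dots> = (\<Sum>g\<in>?G. tuple_term m i z g)"
  proof (rule sum.cong[OF refl])
    fix g
    obtain N where N: "(\<Sum>l<?r. card (functionals \<pp> ?r l \<inter> annihilators \<pp> ?r m g)) = 1 + CARD('k) * N"
      using count_functionals[OF p, of m ?r g] by auto
    have "of_nat CARD('k) = (0 :: 'c fps)"
      using F.of_nat_card_eq_0 by (metis fps_const_0_eq_0 fps_of_nat)
    then have one: "of_nat (1 + CARD('k) * N) = (1 :: 'c fps)" by simp
    have "(\<Sum>l<?r. \<Sum>f\<in>functionals \<pp> ?r l. if f \<in> annihilators \<pp> ?r m g then tuple_term m i z g else 0)
        = (\<Sum>l<?r. of_nat (card (functionals \<pp> ?r l \<inter> annihilators \<pp> ?r m g)) * tuple_term m i z g)"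
      by (intro sum.cong refl) (simp add: sum.If_cases[OF finite_functionals])
    also have "\<dots> = of_nat (1 + CARD('k) * N) * tuple_term m i z g"
      unfolding N[symmetric] of_nat_sum sum_distrib_right ..
    finally show "(\<Sum>l<?r. \<Sum>f\<in>functionals \<pp> ?r l. if f \<in> annihilators \<pp> ?r m g then tuple_term m i z g else 0)
        = tuple_term m i z g" by (simp only: one mult_1_left)
  qed
  also have "\<dots> = wedge_on T ?r i z" by (rule wedge_on_finite[OF T(1), symmetric])
  finally show ?thesis .
qed

text \<open>A coefficient of a product involves only finitely many coefficients of the factors, so
  coefficientwise convergence of the rows passes to the determinant.\<close>

lemma wedge_on_exhaustion:
  assumes z: "z \<in> Omega r" and S: "S \<subseteq> carrier_vec r"
  shows "(\<lambda>M. fps_nth (wedge_on (S \<inter> {a \<in> carrier_vec r. vabs (alin a z) \<le> real M}) r i z) n)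
    \<longlonglongrightarrow> fps_nth (wedge_on S r i z) n"
proof -
  let ?T = "\<lambda>M. S \<inter> {a \<in> carrier_vec r. vabs (alin a z) \<le> real M}"
  define conv where "conv F f \<longleftrightarrow> (\<forall>n. (\<lambda>M. fps_nth (F M) n) \<longlonglongrightarrow> fps_nth f n)"
    for F :: "nat \<Rightarrow> 'c fps" and f
  have const: "conv (\<lambda>M. f) f" for f by (simp add: conv_def)
  have mult: "conv (\<lambda>M. F M * G M) (f * g)" if "conv F f" "conv G g" for F f G g
    unfolding conv_def fps_mult_nth using that
    by (intro allI tendsto_sum tendsto_mult) (auto simp: conv_def)
  have sum: "conv (\<lambda>M. \<Sum>x\<in>I. F x M) (\<Sum>x\<in>I. f x)" if "\<And>x. x \<in> I \<Longrightarrow> conv (F x) (f x)"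
    for I :: "(nat \<Rightarrow> nat) set" and F f
    unfolding conv_def fps_sum_nth using that by (intro allI tendsto_sum) (auto simp: conv_def)
  have prod: "conv (\<lambda>M. \<Prod>x\<in>I. F x M) (\<Prod>x\<in>I. f x)" if "\<And>x. x \<in> I \<Longrightarrow> conv (F x) (f x)"
    for I :: "nat set" and F f
    using that by (induction I rule: infinite_finite_induct) (auto intro: const mult)
  have eis: "conv (\<lambda>M. eis_on (?T M) j l z) (eis_on S j l z)" for j l
    unfolding conv_def
  proof
    fix n
    have fin: "finite (?T M)" for M using finite_alin_ball[OF z] by simp
    have "(\<lambda>M. sum (eis_term j l z n) (?T M)) \<longlonglongrightarrow> fps_nth (eis_on S j l z) n"
    proof (rule has_sum_exhaustion[OF eis_on_has_sum[OF z S] fin])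
      show "mono ?T" by (auto simp: mono_def)
      show "S \<subseteq> (\<Union>M. ?T M)" by (auto simp: real_arch_simple subsetD[OF S])
    qed auto
    then show "(\<lambda>M. fps_nth (eis_on (?T M) j l z) n) \<longlonglongrightarrow> fps_nth (eis_on S j l z) n"
      by (simp add: eis_on_def infsum_finite[OF fin])
  qed
  have "conv (\<lambda>M. wedge_on (?T M) r i z) (wedge_on S r i z)"
    unfolding wedge_on_def vprod_def det_def'[OF rows_mat_carrier]
  proof (intro sum mult const prod)
    fix \<pi> :: "nat \<Rightarrow> nat" and j assume "\<pi> \<in> {\<pi>. \<pi> permutes {0..<r}}" "j \<in> {0..<r}"
    then have "\<pi> j < r" "j < r" using permutes_in_image[of \<pi> "{0..<r}" j] by auto
    then show "conv (\<lambda>M. rows_mat r (\<lambda>j l. eis_on (?T M) j l z) (\<lambda>l. if l = i then 1 else 0) $$ (j, \<pi> j))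
        (rows_mat r (\<lambda>j l. eis_on S j l z) (\<lambda>l. if l = i then 1 else 0) $$ (j, \<pi> j))"
      using eis const by (simp add: rows_mat_def)
  qed
  then show ?thesis by (simp add: conv_def)
qed

lemma sum_wedge_on:
  assumes p: "Factorial_Ring.irreducible \<pp>" "Polynomial.degree \<pp> > 0" and z: "z \<in> Omega r" and r: "r > 0"
  shows "(\<Sum>l<r. \<Sum>f\<in>functionals \<pp> r l. wedge_on {a \<in> carrier_vec r. \<pp> dvd pairing r f a} r i z)
    = eis_wedge r i z"
proof (rule fps_ext)
  fix n
  obtain m where m: "r = Suc m" using r by (cases r) auto
  let ?B = "\<lambda>M. {a \<in> carrier_vec r. vabs (alin a z) \<le> real M}"
  let ?S = "\<lambda>f. {a \<in> carrier_vec r. \<pp> dvd pairing r f a}"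
  have fin: "finite (?B M)" for M by (rule finite_alin_ball[OF z])
  have "(\<lambda>M. \<Sum>l<r. \<Sum>f\<in>functionals \<pp> r l. fps_nth (wedge_on (?S f \<inter> ?B M) r i z) n)
      \<longlonglongrightarrow> (\<Sum>l<r. \<Sum>f\<in>functionals \<pp> r l. fps_nth (wedge_on (?S f) r i z) n)"
    by (intro tendsto_sum wedge_on_exhaustion[OF z]) auto
  moreover have "(\<Sum>l<r. \<Sum>f\<in>functionals \<pp> r l. fps_nth (wedge_on (?S f \<inter> ?B M) r i z) n)
      = fps_nth (wedge_on (carrier_vec r \<inter> ?B M) r i z) n" for M
  proof -
    have 1: "carrier_vec r \<inter> ?B M = ?B M" and sub: "?B M \<subseteq> carrier_vec r" by auto
    show ?thesis
      unfolding 1 unfolding m sum_wedge_on_finite[OF p fin[of M, unfolded m] sub[unfolded m], symmetric] fps_sum_nth ..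
  qed
  moreover have "(\<lambda>M. fps_nth (wedge_on (carrier_vec r \<inter> ?B M) r i z) n) \<longlonglongrightarrow> fps_nth (wedge_on (carrier_vec r) r i z) n"
    by (rule wedge_on_exhaustion[OF z]) simp
  moreover have "wedge_on (carrier_vec r) r i z = eis_wedge r i z"
    unfolding wedge_on_def eis_wedge_eq eis_eq_eis_on[OF Omega_dim[OF z]] ..
  ultimately show "fps_nth (\<Sum>l<r. \<Sum>f\<in>functionals \<pp> r l. wedge_on (?S f) r i z) n = fps_nth (eis_wedge r i z) n"
    by (simp add: fps_sum_nth LIMSEQ_unique)
qed

theorem hecke_G_form:
  assumes p: "Factorial_Ring.irreducible \<pp>" "Polynomial.degree \<pp> > 0" and z: "z \<in> Omega r" and r: "r > 0"
  shows "hecke \<pp> r (\<Sum>j<r - 1. CARD('k) ^ j) (G_form r) z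
    = fps_const (of_A \<pp> ^ (\<Sum>j<r - 1. CARD('k) ^ j)) \<cdot>\<^sub>v G_form r z"
proof -
  let ?k = "\<Sum>j<r - 1. CARD('k) ^ j"
  let ?S = "\<lambda>f. {a \<in> carrier_vec r. \<pp> dvd pairing r f a}"
  let ?t = "\<lambda>i \<gamma>. fps_const (inverse (jfac (map_mat poly_to_Kinf \<gamma>) z ^ ?k)) *
        (adj_mat (bar \<gamma>) *\<^sub>v G_form r (act (map_mat poly_to_Kinf \<gamma>) z)) $ i"
  have p0: "\<pp> \<noteq> 0" using p(2) by auto
  have t: "?t i (functional_mat \<pp> r l f) = wedge_on (?S f) r i z"
    if i: "i < r" and l: "l < r" and f: "f \<in> functionals \<pp> r l" for i l f
  proof -
    let ?\<gamma> = "functional_mat \<pp> r l f"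
    have \<gamma>: "?\<gamma> \<in> carrier_mat r r" "det ?\<gamma> \<noteq> 0" using functional_mat_det[OF l, of \<pp> f] p0 by simp_all
    show ?thesis
      unfolding G_form_eq_eis_wedge[OF act_Omega[OF \<gamma> z r] r] adj_wedge_act[OF \<gamma> z r i]
        functional_mat_lattice[OF l f]
      using jfac_nonzero[OF \<gamma> z r] by (simp flip: mult.assoc)
  qed
  \<comment> \<open>The operator sums over a union of sets of matrices, so it splits by
    \<open>l\<close> only because the entry \<open>(l, l)\<close> tells the sets apart:
    \<open>\<pp>\<close> against 1.\<close>
  have disj: "hecke_B \<pp> r l \<inter> hecke_B \<pp> r l' = {}" if "l < r" "l' < r" "l \<noteq> l'" for l l'
  proof -
    have "\<gamma> $$ (l, l) = \<pp>" if "\<gamma> \<in> hecke_B \<pp> r l" for \<gamma> using that \<open>l < r\<close> by (auto simp: hecke_B_def)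
    moreover have "\<gamma> $$ (l, l) = 1" if "\<gamma> \<in> hecke_B \<pp> r l'" for \<gamma>
      using that \<open>l < r\<close> \<open>l \<noteq> l'\<close> by (auto simp: hecke_B_def)
    moreover have "\<pp> \<noteq> 1" using p(2) by auto
    ultimately show ?thesis by blast
  qed
  have fin: "finite (hecke_B \<pp> r l)" if "l < r" for l
    using bij_betw_finite[OF functional_mat_bij[OF that p(2)]] finite_functionals by blast
  have "(\<Sum>\<gamma>\<in>(\<Union>l<r. hecke_B \<pp> r l). ?t i \<gamma>) = eis_wedge r i z" if i: "i < r" for i
  proof -
    have "(\<Sum>\<gamma>\<in>(\<Union>l<r. hecke_B \<pp> r l). ?t i \<gamma>) = (\<Sum>l<r. \<Sum>\<gamma>\<in>hecke_B \<pp> r l. ?t i \<gamma>)"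
      by (rule sum.UNION_disjoint) (use fin disj in auto)
    also have "\<dots> = (\<Sum>l<r. \<Sum>f\<in>functionals \<pp> r l. wedge_on (?S f) r i z)"
    proof (rule sum.cong[OF refl])
      fix l assume "l \<in> {..<r}"
      then have l: "l < r" by simp
      have "(\<Sum>\<gamma>\<in>hecke_B \<pp> r l. ?t i \<gamma>) = (\<Sum>f\<in>functionals \<pp> r l. ?t i (functional_mat \<pp> r l f))"
        by (rule sum.reindex_bij_betw[OF functional_mat_bij[OF l p(2)], symmetric])
      also have "\<dots> = (\<Sum>f\<in>functionals \<pp> r l. wedge_on (?S f) r i z)"
        by (intro sum.cong refl t[OF i l])
      finally show "(\<Sum>\<gamma>\<in>hecke_B \<pp> r l. ?t i \<gamma>) = (\<Sum>f\<in>functionals \<pp> r l. wedge_on (?S f) r i z)" .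
    qed
    also have "\<dots> = eis_wedge r i z" by (rule sum_wedge_on[OF p z r])
    finally show ?thesis .
  qed
  then show ?thesis
    unfolding hecke_def G_form_eq_eis_wedge[OF z r] by (intro eq_vecI) auto
qed

end

section \<open>Holomorphy\<close>

definition monom_eval :: "(nat \<Rightarrow>\<^sub>0 nat) \<Rightarrow> 'c::complete_nonarch_field vec \<Rightarrow> 'c" where
  "monom_eval m z = (\<Prod>i\<in>Poly_Mapping.keys m. (z $ i) ^ Poly_Mapping.lookup m i)"

lemma monom_eval_superset:
  "finite S \<Longrightarrow> Poly_Mapping.keys m \<subseteq> S \<Longrightarrow> monom_eval m z = (\<Prod>i\<in>S. (z $ i) ^ Poly_Mapping.lookup m i)"
  unfolding monom_eval_def by (rule prod.mono_neutral_left) (auto simp: in_keys_iff)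

lemma monom_eval_add: "monom_eval (m + m') z = monom_eval m z * monom_eval m' z"
proof -
  let ?S = "Poly_Mapping.keys m \<union> Poly_Mapping.keys m'"
  have "monom_eval (m + m') z = (\<Prod>i\<in>?S. (z $ i) ^ Poly_Mapping.lookup (m + m') i)"
    by (rule monom_eval_superset) (auto dest: subsetD[OF Poly_Mapping.keys_add])
  also have "\<dots> = (\<Prod>i\<in>?S. (z $ i) ^ Poly_Mapping.lookup m i) * (\<Prod>i\<in>?S. (z $ i) ^ Poly_Mapping.lookup m' i)"
    by (simp add: lookup_add power_add prod.distrib)
  also have "\<dots> = monom_eval m z * monom_eval m' z"
    by (simp add: monom_eval_superset[of ?S])
  finally show ?thesis .
qed

text \<open>Passing from formal polynomials to their value functions reduces closure under ring
  operations to statements about monomials.\<close>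

definition poly_funs :: "nat \<Rightarrow> ('c::complete_nonarch_field vec \<Rightarrow> 'c fps) set" where
  "poly_funs r = {tate_poly_eval P | P. P \<in> tate_polys r}"

lemma tate_poly_eval_superset:
  "finite S \<Longrightarrow> Poly_Mapping.keys P \<subseteq> S \<Longrightarrow>
    tate_poly_eval P z = (\<Sum>m\<in>S. Poly_Mapping.lookup P m * fps_const (monom_eval m z))"
  unfolding tate_poly_eval_def monom_eval_def[symmetric]
  by (rule sum.mono_neutral_left) (auto simp: in_keys_iff)

lemma poly_funs_add:
  assumes "f \<in> poly_funs r" "g \<in> poly_funs r"
  shows "(\<lambda>z. f z + g z) \<in> poly_funs r"
proof -
  obtain P Q where P: "P \<in> tate_polys r" "f = tate_poly_eval P" and Q: "Q \<in> tate_polys r" "g = tate_poly_eval Q"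
    using assms by (auto simp: poly_funs_def)
  let ?S = "Poly_Mapping.keys P \<union> Poly_Mapping.keys Q"
  have "tate_poly_eval (P + Q) z = f z + g z" for z
    using tate_poly_eval_superset[of ?S "P + Q" z] Poly_Mapping.keys_add[of P Q]
    by (simp add: P(2) Q(2) tate_poly_eval_superset[of ?S] lookup_add distrib_right sum.distrib)
  moreover have "P + Q \<in> tate_polys r"
  proof -
    have "Poly_Mapping.lookup P m \<in> tate" "Poly_Mapping.lookup Q m \<in> tate" for m
      using P(1) Q(1) by (cases "m \<in> Poly_Mapping.keys P"; cases "m \<in> Poly_Mapping.keys Q";
        auto simp: tate_polys_def in_keys_iff)+
    then show ?thesis
      using P(1) Q(1) Poly_Mapping.keys_add[of P Q] by (fastforce simp: tate_polys_def lookup_add intro: tate_add)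
  qed
  ultimately show ?thesis unfolding poly_funs_def by (auto intro!: exI[of _ "P + Q"])
qed

lemma poly_funs_monom:
  assumes "c \<in> tate" "Poly_Mapping.keys m \<subseteq> {..<r - 1}"
  shows "(\<lambda>z. c * fps_const (monom_eval m z)) \<in> poly_funs r"
proof -
  have "tate_poly_eval (Poly_Mapping.single m c) z = c * fps_const (monom_eval m z)" for z
    using tate_poly_eval_superset[of "{m}" "Poly_Mapping.single m c" z] by (cases "c = 0") auto
  moreover have "Poly_Mapping.single m c \<in> tate_polys r"
    using assms by (cases "c = 0") (auto simp: tate_polys_def)
  ultimately show ?thesis unfolding poly_funs_def by (auto intro!: exI[of _ "Poly_Mapping.single m c"])
qed

lemma poly_funs_const: "c \<in> tate \<Longrightarrow> (\<lambda>z. c) \<in> poly_funs r"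
  using poly_funs_monom[of c 0 r] by (simp add: monom_eval_def)

lemma poly_funs_var: "i < r - 1 \<Longrightarrow> (\<lambda>z. fps_const (z $ i)) \<in> poly_funs r"
  using poly_funs_monom[of 1 "Poly_Mapping.single i 1" r] by (simp add: monom_eval_def)

lemma poly_funs_sum:
  "finite I \<Longrightarrow> (\<And>i. i \<in> I \<Longrightarrow> f i \<in> poly_funs r) \<Longrightarrow> (\<lambda>z. \<Sum>i\<in>I. f i z) \<in> poly_funs r"
  by (induction I rule: finite_induct) (auto intro: poly_funs_add poly_funs_const)

lemma poly_funs_mult:
  assumes "f \<in> poly_funs r" "g \<in> poly_funs r"
  shows "(\<lambda>z. f z * g z) \<in> poly_funs r"
proof -
  obtain P Q where P: "P \<in> tate_polys r" "f = tate_poly_eval P" and Q: "Q \<in> tate_polys r" "g = tate_poly_eval Q"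
    using assms by (auto simp: poly_funs_def)
  let ?t = "\<lambda>m m' z. (Poly_Mapping.lookup P m * Poly_Mapping.lookup Q m') * fps_const (monom_eval (m + m') z)"
  have "(\<lambda>z. f z * g z) = (\<lambda>z. \<Sum>m\<in>Poly_Mapping.keys P. \<Sum>m'\<in>Poly_Mapping.keys Q. ?t m m' z)"
    by (rule ext)
      (simp add: P(2) Q(2) tate_poly_eval_superset[OF finite_keys order_refl] sum_product monom_eval_add
        mult_ac flip: fps_const_mult)
  moreover have "?t m m' \<in> poly_funs r" if "m \<in> Poly_Mapping.keys P" "m' \<in> Poly_Mapping.keys Q" for m m'
  proof (intro poly_funs_monom tate_mult)
    show "Poly_Mapping.lookup P m \<in> tate" "Poly_Mapping.lookup Q m' \<in> tate"
      using that P(1) Q(1) by (auto simp: tate_polys_def)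
    have "Poly_Mapping.keys m \<subseteq> {..<r - 1}" "Poly_Mapping.keys m' \<subseteq> {..<r - 1}"
      using that P(1) Q(1) unfolding tate_polys_def by blast+
    then show "Poly_Mapping.keys (m + m') \<subseteq> {..<r - 1}"
      using Poly_Mapping.keys_add[of m m'] by blast
  qed
  ultimately show ?thesis by (simp add: poly_funs_sum)
qed

lemma tate_units_mult:
  assumes "f \<in> tate_units" "g \<in> tate_units"
  shows "f * g \<in> tate_units"
proof -
  obtain f' g' where "f' \<in> tate" "g' \<in> tate" "f * f' = 1" "g * g' = 1" "f \<in> tate" "g \<in> tate"
    using assms by (auto simp: tate_units_def)
  moreover from this have "(f * g) * (f' * g') = 1"
    by (metis (no_types, lifting) mult.assoc mult.left_commute mult_1_right)
  ultimately show ?thesis unfolding tate_units_def by (blast intro: tate_mult)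
qed

lemma regular_rationalI:
  assumes "P \<in> poly_funs r" "Q \<in> poly_funs r"
    "\<And>z. z \<in> S \<Longrightarrow> Q z \<in> tate_units" "\<And>z. z \<in> S \<Longrightarrow> f z = P z * inverse (Q z)"
  shows "f \<in> regular_rational r S"
  using assms unfolding poly_funs_def regular_rational_def by blast

lemma regular_rationalE:
  assumes "f \<in> regular_rational r S"
  obtains P Q where "P \<in> poly_funs r" "Q \<in> poly_funs r"
    "\<And>z. z \<in> S \<Longrightarrow> Q z \<in> tate_units" "\<And>z. z \<in> S \<Longrightarrow> f z = P z * inverse (Q z)"
  using assms unfolding poly_funs_def regular_rational_def by blast

lemma tate_units_inverse: "f \<in> tate_units \<Longrightarrow> f * inverse f = 1"
  using fps_inverse_unique by (auto simp: tate_units_def)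

lemma regular_rational_const: "c \<in> tate \<Longrightarrow> (\<lambda>z. c) \<in> regular_rational r S"
  by (rule regular_rationalI[of "\<lambda>z. c" r "\<lambda>z. 1"])
    (auto intro: poly_funs_const simp: tate_units_def intro!: bexI[of _ 1])

lemma regular_rational_add:
  assumes "f \<in> regular_rational r S" "g \<in> regular_rational r S"
  shows "(\<lambda>z. f z + g z) \<in> regular_rational r S"
proof -
  obtain P Q where P: "P \<in> poly_funs r" "Q \<in> poly_funs r" "\<And>z. z \<in> S \<Longrightarrow> Q z \<in> tate_units"
    "\<And>z. z \<in> S \<Longrightarrow> f z = P z * inverse (Q z)" using regular_rationalE[OF assms(1)] by blast
  obtain P' Q' where P': "P' \<in> poly_funs r" "Q' \<in> poly_funs r" "\<And>z. z \<in> S \<Longrightarrow> Q' z \<in> tate_units"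
    "\<And>z. z \<in> S \<Longrightarrow> g z = P' z * inverse (Q' z)" using regular_rationalE[OF assms(2)] by blast
  show ?thesis
  proof (rule regular_rationalI[of "\<lambda>z. P z * Q' z + P' z * Q z" r "\<lambda>z. Q z * Q' z"])
    fix z assume z: "z \<in> S"
    have "(P z * Q' z + P' z * Q z) * inverse (Q z * Q' z)
        = P z * inverse (Q z) * (Q' z * inverse (Q' z)) + P' z * inverse (Q' z) * (Q z * inverse (Q z))"
      by (simp add: fps_inverse_mult algebra_simps)
    then show "f z + g z = (P z * Q' z + P' z * Q z) * inverse (Q z * Q' z)"
      using tate_units_inverse[OF P(3)[OF z]] tate_units_inverse[OF P'(3)[OF z]] P(4)[OF z] P'(4)[OF z] by simp
  qed (auto intro!: poly_funs_add poly_funs_mult tate_units_mult P P')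
qed

lemma regular_rational_mult:
  assumes "f \<in> regular_rational r S" "g \<in> regular_rational r S"
  shows "(\<lambda>z. f z * g z) \<in> regular_rational r S"
proof -
  obtain P Q where P: "P \<in> poly_funs r" "Q \<in> poly_funs r" "\<And>z. z \<in> S \<Longrightarrow> Q z \<in> tate_units"
    "\<And>z. z \<in> S \<Longrightarrow> f z = P z * inverse (Q z)" using regular_rationalE[OF assms(1)] by blast
  obtain P' Q' where P': "P' \<in> poly_funs r" "Q' \<in> poly_funs r" "\<And>z. z \<in> S \<Longrightarrow> Q' z \<in> tate_units"
    "\<And>z. z \<in> S \<Longrightarrow> g z = P' z * inverse (Q' z)" using regular_rationalE[OF assms(2)] by blast
  show ?thesis
    by (rule regular_rationalI[of "\<lambda>z. P z * P' z" r "\<lambda>z. Q z * Q' z"])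
      (auto intro!: poly_funs_mult tate_units_mult P P' simp: P(4) P'(4) fps_inverse_mult mult_ac)
qed

lemma regular_rational_power:
  "f \<in> regular_rational r S \<Longrightarrow> (\<lambda>z. f z ^ n) \<in> regular_rational r S"
  by (induction n) (auto intro: regular_rational_mult regular_rational_const)

lemma regular_rational_sum:
  "finite I \<Longrightarrow> (\<And>i. i \<in> I \<Longrightarrow> f i \<in> regular_rational r S) \<Longrightarrow> (\<lambda>z. \<Sum>i\<in>I. f i z) \<in> regular_rational r S"
  by (induction I rule: finite_induct) (auto intro: regular_rational_add regular_rational_const)

text \<open>The uniform bound is included to make the notion stable under products, as the
  determinant expansion requires.\<close>

definition approximable :: "nat \<Rightarrow> 'c::complete_nonarch_field vec set \<Rightarrow> ('c vec \<Rightarrow> 'c fps) \<Rightarrow> bool" where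
  "approximable r S f \<longleftrightarrow> (\<exists>B. \<forall>z\<in>S. coeffs_le (f z) B) \<and>
     (\<forall>e>0. \<exists>g\<in>regular_rational r S. \<forall>z\<in>S. coeffs_le (f z - g z) e)"

lemma approximableE:
  assumes "approximable r S f"
  obtains B where "B > 0" "\<And>z. z \<in> S \<Longrightarrow> coeffs_le (f z) B"
    "\<And>e. e > 0 \<Longrightarrow> \<exists>g\<in>regular_rational r S. \<forall>z\<in>S. coeffs_le (f z - g z) e"
proof -
  obtain B where "\<forall>z\<in>S. coeffs_le (f z) B" using assms by (auto simp: approximable_def)
  then have "coeffs_le (f z) (max 1 B)" if "z \<in> S" for z
    using that by (auto intro: coeffs_le_trans)
  then show ?thesis using that[of "max 1 B"] assms by (auto simp: approximable_def)
qed

lemma approximable_const: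
  assumes "c \<in> tate"
  shows "approximable r S (\<lambda>z. c)"
  unfolding approximable_def
proof (intro conjI allI impI)
  show "\<exists>B. \<forall>z\<in>S. coeffs_le c B" using coeffs_le_gauss_norm[OF assms] by blast
  fix e :: real assume "e > 0"
  then show "\<exists>g\<in>regular_rational r S. \<forall>z\<in>S. coeffs_le (c - g z) e"
    by (intro bexI[OF _ regular_rational_const[OF assms]]) (simp add: coeffs_le_zero)
qed

lemma approximable_add:
  assumes "approximable r S f" "approximable r S g"
  shows "approximable r S (\<lambda>z. f z + g z)"
proof -
  obtain B where B: "B > 0" "\<And>z. z \<in> S \<Longrightarrow> coeffs_le (f z) B"
    "\<And>e. e > 0 \<Longrightarrow> \<exists>h\<in>regular_rational r S. \<forall>z\<in>S. coeffs_le (f z - h z) e" using approximableE[OF assms(1)] by metis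
  obtain C where C: "C > 0" "\<And>z. z \<in> S \<Longrightarrow> coeffs_le (g z) C"
    "\<And>e. e > 0 \<Longrightarrow> \<exists>h\<in>regular_rational r S. \<forall>z\<in>S. coeffs_le (g z - h z) e" using approximableE[OF assms(2)] by metis
  show ?thesis
    unfolding approximable_def
  proof (intro conjI allI impI)
    show "\<exists>D. \<forall>z\<in>S. coeffs_le (f z + g z) D"
      by (rule exI[of _ "max B C"]) (auto intro!: coeffs_le_add coeffs_le_trans[OF B(2)] coeffs_le_trans[OF C(2)])
    fix e :: real assume "e > 0"
    then obtain h h' where h: "h \<in> regular_rational r S" "\<forall>z\<in>S. coeffs_le (f z - h z) e"
      and h': "h' \<in> regular_rational r S" "\<forall>z\<in>S. coeffs_le (g z - h' z) e" using B(3) C(3) by meson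
    have "coeffs_le (f z + g z - (h z + h' z)) e" if "z \<in> S" for z
    proof -
      have "f z + g z - (h z + h' z) = (f z - h z) + (g z - h' z)" by (simp add: algebra_simps)
      then show ?thesis using h(2) h'(2) that by (simp only: coeffs_le_add)
    qed
    then show "\<exists>h\<in>regular_rational r S. \<forall>z\<in>S. coeffs_le (f z + g z - h z) e"
      using regular_rational_add[OF h(1) h'(1)] by (intro bexI[of _ "\<lambda>z. h z + h' z"]) auto
  qed
qed

lemma approximable_mult:
  assumes "approximable r S f" "approximable r S g"
  shows "approximable r S (\<lambda>z. f z * g z)"
proof -
  obtain B where B: "B > 0" "\<And>z. z \<in> S \<Longrightarrow> coeffs_le (f z) B"
    "\<And>e. e > 0 \<Longrightarrow> \<exists>h\<in>regular_rational r S. \<forall>z\<in>S. coeffs_le (f z - h z) e" using approximableE[OF assms(1)] by metis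
  obtain C where C: "C > 0" "\<And>z. z \<in> S \<Longrightarrow> coeffs_le (g z) C"
    "\<And>e. e > 0 \<Longrightarrow> \<exists>h\<in>regular_rational r S. \<forall>z\<in>S. coeffs_le (g z - h z) e" using approximableE[OF assms(2)] by metis
  show ?thesis
    unfolding approximable_def
  proof (intro conjI allI impI)
    show "\<exists>D. \<forall>z\<in>S. coeffs_le (f z * g z) D"
      by (rule exI[of _ "B * C"]) (auto intro!: coeffs_le_mult B C)
    fix e :: real assume e: "e > 0"
    \<comment> \<open>\<open>d \<le> B\<close> keeps the approximant of \<open>f\<close> bounded by
      \<open>B\<close>; the other two bounds make each half of the split difference at most
      \<open>e\<close>.\<close>
    define d where "d = min (min B (e / B)) (e / C)"
    have d: "d > 0" "B * d \<le> e" "d * C \<le> e" "d \<le> B"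
    proof -
      show "d > 0" using e B(1) C(1) by (simp add: d_def)
      have "d \<le> e / B" "d \<le> e / C" by (simp_all add: d_def)
      then show "B * d \<le> e" "d * C \<le> e" using B(1) C(1) by (simp_all add: le_divide_eq mult.commute)
      show "d \<le> B" by (simp add: d_def)
    qed
    obtain h h' where h: "h \<in> regular_rational r S" "\<And>z. z \<in> S \<Longrightarrow> coeffs_le (f z - h z) d"
      and h': "h' \<in> regular_rational r S" "\<And>z. z \<in> S \<Longrightarrow> coeffs_le (g z - h' z) d" using B(3) C(3) d(1) by meson
    have "coeffs_le (f z * g z - h z * h' z) e" if z: "z \<in> S" for z
    proof -
      have "h z = f z - (f z - h z)" by simp
      then have hB: "coeffs_le (h z) B"
        using coeffs_le_diff[OF B(2)[OF z] coeffs_le_trans[OF h(2)[OF z] d(4)]] by simp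
      have "f z * g z - h z * h' z = (f z - h z) * g z + h z * (g z - h' z)" by (simp add: algebra_simps)
      moreover have "coeffs_le ((f z - h z) * g z) e"
        by (rule coeffs_le_trans[OF coeffs_le_mult[OF h(2)[OF z] C(2)[OF z]] d(3)])
      moreover have "coeffs_le (h z * (g z - h' z)) e"
        by (rule coeffs_le_trans[OF coeffs_le_mult[OF hB h'(2)[OF z]] d(2)])
      ultimately show ?thesis by (simp only: coeffs_le_add)
    qed
    then show "\<exists>h\<in>regular_rational r S. \<forall>z\<in>S. coeffs_le (f z * g z - h z) e"
      using regular_rational_mult[OF h(1) h'(1)] by (intro bexI[of _ "\<lambda>z. h z * h' z"]) auto
  qed
qed

lemma approximable_sum:
  "(\<And>i. i \<in> I \<Longrightarrow> approximable r S (f i)) \<Longrightarrow> approximable r S (\<lambda>z. \<Sum>i\<in>I. f i z)"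
  by (induction I rule: infinite_finite_induct) (auto intro: approximable_add approximable_const)

lemma approximable_prod:
  "(\<And>i. i \<in> I \<Longrightarrow> approximable r S (f i)) \<Longrightarrow> approximable r S (\<lambda>z. \<Prod>i\<in>I. f i z)"
  by (induction I rule: infinite_finite_induct) (auto intro: approximable_mult approximable_const)

context drinfeld_setting
begin

lemma regular_rational_inverse_alin:
  assumes r: "r > 0" and a: "a \<in> carrier_vec r" and S: "S \<subseteq> Omega r"
  shows "(\<lambda>z. fps_const (inverse (alin a z))) \<in> regular_rational r S"
proof (cases "a = 0\<^sub>v r")
  case True
  have "alin a z = 0" if "z \<in> S" for z using that S True alin_eq_0_iff[of z r a] a by auto
  then show ?thesis
    by (intro regular_rationalI[of "\<lambda>z. 0" r "\<lambda>z. 1"])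
      (auto intro: poly_funs_const simp: tate_units_def intro!: bexI[of _ 1])
next
  case False
  obtain m where m: "r = Suc m" using r by (cases r) auto
  let ?Q = "\<lambda>z. (\<Sum>i<m. fps_const (of_A (a $ i)) * fps_const (z $ i)) + fps_const (of_A (a $ m))"
  have Q: "?Q z = fps_const (alin a z)" if "z \<in> S" for z
  proof -
    have "z \<in> Omega r" using that S by blast
    then have "alin a z = (\<Sum>i<m. of_A (a $ i) * z $ i) + of_A (a $ m)"
      using a unfolding m by (simp add: alin_eq Omega_dim[of z "Suc m"]) (simp add: Omega_def)
    then show ?thesis by (intro fps_ext) (simp add: fps_sum_nth)
  qed
  show ?thesis
  proof (rule regular_rationalI[of "\<lambda>z. 1" r ?Q])
    show "?Q \<in> poly_funs r"
      by (intro poly_funs_add poly_funs_sum poly_funs_mult poly_funs_const poly_funs_var) (auto simp: m)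
    fix z assume z: "z \<in> S"
    then have nz: "alin a z \<noteq> 0" using False alin_eq_0_iff[of z r a] a S by auto
    then have "fps_const (alin a z) * fps_const (inverse (alin a z)) = 1" by simp
    then show "?Q z \<in> tate_units" unfolding Q[OF z] tate_units_def using tate_const by blast
    show "fps_const (inverse (alin a z)) = 1 * inverse (?Q z)"
      unfolding Q[OF z] by (simp add: fps_const_inverse)
  qed (auto intro: poly_funs_const)
qed

text \<open>Dividing \<open>a\<close> by its entry of largest absolute value gives a vector of norm
  1, to which the condition defining \<open>Omega_n\<close> applies; the norm of \<open>z\<close> is
  at least 1 because its last entry is 1.\<close>

lemma Omega_n_bound:
  assumes z: "z \<in> Omega_n r n" and r: "r > 0" and a: "a \<in> carrier_vec r" and i: "i < r"
  shows "inverse (real CARD('k)) ^ n * vabs (of_A (a $ i)) \<le> vabs (alin a z)"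
proof (cases "a $ i = 0")
  case False
  have zO: "z \<in> Omega r" using z by (simp add: Omega_n_def)
  have dim: "dim_vec z = r" by (rule Omega_dim[OF zO])
  let ?V = "(\<lambda>i. vabs (of_A (a $ i))) ` {..<r}"
  have "Max ?V \<in> ?V" by (rule Max_in) (use r in auto)
  then obtain i0 where i0: "i0 < r" "Max ?V = vabs (of_A (a $ i0))" by auto
  have le: "vabs (of_A (a $ j)) \<le> vabs (of_A (a $ i0))" if "j < r" for j
    unfolding i0(2)[symmetric] using that by (intro Max_ge) auto
  have "0 < vabs (of_A (a $ i))" using False by simp
  then have pos: "0 < vabs (of_A (a $ i0))" using le[OF i] by linarith
  then have ai0: "a $ i0 \<noteq> 0" by auto
  define b where "b = vec r (\<lambda>j. poly_to_Kinf (a $ j) / poly_to_Kinf (a $ i0))"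
  have b: "b \<in> carrier_vec r" by (simp add: b_def)
  have "vnorm (map_vec of_Kinf b) = 1"
    unfolding vnorm_def
  proof (rule Max_eqI)
    fix y assume "y \<in> (\<lambda>j. vabs (map_vec of_Kinf b $ j)) ` {..<dim_vec (map_vec of_Kinf b)}"
    then obtain j where "j < r" "y = vabs (of_A (a $ j)) / vabs (of_A (a $ i0))"
      by (auto simp: b_def of_Kinf_divide vabs_divide of_A_def)
    then show "y \<le> 1" using le[of j] pos by simp
  next
    show "1 \<in> (\<lambda>j. vabs (map_vec of_Kinf b $ j)) ` {..<dim_vec (map_vec of_Kinf b)}"
      using i0(1) ai0 by (intro image_eqI[of _ _ i0]) (auto simp: b_def)
  qed simp
  then have "real CARD('k) powi (- int n) * vnorm z \<le> vabs (lin_comb b z)"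
    using z b by (auto simp: Omega_n_def)
  moreover have "1 \<le> vnorm z"
  proof -
    have "vabs (z $ (r - 1)) \<le> vnorm z" unfolding vnorm_def using r dim by (intro Max_ge) auto
    then show ?thesis using zO by (simp add: Omega_def)
  qed
  moreover have "lin_comb b z = alin a z / of_A (a $ i0)"
    using a dim by (simp add: lin_comb_def alin_eq b_def of_Kinf_divide of_A_def sum_divide_distrib)
  moreover have "real CARD('k) powi (- int n) = inverse (real CARD('k)) ^ n"
    by (simp add: power_int_minus power_inverse)
  ultimately have "inverse (real CARD('k)) ^ n * 1 \<le> vabs (alin a z) / vabs (of_A (a $ i0))"
    by (metis (no_types, lifting) mult_left_mono order_trans vabs_divide zero_le_power inverse_nonnegative_iff_nonnegative of_nat_0_le_iff)
  then have "inverse (real CARD('k)) ^ n * vabs (of_A (a $ i0)) \<le> vabs (alin a z)"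
    using pos by (simp add: le_divide_eq)
  moreover have "inverse (real CARD('k)) ^ n * vabs (of_A (a $ i)) \<le> inverse (real CARD('k)) ^ n * vabs (of_A (a $ i0))"
    by (intro mult_left_mono le i) simp
  ultimately show ?thesis by linarith
qed simp

text \<open>On \<open>Omega_n\<close> the linear forms are bounded below by the size of their
  coefficients uniformly in \<open>z\<close>. Truncation to coefficients of degree below
  \<open>N\<close> therefore approximates uniformly, by finite sums of rational functions.\<close>

lemma approximable_eis:
  assumes r: "r > 0" and l: "l < r"
  shows "approximable r (Omega_n r n) (eis j l)"
  unfolding approximable_def
proof (intro conjI allI impI)
  let ?q = "real CARD('k)" and ?Q = "CARD('k) ^ j"
  have qpos: "0 < ?q" using q_ge_2 by simp
  have Q: "1 \<le> ?Q" using q_ge_2 by simp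
  have sub: "Omega_n r n \<subseteq> Omega r" by (auto simp: Omega_n_def)
  have inv: "vabs (inverse (alin a z)) \<le> ?q ^ n * inverse M"
    if "z \<in> Omega_n r n" "a \<in> carrier_vec r" "i < r" "M \<le> vabs (of_A (a $ i))" "M > 0" for a z i M
  proof -
    have "inverse ?q ^ n * M \<le> inverse ?q ^ n * vabs (of_A (a $ i))"
      using that(4) by (intro mult_left_mono) auto
    then have "inverse ?q ^ n * M \<le> vabs (alin a z)"
      using Omega_n_bound[OF that(1) r that(2,3)] by linarith
    then have "inverse (vabs (alin a z)) \<le> inverse (inverse ?q ^ n * M)"
      using that(5) qpos by (intro le_imp_inverse_le) auto
    then show ?thesis by (simp add: vabs_inverse power_inverse)
  qed
  have "coeffs_le (eis j l z) ((?q ^ n) ^ ?Q)" if z: "z \<in> Omega_n r n" for z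
    unfolding coeffs_le_def
  proof
    fix k
    show "vabs (fps_nth (eis j l z) k) \<le> (?q ^ n) ^ ?Q"
    proof (rule vabs_has_sum_le[OF eis_has_sum[OF subsetD[OF sub z]]])
      fix a :: "'k poly vec" assume a: "a \<in> carrier_vec r"
      have "vabs (inverse (alin a z)) \<le> ?q ^ n"
      proof (cases "a = 0\<^sub>v r")
        case True
        then show ?thesis using alin_eq_0_iff[OF subsetD[OF sub z] a] by simp
      next
        case False
        then obtain i where "i < r" "a $ i \<noteq> 0" using a by (metis carrier_vecD eq_vecI index_zero_vec(1,2))
        then show ?thesis using inv[OF z a, of i 1] vabs_of_A_ge_1[of "a $ i"] by simp
      qed
      then show "vabs (eis_term j l z k a) \<le> (?q ^ n) ^ ?Q"
        using order_trans[OF vabs_eis_term_le[of j l z k a, unfolded vabs_power] power_mono[OF _ vabs_nonneg]]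
        by blast
    qed simp
  qed
  then show "\<exists>B. \<forall>z\<in>Omega_n r n. coeffs_le (eis j l z) B" by blast
  fix e :: real assume e: "e > 0"
  have "0 < min 1 e" using e by simp
  \<comment> \<open>The tail terms are powers with exponent \<open>q^j\<close> of numbers at most
    \<open>min 1 e\<close>; the bound 1 ensures that the power does not increase them.\<close>
  then obtain N where N: "inverse ?q ^ N < min 1 e * inverse ?q ^ n"
    using real_arch_pow_inv[of "min 1 e * inverse ?q ^ n" "inverse ?q"] qpos real_q_gt_1
    by (auto simp: inverse_less_1_iff)
  have small: "?q ^ n * inverse (?q ^ N) \<le> min 1 e"
    using less_imp_le[OF N] qpos by (simp add: power_inverse field_simps)
  let ?S = "residues_vec r N"
  have "(\<lambda>z. eis_on ?S j l z) \<in> regular_rational r (Omega_n r n)"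
  proof -
    have "(\<lambda>z. \<Sum>a\<in>?S. fps_const (inverse (alin a z)) ^ ?Q * at_t (a $ l)) \<in> regular_rational r (Omega_n r n)"
      by (intro regular_rational_sum regular_rational_mult regular_rational_power regular_rational_const
          regular_rational_inverse_alin[OF r _ sub] finite_residues_vec) (auto simp: residues_vec_def)
    moreover have "eis_on ?S j l z = (\<Sum>a\<in>?S. fps_const (inverse (alin a z)) ^ ?Q * at_t (a $ l))" for z
      by (rule fps_ext)
        (simp add: eis_on_def infsum_finite[OF finite_residues_vec] fps_sum_nth eis_term_def at_t_nth
          mult.commute fps_const_power)
    ultimately show ?thesis by simp
  qed
  moreover have "coeffs_le (eis j l z - eis_on ?S j l z) e" if z: "z \<in> Omega_n r n" for z
    unfolding coeffs_le_def
  proof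
    fix k
    have zO: "z \<in> Omega r" using sub z by blast
    have "vabs (infsum (eis_term j l z k) (carrier_vec r) - sum (eis_term j l z k) ?S) \<le> e"
    proof (rule vabs_infsum_diff_le[OF vanishing_eis_term[OF zO] finite_residues_vec])
      show "?S \<subseteq> carrier_vec r" by (auto simp: residues_vec_def)
      fix a :: "'k poly vec" assume a: "a \<in> carrier_vec r - ?S"
      then obtain i where i: "i < r" "a $ i \<notin> polys_below N" by (auto simp: residues_vec_def)
      then have ai: "a $ i \<noteq> 0" "N \<le> Polynomial.degree (a $ i)"
        using polys_below_degree[of N "a $ i"] by (auto simp: polys_below_def coeff_eq_0 intro: ccontr)
      then have "?q ^ N \<le> vabs (of_A (a $ i))"
        using real_q_gt_1 by (simp add: vabs_of_A power_increasing)
      then have le: "vabs (inverse (alin a z)) \<le> min 1 e"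
        using inv[OF z _ i(1), of a "?q ^ N"] a small qpos by auto
      have "vabs (eis_term j l z k a) \<le> vabs (inverse (alin a z)) ^ ?Q"
        using vabs_eis_term_le[of j l z k a] by (simp add: vabs_power)
      also have "\<dots> \<le> vabs (inverse (alin a z)) ^ 1"
        using le Q by (intro power_decreasing) auto
      finally show "vabs (eis_term j l z k a) \<le> e" using le by simp
    qed (use e in simp)
    then show "vabs (fps_nth (eis j l z - eis_on ?S j l z) k) \<le> e"
      using Omega_dim[OF zO] by (simp add: eis_def eis_on_def infsum_finite[OF finite_residues_vec])
  qed
  ultimately show "\<exists>g\<in>regular_rational r (Omega_n r n). \<forall>z\<in>Omega_n r n. coeffs_le (eis j l z - g z) e"
    by blast
qed

lemma tate_signof: "signof \<pi> \<in> (tate :: 'c fps set)"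
  by (auto simp: sign_def tate_minus)

lemma approximable_eis_wedge:
  assumes r: "r > 0"
  shows "approximable r (Omega_n r n) (eis_wedge r i)"
proof -
  have "approximable r (Omega_n r n) (\<lambda>z. \<Sum>\<pi>\<in>{\<pi>. \<pi> permutes {0..<r}}. signof \<pi> *
      (\<Prod>j=0..<r. rows_mat r (\<lambda>j l. eis j l z) (\<lambda>l. if l = i then 1 else 0) $$ (j, \<pi> j)))"
  proof (intro approximable_sum approximable_mult approximable_prod approximable_const tate_signof)
    fix \<pi> :: "nat \<Rightarrow> nat" and j assume "\<pi> \<in> {\<pi>. \<pi> permutes {0..<r}}" "j \<in> {0..<r}"
    then have "\<pi> j < r" "j < r" using permutes_in_image[of \<pi> "{0..<r}" j] by auto
    then show "approximable r (Omega_n r n) (\<lambda>z. rows_mat r (\<lambda>j l. eis j l z) (\<lambda>l. if l = i then 1 else 0) $$ (j, \<pi> j))"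
      using approximable_eis[OF r, of "\<pi> j" n j]
      by (cases "j < r - 1"; cases "\<pi> j = i") (simp_all add: rows_mat_def approximable_const)
  qed
  then show ?thesis
    by (simp only: eis_wedge_eq[abs_def] vprod_def det_def'[OF rows_mat_carrier])
qed

lemma tate_eis_wedge:
  assumes z: "z \<in> Omega r"
  shows "eis_wedge r i z \<in> tate"
  unfolding eis_wedge_def
  by (rule tate_det[of _ r]) (auto simp: wedge_mat_def intro!: tate_eis[OF z])

theorem G_form_Hol:
  assumes r: "r > 0"
  shows "G_form r \<in> Hol r"
  unfolding Hol_def
proof (intro CollectI conjI ballI allI impI)
  fix z assume z: "z \<in> Omega r"
  show "G_form r z \<in> carrier_vec r" by (simp add: G_form_def)
  fix i assume "i < r"
  then show "G_form r z $ i \<in> tate" by (simp add: G_form_eq_eis_wedge[OF z r] tate_eis_wedge[OF z])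
next
  fix i n and e :: real assume i: "i < r" and e: "e > 0"
  then obtain g where g: "g \<in> regular_rational r (Omega_n r n)"
    "\<And>z. z \<in> Omega_n r n \<Longrightarrow> coeffs_le (eis_wedge r i z - g z) (e / 2)"
    using approximable_eis_wedge[OF r, of n i] unfolding approximable_def by (meson half_gt_zero)
  have "gauss_norm (G_form r z $ i - g z) < e" if z: "z \<in> Omega_n r n" for z
  proof -
    have "z \<in> Omega r" using z by (simp add: Omega_n_def)
    then show ?thesis
      using gauss_norm_le[OF g(2)[OF z]] i e by (simp add: G_form_eq_eis_wedge[OF _ r])
  qed
  then show "\<exists>f\<in>regular_rational r (Omega_n r n). \<forall>z\<in>Omega_n r n. gauss_norm (G_form r z $ i - f z) < e"
    using g(1) by blast
qed

end

section \<open>Existence of points and behaviour at the cusps\<close>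

context drinfeld_setting
begin

text \<open>For a root \<open>\<alpha>\<close> of \<open>X^r - \<theta>\<close>, the powers of \<open>\<alpha>\<close> below \<open>\<alpha>^r\<close> have
  absolute values in distinct classes modulo those of \<open>K\<^sub>\<infinity>\<close>.\<close>

lemma Omega_nonempty:
  assumes r: "r > 0"
  obtains z where "z \<in> Omega r"
proof -
  obtain a where a: "a ^ r = to_ac (fls_X_inv :: 'k fls)"
    using nth_root_exists[OF r] by blast
  define \<alpha> where "\<alpha> = \<iota> a"
  have emb_power: "\<iota> (x ^ n) = \<iota> x ^ n" for x n
    by (induction n) (simp_all add: emb_one emb_mult)
  have "\<alpha> ^ r = theta" by (simp add: \<alpha>_def theta_def of_Kinf_def a flip: emb_power)
  then have v: "vabs \<alpha> ^ r = real CARD('k)" by (metis vabs_power vabs_theta)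
  then have v0: "0 < vabs \<alpha>" using r q_ge_2 by (cases "\<alpha> = 0") (auto simp: power_0_left)
  define w where "w = vec r (\<lambda>i. \<alpha> ^ (r - 1 - i))"
  have distinct: "vabs (of_Kinf b * \<alpha> ^ m) \<noteq> vabs (of_Kinf b' * \<alpha> ^ m')"
    if b: "b \<noteq> 0" "b' \<noteq> 0" and m: "m < r" "m' < r" "m \<noteq> m'" for b b' m m'
  proof
    \<comment> \<open>The \<open>r\<close>-th power is an integral power of \<open>q\<close> whose
      exponent modulo \<open>r\<close> recovers \<open>m\<close>.\<close>
    have pw: "vabs (of_Kinf b * \<alpha> ^ m) ^ r
        = real CARD('k) powi (- fls_subdegree b * int r + int m)" if "b \<noteq> 0" for b m
    proof -
      have "(vabs \<alpha> ^ m) ^ r = real CARD('k) ^ m" by (metis v power_mult mult.commute)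
      moreover have "vabs (of_Kinf b) ^ r = real CARD('k) powi (- fls_subdegree b * int r)"
        by (simp only: vabs_of_Kinf[OF that] power_int_mult power_int_of_nat)
      moreover have "real CARD('k) powi (- fls_subdegree b * int r + int m)
          = real CARD('k) powi (- fls_subdegree b * int r) * real CARD('k) powi int m"
        using q_ge_2 by (intro power_int_add) simp
      ultimately show ?thesis by (simp add: vabs_mult vabs_power power_mult_distrib)
    qed
    assume "vabs (of_Kinf b * \<alpha> ^ m) = vabs (of_Kinf b' * \<alpha> ^ m')"
    then have "real CARD('k) powi (- fls_subdegree b * int r + int m)
        = real CARD('k) powi (- fls_subdegree b' * int r + int m')"
      using pw[OF b(1)] pw[OF b(2)] by metis
    then have "- fls_subdegree b * int r + int m = - fls_subdegree b' * int r + int m'"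
      using power_int_strict_increasing[OF _ real_q_gt_1] by (metis less_irrefl linorder_neqE)
    then have "(int m + - fls_subdegree b * int r) mod int r = (int m' + - fls_subdegree b' * int r) mod int r"
      by (simp only: add.commute)
    then have "int m mod int r = int m' mod int r" by (simp only: mod_mult_self1)
    then show False using m by simp
  qed
  have "w \<in> Omega r"
    unfolding Omega_def
  proof (intro CollectI conjI ballI impI)
    show "w \<in> carrier_vec r" "w $ (r - 1) = 1" using r by (simp_all add: w_def)
    fix b :: "'k fls vec" assume b: "b \<in> carrier_vec r" "lin_comb b w = 0"
    define t where "t i = of_Kinf (b $ i) * w $ i" for i
    show "b = 0\<^sub>v r"
    proof (rule ccontr)
      assume "b \<noteq> 0\<^sub>v r"
      then obtain i0 where i0: "i0 < r" "b $ i0 \<noteq> 0" using b(1) by (metis carrier_vecD eq_vecI index_zero_vec(1,2))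
      let ?V = "(\<lambda>i. vabs (t i)) ` {..<r}"
      have "Max ?V \<in> ?V" by (rule Max_in) (use r in auto)
      then obtain i where i: "i < r" "Max ?V = vabs (t i)" by auto
      have le: "vabs (t j) \<le> vabs (t i)" if "j < r" for j
        unfolding i(2)[symmetric] using that by (intro Max_ge) auto
      have "0 < vabs (t i0)" using i0 v0 by (simp add: t_def w_def)
      then have pos: "0 < vabs (t i)" using le[OF i0(1)] by linarith
      then have bi: "b $ i \<noteq> 0" by (auto simp: t_def)
      have "vabs (t j) < vabs (t i)" if j: "j \<in> {..<r} - {i}" for j
      proof (cases "b $ j = 0")
        case False
        have "r - 1 - j \<noteq> r - 1 - i" using i(1) j by auto
        then have "vabs (t j) \<noteq> vabs (t i)"
          using distinct[OF False bi, of "r - 1 - j" "r - 1 - i"] i(1) j by (auto simp: t_def w_def)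
        then show ?thesis using le[of j] j by auto
      qed (use pos in \<open>simp add: t_def\<close>)
      then have "vabs (\<Sum>j\<in>{..<r} - {i}. t j) < vabs (t i)" by (intro vabs_sum_less pos) auto
      then have "vabs ((\<Sum>j\<in>{..<r} - {i}. t j) + t i) = vabs (t i)" by (rule vabs_add_eq)
      moreover have "lin_comb b w = (\<Sum>j\<in>{..<r} - {i}. t j) + t i"
        using i(1) by (simp add: lin_comb_def t_def w_def sum.remove[of "{..<r}" i])
      ultimately show False using b(2) pos by simp
    qed
  qed
  then show ?thesis by (rule that)
qed

lemma weight_eq: "(CARD('k) ^ n - 1) div (CARD('k) - 1) = (\<Sum>j<n. CARD('k) ^ j)"
proof -
  have "(CARD('k) - 1) * (\<Sum>j<n. CARD('k) ^ j) = CARD('k) ^ n - 1"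
  proof (induction n)
    case (Suc n)
    have "1 \<le> CARD('k) ^ n" using q_ge_2 by simp
    then show ?case using Suc q_ge_2 by (simp add: distrib_left diff_mult_distrib)
  qed simp
  then show ?thesis using q_ge_2 by (metis nonzero_mult_div_cancel_left not_numeral_le_zero
      diff_is_0_eq numeral_le_one_iff order_trans semiring_norm(69))
qed

section \<open>Estimates at the cusps\<close>

lemma alin_split:
  assumes "dim_vec z = Suc m" "dim_vec a = Suc m"
  shows "alin a z = of_A (a $ 0) * z $ 0 + (\<Sum>i<m. of_A (a $ Suc i) * tl_vec z $ i)"
proof -
  have "alin a z = (\<Sum>i<Suc m. of_A (a $ i) * z $ i)" using assms by (simp add: alin_eq)
  then show ?thesis using assms(1) by (simp only: sum.lessThan_Suc_shift) (simp add: tl_vec_def)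
qed

text \<open>On the cusp domain \<open>z\<^sub>1\<close> is as far as possible from the span of the other entries, so it
  dominates every linear form in which it occurs.\<close>

lemma cusp_alin_ge:
  assumes z: "z \<in> cusp_domain r w" and r: "r \<ge> 2" and a: "a \<in> carrier_vec r" "a $ 0 \<noteq> 0"
  shows "vabs (z $ 0) \<le> vabs (alin a z)"
proof -
  have zO: "z \<in> Omega r" and w: "tl_vec z = w" and im: "vabs (z $ 0) = im_norm z"
    using z by (auto simp: cusp_domain_def)
  have dim: "dim_vec z = r" by (rule Omega_dim[OF zO])
  obtain m where m: "r = Suc m" using r by (cases r) auto
  \<comment> \<open>Division by \<open>a $ 0\<close> turns the form into \<open>z\<^sub>1\<close>
    minus a point of the span of the other entries. Undoing the division costs nothing, since a
    nonzero element of \<open>A\<close> has absolute value at least 1.\<close>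
  define b where "b = vec m (\<lambda>i. - poly_to_Kinf (a $ Suc i) / poly_to_Kinf (a $ 0))"
  have "im_norm z \<le> vabs (z $ 0 - lin_comb b (tl_vec z))"
    unfolding im_norm_def
    by (rule cINF_lower) (auto simp: b_def dim m intro!: bdd_belowI[of _ 0])
  also have "z $ 0 - lin_comb b (tl_vec z) = alin a z / of_A (a $ 0)"
  proof -
    have "alin a z = of_A (a $ 0) * z $ 0 + (\<Sum>i<m. of_A (a $ Suc i) * tl_vec z $ i)"
      using a dim m by (intro alin_split) auto
    moreover have "lin_comb b (tl_vec z) = - (\<Sum>i<m. of_A (a $ Suc i) * tl_vec z $ i) / of_A (a $ 0)"
      using dim m by (simp add: lin_comb_def tl_vec_def b_def of_Kinf_divide of_Kinf_minus of_A_def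
          sum_divide_distrib sum_negf)
    ultimately show ?thesis using a(2) by (simp add: field_simps)
  qed
  also have "vabs \<dots> \<le> vabs (alin a z)"
    using vabs_of_A_ge_1[OF a(2)] divide_left_mono[of 1 "vabs (of_A (a $ 0))" "vabs (alin a z)"] a(2)
    by (simp add: vabs_divide)
  finally show ?thesis unfolding im .
qed

text \<open>For each nonzero lattice point \<open>y\<close>, \<open>cusp_alin_ge\<close> bounds
  \<open>z\<^sub>1\<close> by \<open>z\<^sub>1 - y\<close>, so \<open>y\<close> is bounded by it as
  well. Every factor \<open>1 - z\<^sub>1 / y\<close> of the exponential thus has absolute value at
  least 1.\<close>

lemma cusp_u_param_le:
  assumes z: "z \<in> cusp_domain r w" and w: "w \<in> Omega (r - 1)" and r: "r \<ge> 2" and z0: "z $ 0 \<noteq> 0"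
  shows "vabs (u_param z) \<le> inverse (vabs carlitz_period) * inverse (vabs (z $ 0))"
proof -
  interpret L: discrete_subgroup "A_lattice w" by (rule A_lattice_discrete[OF w])
  have zO: "z \<in> Omega r" and tl: "tl_vec z = w" using z by (auto simp: cusp_domain_def)
  have dim: "dim_vec z = r" by (rule Omega_dim[OF zO])
  have dimw: "dim_vec w = r - 1" by (rule Omega_dim[OF w])
  obtain m where m: "r = Suc m" using r by (cases r) auto
  have "vabs (z $ 0) \<le> vabs (lattice_exp (A_lattice w) (z $ 0))"
  proof (rule L.vabs_lattice_exp_ge)
    fix y assume y: "y \<in> A_lattice w" "y \<noteq> 0"
    obtain a where a: "a \<in> carrier_vec (r - 1)" "y = alin a w" using y(1) by (auto simp: A_lattice_eq dimw)
    define a' where "a' = vec r (\<lambda>i. if i = 0 then 1 else - a $ (i - 1))"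
    have "alin a' z = z $ 0 - y"
      using a dimw m dim by (subst alin_split[of z m]) (simp_all add: a'_def tl alin_eq of_A_minus sum_negf)
    then have ge: "vabs (z $ 0) \<le> vabs (z $ 0 - y)"
      using cusp_alin_ge[OF z r, of a'] r by (simp add: a'_def)
    have "y = z $ 0 - (z $ 0 - y)" by simp
    then have "vabs y \<le> vabs (z $ 0 - y)"
      using vabs_diff_le_max[of "z $ 0" "z $ 0 - y"] ge by simp
    moreover have "1 - z $ 0 / y = - (z $ 0 - y) / y" using y(2) by (simp add: field_simps)
    ultimately show "1 \<le> vabs (1 - z $ 0 / y)"
      using y(2) by (simp only: vabs_divide vabs_minus) (simp add: le_divide_eq)
  qed
  then have "inverse (vabs (lattice_exp (A_lattice w) (z $ 0))) \<le> inverse (vabs (z $ 0))"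
    using z0 by (intro le_imp_inverse_le) auto
  then show ?thesis
    unfolding u_param_def tl vabs_mult vabs_inverse by (intro mult_left_mono) auto
qed

text \<open>Vectors with \<open>a $ l = 0\<close> contribute nothing. For \<open>l = 0\<close> only
  vectors that involve \<open>z\<^sub>1\<close> remain, which is the source of the decay at the
  cusps.\<close>

lemma coeffs_le_eis:
  assumes z: "z \<in> Omega r" and B: "0 \<le> B"
    and a: "\<And>a. a \<in> carrier_vec r \<Longrightarrow> a \<noteq> 0\<^sub>v r \<Longrightarrow> a $ l \<noteq> 0 \<Longrightarrow> vabs (inverse (alin a z)) ^ (CARD('k) ^ j) \<le> B"
  shows "coeffs_le (eis j l z) B"
  unfolding coeffs_le_def
proof
  fix n
  show "vabs (fps_nth (eis j l z) n) \<le> B"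
  proof (rule vabs_has_sum_le[OF eis_has_sum[OF z]])
    fix x :: "'k poly vec" assume x: "x \<in> carrier_vec r"
    show "vabs (eis_term j l z n x) \<le> B"
    proof (cases "x $ l = 0 \<or> x = 0\<^sub>v r")
      case True
      then have "eis_term j l z n x = 0"
        using alin_eq_0_iff[OF z x] by (auto simp: eis_term_def)
      then show ?thesis using B by simp
    next
      case False
      then show ?thesis using vabs_eis_term_le[of j l z n x] a[OF x] by (simp add: vabs_power)
    qed
  qed (rule B)
qed

text \<open>All Eisenstein entries are bounded, and those in column 0 are of size
  \<open>1 / |z\<^sub>1|\<close>. Every term of the determinant takes one entry from column 0; for
  \<open>i \<ge> 1\<close> it is never the 1 of the last row, so the term decays. For
  \<open>i = 0\<close> only boundedness remains, which is what the factor \<open>u_param\<close> in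
  the cusp condition compensates.\<close>

lemma cusp_bounds:
  assumes w: "w \<in> Omega (r - 1)" and r: "r \<ge> 2"
  obtains C where "C \<ge> 1"
    "\<And>z. z \<in> cusp_domain r w \<Longrightarrow> vabs (z $ 0) \<ge> 1 \<Longrightarrow> coeffs_le (eis_wedge r 0 z) C"
    "\<And>z i. z \<in> cusp_domain r w \<Longrightarrow> vabs (z $ 0) \<ge> 1 \<Longrightarrow> 1 \<le> i \<Longrightarrow> i < r \<Longrightarrow>
      coeffs_le (eis_wedge r i z) (C * inverse (vabs (z $ 0)))"
proof -
  obtain c where c: "c > 0" "\<And>a i. a \<in> carrier_vec (r - 1) \<Longrightarrow> i < r - 1 \<Longrightarrow> c * vabs (of_A (a $ i)) \<le> vabs (alin a w)"
    using Omega_bound[OF w] by metis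
  \<comment> \<open>The bound 1 serves the vectors that involve \<open>z\<^sub>1\<close>, the bound
    \<open>inverse c\<close> those that are linear forms in \<open>w\<close> alone. \<open>B\<close>
    then covers all exponents \<open>q^j\<close> with \<open>j < r\<close>.\<close>
  define M where "M = max 1 (inverse c)"
  define B where "B = M ^ (CARD('k) ^ r)"
  have M: "1 \<le> M" by (simp add: M_def)
  have B: "1 \<le> B" by (simp add: B_def M)
  obtain m where m: "r = Suc m" "m \<ge> 1" using r by (cases r) auto
  have dimw: "dim_vec w = m" using Omega_dim[OF w] m by simp
  have inv0: "vabs (inverse (alin a z)) \<le> inverse (vabs (z $ 0))"
    if z: "z \<in> cusp_domain r w" "vabs (z $ 0) \<ge> 1" and a: "a \<in> carrier_vec r" "a $ 0 \<noteq> 0" for a z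
    unfolding vabs_inverse using cusp_alin_ge[OF z(1) r a] z(2) by (intro le_imp_inverse_le) linarith+
  have inv: "vabs (inverse (alin a z)) \<le> M"
    if z: "z \<in> cusp_domain r w" "vabs (z $ 0) \<ge> 1" and a: "a \<in> carrier_vec r" "a \<noteq> 0\<^sub>v r" for a z
  proof (cases "a $ 0 = 0")
    case False
    have "inverse (vabs (z $ 0)) \<le> 1" using z(2) by (simp add: inverse_le_1_iff)
    then show ?thesis using inv0[OF z a(1) False] M by linarith
  next
    case True
    obtain i where i: "i < r" "a $ i \<noteq> 0" using a by (metis carrier_vecD eq_vecI index_zero_vec(1,2))
    then obtain i' where i': "i = Suc i'" using True by (cases i) auto
    let ?a = "vec m (\<lambda>i. a $ Suc i)"
    have zO: "z \<in> Omega r" and tl: "tl_vec z = w" using z by (auto simp: cusp_domain_def)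
    have "alin a z = alin ?a w"
      using a Omega_dim[OF zO] dimw m True
      by (subst alin_split[of z m]) (simp_all add: alin_eq tl)
    moreover have "c * vabs (of_A (?a $ i')) \<le> vabs (alin ?a w)"
      using i i' m by (intro c(2)) auto
    moreover have "c * 1 \<le> c * vabs (of_A (?a $ i'))"
      using i i' m c(1) by (intro mult_left_mono vabs_of_A_ge_1) auto
    ultimately have "c \<le> vabs (alin a z)" by simp
    then have "vabs (inverse (alin a z)) \<le> inverse c"
      unfolding vabs_inverse using c(1) by (intro le_imp_inverse_le)
    then show ?thesis by (simp add: M_def)
  qed
  have eisB: "coeffs_le (eis j l z) B" if z: "z \<in> cusp_domain r w" "vabs (z $ 0) \<ge> 1" and j: "j < r" for j l z
  proof (rule coeffs_le_eis)
    show "z \<in> Omega r" using z by (simp add: cusp_domain_def)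
    fix a :: "'k poly vec" assume a: "a \<in> carrier_vec r" "a \<noteq> 0\<^sub>v r"
    have "vabs (inverse (alin a z)) ^ (CARD('k) ^ j) \<le> M ^ (CARD('k) ^ j)"
      by (intro power_mono inv z a) auto
    also have "\<dots> \<le> B"
      unfolding B_def using M j q_ge_2 by (intro power_increasing) auto
    finally show "vabs (inverse (alin a z)) ^ (CARD('k) ^ j) \<le> B" .
  qed (use B in simp)
  have eis0: "coeffs_le (eis j 0 z) (inverse (vabs (z $ 0)))"
    if z: "z \<in> cusp_domain r w" "vabs (z $ 0) \<ge> 1" for j z
  proof (rule coeffs_le_eis)
    show "z \<in> Omega r" using z by (simp add: cusp_domain_def)
    fix a :: "'k poly vec" assume a: "a \<in> carrier_vec r" "a $ 0 \<noteq> 0"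
    have le1: "inverse (vabs (z $ 0)) \<le> 1" using z(2) by (simp add: inverse_le_1_iff)
    have "vabs (inverse (alin a z)) ^ (CARD('k) ^ j) \<le> vabs (inverse (alin a z)) ^ 1"
      using inv0[OF z a] le1 q_ge_2 by (intro power_decreasing) auto
    then show "vabs (inverse (alin a z)) ^ (CARD('k) ^ j) \<le> inverse (vabs (z $ 0))"
      using inv0[OF z a] by simp
  qed simp
  let ?e = "\<lambda>i z. rows_mat r (\<lambda>j l. eis j l z) (\<lambda>l. if l = i then 1 else 0)"
  have entry: "coeffs_le (?e i z $$ (j, l)) B"
    if z: "z \<in> cusp_domain r w" "vabs (z $ 0) \<ge> 1" and jl: "j < r" "l < r" for i j l z
    using eisB[OF z jl(1), of l] B jl coeffs_le_const[of "1::'c"]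
    by (auto simp: rows_mat_def coeffs_le_zero intro: coeffs_le_trans)
  have sign: "coeffs_le (signof \<pi> :: 'c fps) 1" for \<pi> :: "nat \<Rightarrow> nat"
    using coeffs_le_const[of "1::'c"] by (auto simp: sign_def intro: coeffs_le_minus)
  have wedge: "coeffs_le (eis_wedge r i z) D"
    if "D \<ge> 0" "\<And>\<pi>. \<pi> permutes {0..<r} \<Longrightarrow> coeffs_le (\<Prod>j=0..<r. ?e i z $$ (j, \<pi> j)) D" for i z D
    unfolding eis_wedge_eq vprod_def det_def'[OF rows_mat_carrier]
  proof (intro coeffs_le_sum that(1))
    fix \<pi> assume "\<pi> \<in> {\<pi>. \<pi> permutes {0..<r}}"
    then show "coeffs_le (signof \<pi> * (\<Prod>j=0..<r. ?e i z $$ (j, \<pi> j))) D"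
      using coeffs_le_mult[OF sign that(2)] by simp
  qed
  have perm: "\<pi> j < r" if "\<pi> permutes {0..<r}" "j < r" for \<pi> j
    using permutes_in_image[OF that(1), of j] that(2) by simp
  have "coeffs_le (eis_wedge r 0 z) (B ^ r)" if z: "z \<in> cusp_domain r w" "vabs (z $ 0) \<ge> 1" for z
  proof (rule wedge)
    fix \<pi> assume \<pi>: "\<pi> permutes {0..<r}"
    show "coeffs_le (\<Prod>j=0..<r. ?e 0 z $$ (j, \<pi> j)) (B ^ r)"
      using coeffs_le_prod[of "{0..<r}" "\<lambda>j. ?e 0 z $$ (j, \<pi> j)" "\<lambda>_. B"] entry[OF z] perm[OF \<pi>] by simp
  qed (use B in simp)
  moreover have "coeffs_le (eis_wedge r i z) (B ^ r * inverse (vabs (z $ 0)))"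
    if z: "z \<in> cusp_domain r w" "vabs (z $ 0) \<ge> 1" and i: "1 \<le> i" "i < r" for z i
  proof (rule wedge)
    fix \<pi> assume \<pi>: "\<pi> permutes {0..<r}"
    let ?f = "\<lambda>j. ?e i z $$ (j, \<pi> j)"
    obtain j0 where j0: "j0 < r" "\<pi> j0 = 0"
      using permutes_image[OF \<pi>] r by (metis atLeastLessThan_iff gr0I imageE not_numeral_le_zero zero_le)
    have 0: "coeffs_le (?f j0) (inverse (vabs (z $ 0)))"
      using eis0[OF z, of j0] j0 i by (auto simp: rows_mat_def coeffs_le_zero)
    have "coeffs_le (\<Prod>j\<in>{0..<r} - {j0}. ?f j) (B ^ (r - 1))"
      using coeffs_le_prod[of "{0..<r} - {j0}" ?f "\<lambda>_. B"] entry[OF z] perm[OF \<pi>] j0 by simp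
    then have "coeffs_le (\<Prod>j\<in>{0..<r} - {j0}. ?f j) (B ^ r)"
      by (rule coeffs_le_trans) (intro power_increasing B, simp)
    from coeffs_le_mult[OF this 0] show "coeffs_le (\<Prod>j=0..<r. ?f j) (B ^ r * inverse (vabs (z $ 0)))"
      using j0 by (simp add: prod.remove[of "{0..<r}" j0] mult.commute)
  qed (use B in simp)
  moreover have "1 \<le> B ^ r" using B by simp
  ultimately show ?thesis using that[of "B ^ r"] by blast
qed

theorem G_form_vect_forms:
  assumes r: "r \<ge> 2"
  shows "G_form r \<in> vect_forms r (\<Sum>j<r - 1. CARD('k) ^ j)"
  unfolding vect_forms_def
proof (intro CollectI conjI ballI allI impI)
  have r0: "r > 0" using r by simp
  show "G_form r \<in> Hol r" by (rule G_form_Hol[OF r0])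
  show "G_form r (act (map_mat poly_to_Kinf \<gamma>) z)
      = fps_const (jfac (map_mat poly_to_Kinf \<gamma>) z ^ (\<Sum>j<r - 1. CARD('k) ^ j)) \<cdot>\<^sub>v (rho \<gamma> *\<^sub>v G_form r z)"
    if \<gamma>: "\<gamma> \<in> GL_A r" and z: "z \<in> Omega r" for \<gamma> z
  proof -
    note GL = transpose_GL_surj[OF \<gamma>]
    have d: "det \<gamma> \<noteq> 0" using GL(3) by auto
    have z': "act (map_mat poly_to_Kinf \<gamma>) z \<in> Omega r" by (rule act_Omega[OF GL(2) d z r0])
    have "rho \<gamma> \<in> carrier_mat r r" using GL(2) by (simp add: rho_def bar_def)
    then show ?thesis
      unfolding G_form_eq_eis_wedge[OF z' r0] G_form_eq_eis_wedge[OF z r0]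
      by (intro eq_vecI) (auto simp: eis_wedge_modular[OF \<gamma> z r0])
  qed
  fix w and e :: real assume w: "w \<in> Omega (r - 1)" and e: "e > 0"
  obtain C where C: "C \<ge> 1"
    "\<And>z. z \<in> cusp_domain r w \<Longrightarrow> vabs (z $ 0) \<ge> 1 \<Longrightarrow> coeffs_le (eis_wedge r 0 z) C"
    "\<And>z i. z \<in> cusp_domain r w \<Longrightarrow> vabs (z $ 0) \<ge> 1 \<Longrightarrow> 1 \<le> i \<Longrightarrow> i < r \<Longrightarrow>
      coeffs_le (eis_wedge r i z) (C * inverse (vabs (z $ 0)))"
    using cusp_bounds[OF w r] by metis
  define P where "P = max 1 (inverse (vabs carlitz_period))"
  \<comment> \<open>Beyond \<open>vnorm w\<close> the norm of \<open>z\<close> is attained at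
    \<open>z\<^sub>1\<close>; the other two bounds make \<open>z\<^sub>1\<close> large enough for
    the estimates. \<open>P \<ge> 1\<close> lets one bound serve all components.\<close>
  define R where "R = max (vnorm w) (max 1 (P * C / e))"
  have big: "vabs (z $ 0) \<ge> 1" "P * C * inverse (vabs (z $ 0)) < e" "C * inverse (vabs (z $ 0)) < e"
    if z: "z \<in> cusp_domain r w" "vnorm z > R" for z
  proof -
    have dim: "dim_vec z = r" and tl: "tl_vec z = w" using z(1) Omega_dim by (auto simp: cusp_domain_def)
    let ?V = "(\<lambda>i. vabs (z $ i)) ` {..<r}"
    have "Max ?V \<in> ?V" by (rule Max_in) (use r0 in auto)
    then obtain i where i: "i < r" "vnorm z = vabs (z $ i)" unfolding vnorm_def dim by auto
    have "i = 0"
    proof (cases i)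
      case (Suc i')
      have "w $ i' = z $ i" "i' < dim_vec w"
        using i(1) dim by (auto simp: Suc tl[symmetric] tl_vec_def)
      then have "vabs (z $ i) \<le> vnorm w"
        unfolding vnorm_def by (intro Max_ge) (auto intro!: image_eqI[of _ _ i'])
      then show ?thesis using z(2) i(2) by (simp add: R_def)
    qed
    then have "vabs (z $ 0) > R" using z(2) i(2) by simp
    then have 1: "vabs (z $ 0) > 1" and 2: "vabs (z $ 0) > P * C / e" by (auto simp: R_def)
    show "vabs (z $ 0) \<ge> 1" using 1 by simp
    have "P * C < e * vabs (z $ 0)" using 2 e by (simp add: divide_less_eq mult.commute)
    then show lt: "P * C * inverse (vabs (z $ 0)) < e"
      using 1 e by (simp add: divide_inverse[symmetric] divide_less_eq)
    have "1 * C * inverse (vabs (z $ 0)) \<le> P * C * inverse (vabs (z $ 0))"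
      using C(1) by (intro mult_right_mono) (auto simp: P_def)
    then show "C * inverse (vabs (z $ 0)) < e" using lt by simp
  qed
  have "gauss_norm (fps_const (u_param z) * G_form r z $ 0) < e \<and> (\<forall>i\<in>{1..<r}. gauss_norm (G_form r z $ i) < e)"
    if z: "z \<in> cusp_domain r w" "vnorm z > R" for z
  proof
    note b = big[OF z]
    have zO: "z \<in> Omega r" using z(1) by (simp add: cusp_domain_def)
    have G: "G_form r z $ i = eis_wedge r i z" if "i < r" for i
      using that by (simp add: G_form_eq_eis_wedge[OF zO r0])
    have "z $ 0 \<noteq> 0" using b(1) by auto
    have "coeffs_le (fps_const (u_param z) * G_form r z $ 0) (vabs (u_param z) * C)"
      unfolding G[OF r0] by (intro coeffs_le_mult coeffs_le_const C(2) z(1) b(1))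
    then have "gauss_norm (fps_const (u_param z) * G_form r z $ 0) \<le> vabs (u_param z) * C" by (rule gauss_norm_le)
    also have "\<dots> \<le> (inverse (vabs carlitz_period) * inverse (vabs (z $ 0))) * C"
      using cusp_u_param_le[OF z(1) w r \<open>z $ 0 \<noteq> 0\<close>] C(1) by (intro mult_right_mono) auto
    also have "\<dots> \<le> (P * inverse (vabs (z $ 0))) * C"
      using C(1) by (intro mult_right_mono) (auto simp: P_def)
    also have "\<dots> < e" using b(2) by (simp add: mult_ac)
    finally show "gauss_norm (fps_const (u_param z) * G_form r z $ 0) < e" .
    show "\<forall>i\<in>{1..<r}. gauss_norm (G_form r z $ i) < e"
      using le_less_trans[OF gauss_norm_le[OF C(3)[OF z(1) b(1)]] b(3)] by (auto simp: G)
  qed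
  then show "\<exists>R. \<forall>z\<in>cusp_domain r w. R < vnorm z \<longrightarrow>
      gauss_norm (fps_const (u_param z) * G_form r z $ 0) < e \<and> (\<forall>i\<in>{1..<r}. gauss_norm (G_form r z $ i) < e)"
    by blast
qed

lemma G_form_hecke_eigenform:
  assumes r: "r \<ge> 2"
  shows "hecke_eigenform r (\<Sum>j<r - 1. CARD('k) ^ j) (G_form r)"
  unfolding hecke_eigenform_def
proof (intro conjI allI impI)
  have r0: "r > 0" using r by simp
  show "G_form r \<in> vect_forms r (\<Sum>j<r - 1. CARD('k) ^ j)" by (rule G_form_vect_forms[OF r])
  obtain z where "z \<in> Omega r" using Omega_nonempty[OF r0] .
  then show "\<exists>z\<in>Omega r. G_form r z \<noteq> 0\<^sub>v r" using G_form_nonzero r0 by blast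
  fix \<pp> :: "'k poly" assume p: "Factorial_Ring.irreducible \<pp> \<and> Polynomial.lead_coeff \<pp> = 1"
  then have "Polynomial.degree \<pp> \<noteq> 0"
    by (metis Factorial_Ring.irreducible_def is_unit_iff_degree)
  then show "\<exists>c\<in>tate. \<forall>z\<in>Omega r. hecke \<pp> r (\<Sum>j<r - 1. CARD('k) ^ j) (G_form r) z = c \<cdot>\<^sub>v G_form r z"
    using hecke_G_form[OF conjunct1[OF p] _ _ r0] tate_const by blast
qed

end

theorem theorem4p17:
  fixes \<iota> :: "'k::{field,finite} fls alg_closure \<Rightarrow> 'c::complete_nonarch_field"
    and \<kappa> :: 'c
    and r :: nat
    and \<pp> :: "'k poly"
  assumes "drinfeld_setting \<iota> \<kappa>"
    and "r \<ge> 2"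
    and "Polynomial.degree \<pp> > 0" and "Polynomial.lead_coeff \<pp> = 1"
    and "Factorial_Ring.irreducible \<pp>"
  shows "drinfeld_setting.G_form \<iota> \<kappa> r
           \<in> drinfeld_setting.vect_forms \<iota> \<kappa> r ((CARD('k) ^ (r - 1) - 1) div (CARD('k) - 1))
       \<and> drinfeld_setting.hecke_eigenform \<iota> \<kappa> r ((CARD('k) ^ (r - 1) - 1) div (CARD('k) - 1))
           (drinfeld_setting.G_form \<iota> \<kappa> r)
       \<and> (\<forall>z\<in>drinfeld_setting.Omega \<iota> r.
            drinfeld_setting.hecke \<iota> \<pp> r ((CARD('k) ^ (r - 1) - 1) div (CARD('k) - 1))
              (drinfeld_setting.G_form \<iota> \<kappa> r) z
            = fps_const (drinfeld_setting.of_A \<iota> \<pp> ^ (\<Sum>i\<le>r - 2. CARD('k) ^ i))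
                \<cdot>\<^sub>v drinfeld_setting.G_form \<iota> \<kappa> r z)"
proof -
  interpret drinfeld_setting \<iota> \<kappa> by (rule assms(1))
  have r: "r > 0" using assms(2) by simp
  \<comment> \<open>For \<open>r \<ge> 2\<close> the truncated subtraction is exact.\<close>
  have "{..r - 2} = {..<r - 1}" using assms(2) by auto
  then show ?thesis
    using G_form_vect_forms[OF assms(2)] G_form_hecke_eigenform[OF assms(2)]
      hecke_G_form[OF assms(5,3) _ r] by (simp only: weight_eq) blast
qed

end
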